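(* If $\Delta$ is a total C-Log theory containing no $\mathbf{New}$- and no $\mathbf{Select}$-expressions, then endogenous model expansion for $\Delta$ is in P (data complexity, $\Delta$ fixed).
   Context: Causal effect expressions (CEEs) over a relational vocabulary $\Sigma$ are built from atoms using $C'\leftarrow\varphi$, $C_1\ \mathbf{And}\ C_2$, $C_1\ \mathbf{Or}\ C_2$, $\mathbf{All}\,x[\varphi]:C'$, $\mathbf{Select}\,x[\varphi]:C'$ and $\mathbf{New}\,x:C'$ ($\varphi$ FO formulas); a C-Log theory is a CEE without free variables; endogenous symbols of $\Delta$ are the predicates occurring in its atom-expressions, others are exogenous. Semantics: a structure $\mathcal I$ is a model of $\Delta$ if for some selection function $\zeta$ (for each occurrence, depending on the values of its variable context: a chosen element for $\mathbf{Select}$, a branch in $\{1,2\}$ for $\mathbf{Or}$, an injective partial creation function for $\mathbf{New}$ with pairwise disjoint images) the pair $(\mathcal I,\mathcal I)$ is the well-founded fixpoint $w(A_\zeta)$ of the partial immediate causality operator $A_\zeta$ — mapping a three-valued structure $I$ to the structure giving every endogenous domain atom (and every non-initial domain element via an auxiliary predicate $\mathcal U$) its value in the Kleene-evaluated three-valued effect set of $\Delta$ in $I$ under $\zeta$ — and $\Delta$ succeeds with $\zeta$ in $\mathcal I$ (every relevant $\mathbf{Select}$ choice satisfies its qualification and every relevant creation is defined). A causal theory is total if for every selection function $\zeta$, $w(A_\zeta)$ is two-valued. Model expansion: input a partial structure $\mathcal I$ with finite two-valued domain; output a model of $\Delta$ more precise than $\mathcal I$ if one exists, "unsat" otherwise.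 Endogenous model expansion is the special case where $\mathcal I$ is two-valued on the exogenous symbols of $\Delta$ and completely unknown on the endogenous symbols. *)

theory Defs
  imports Main
begin

section \<open>Truth values and three-valued structures\<close>

text \<open>Truth order: \<open>FF < UU < TT\<close>. The lattice operations are those of Kleene's logic.\<close>

datatype tv = FF | UU | TT

instantiation tv :: complete_linorder
begin

definition less_eq_tv :: "tv \<Rightarrow> tv \<Rightarrow> bool" where
  "x \<le> y \<longleftrightarrow> x = FF \<or> y = TT \<or> x = y"
definition less_tv :: "tv \<Rightarrow> tv \<Rightarrow> bool" where
  "x < y \<longleftrightarrow> x \<le> y \<and> x \<noteq> (y :: tv)"
definition bot_tv :: tv where "bot = FF"
definition top_tv :: tv where "top = TT"
definition inf_tv :: "tv \<Rightarrow> tv \<Rightarrow> tv" where "inf x y = (if x \<le> y then x else (y :: tv))"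
definition sup_tv :: "tv \<Rightarrow> tv \<Rightarrow> tv" where "sup x y = (if x \<le> y then y else (x :: tv))"
definition Inf_tv :: "tv set \<Rightarrow> tv" where
  "Inf A = (if FF \<in> A then FF else if UU \<in> A then UU else TT)"
definition Sup_tv :: "tv set \<Rightarrow> tv" where
  "Sup A = (if TT \<in> A then TT else if UU \<in> A then UU else FF)"

instance
proof
  fix x y z :: tv and A :: "tv set"
  show "(x < y) = (x \<le> y \<and> \<not> y \<le> x)" by (auto simp: less_tv_def less_eq_tv_def)
  show "x \<le> x" by (simp add: less_eq_tv_def)
  show "x \<le> z" if "x \<le> y" "y \<le> z" using that by (auto simp: less_eq_tv_def)
  show "x = y" if "x \<le> y" "y \<le> x" using that by (auto simp: less_eq_tv_def)
  show "x \<le> y \<or> y \<le> x" by (cases x; cases y) (auto simp: less_eq_tv_def)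
  show "inf x y \<le> x" "inf x y \<le> y" "x \<le> sup x y" "y \<le> sup x y"
    by (cases x; cases y; simp add: inf_tv_def sup_tv_def min_def max_def less_eq_tv_def)+
  show "x \<le> inf y z" if "x \<le> y" "x \<le> z" using that by (simp add: inf_tv_def min_def)
  show "sup y z \<le> x" if "y \<le> x" "z \<le> x" using that by (simp add: sup_tv_def max_def)
  show "Inf A \<le> x" if "x \<in> A"
    using that by (cases x) (auto simp: Inf_tv_def less_eq_tv_def)
  show "x \<le> Inf A" if "\<And>y. y \<in> A \<Longrightarrow> x \<le> y"
    using that[of FF] that[of UU] by (cases x) (auto simp: Inf_tv_def less_eq_tv_def)
  show "x \<le> Sup A" if "x \<in> A"
    using that by (cases x) (auto simp: Sup_tv_def less_eq_tv_def)
  show "Sup A \<le> x" if "\<And>y. y \<in> A \<Longrightarrow> y \<le> x"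
    using that[of TT] that[of UU] by (cases x) (auto simp: Sup_tv_def less_eq_tv_def)
  show "Inf ({} :: tv set) = top" by (simp add: Inf_tv_def top_tv_def)
  show "Sup ({} :: tv set) = bot" by (simp add: Sup_tv_def bot_tv_def)
qed

end

primrec tv_not :: "tv \<Rightarrow> tv" where
  "tv_not FF = TT"
| "tv_not UU = UU"
| "tv_not TT = FF"

text \<open>Domain atoms: \<open>Elem d\<close> is the auxiliary atom stating that \<open>d\<close> belongs to the domain
  (the predicate \<open>\<U>\<close> for elements that are created), \<open>Atm p ds\<close> is an ordinary domain atom.
  A (partial) structure assigns a truth value to every domain atom; a (two-valued) structure is
  a partial structure in which no atom is \<open>UU\<close>.\<close>

datatype ('p, 'd) datom = Elem 'd | Atm 'p "'d list"

type_synonym ('p, 'd) pstr = "('p, 'd) datom \<Rightarrow> tv"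

definition two_valued :: "('a \<Rightarrow> tv) \<Rightarrow> bool" where
  "two_valued J \<longleftrightarrow> (\<forall>a. J a \<noteq> UU)"

definition less_precise :: "('a \<Rightarrow> tv) \<Rightarrow> ('a \<Rightarrow> tv) \<Rightarrow> bool"  (infix "\<le>\<^sub>p" 50) where
  "J \<le>\<^sub>p J' \<longleftrightarrow> (\<forall>a. J a = UU \<or> J a = J' a)"

text \<open>The vocabulary consists of the predicate symbols in the list \<open>\<Sigma>\<close> with arities \<open>ar\<close>; the
  order of the list only matters for the encoding of structures as words. Atoms outside the
  vocabulary, of the wrong arity, or about elements outside the domain are false.\<close>

definition partial_structure :: "'p list \<Rightarrow> ('p \<Rightarrow> nat) \<Rightarrow> ('p, 'd) pstr \<Rightarrow> bool" where
  "partial_structure \<Sigma> ar J \<longleftrightarrow> (\<exists>d. J (Elem d) \<noteq> FF) \<and>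
     (\<forall>p ds. p \<notin> set \<Sigma> \<or> length ds \<noteq> ar p \<or> (\<exists>d\<in>set ds. J (Elem d) = FF)
        \<longrightarrow> J (Atm p ds) = FF)"

definition structure_over :: "'p list \<Rightarrow> ('p \<Rightarrow> nat) \<Rightarrow> ('p, 'd) pstr \<Rightarrow> bool" where
  "structure_over \<Sigma> ar I \<longleftrightarrow> partial_structure \<Sigma> ar I \<and> two_valued I"


section \<open>First-order formulas and causal effect expressions\<close>

type_synonym var = nat

datatype 'p fo =
    Rel 'p "var list"
  | Eq var var
  | Neg "'p fo"
  | Conj "'p fo" "'p fo"
  | Disj "'p fo" "'p fo"
  | Forall var "'p fo"
  | Exists var "'p fo"

primrec fv_fo :: "'p fo \<Rightarrow> var set" where
  "fv_fo (Rel p xs) = set xs"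
| "fv_fo (Eq x y) = {x, y}"
| "fv_fo (Neg \<phi>) = fv_fo \<phi>"
| "fv_fo (Conj \<phi> \<psi>) = fv_fo \<phi> \<union> fv_fo \<psi>"
| "fv_fo (Disj \<phi> \<psi>) = fv_fo \<phi> \<union> fv_fo \<psi>"
| "fv_fo (Forall x \<phi>) = fv_fo \<phi> - {x}"
| "fv_fo (Exists x \<phi>) = fv_fo \<phi> - {x}"

primrec wf_fo :: "'p list \<Rightarrow> ('p \<Rightarrow> nat) \<Rightarrow> 'p fo \<Rightarrow> bool" where
  "wf_fo \<Sigma> ar (Rel p xs) \<longleftrightarrow> p \<in> set \<Sigma> \<and> length xs = ar p"
| "wf_fo \<Sigma> ar (Eq x y) \<longleftrightarrow> True"
| "wf_fo \<Sigma> ar (Neg \<phi>) \<longleftrightarrow> wf_fo \<Sigma> ar \<phi>"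
| "wf_fo \<Sigma> ar (Conj \<phi> \<psi>) \<longleftrightarrow> wf_fo \<Sigma> ar \<phi> \<and> wf_fo \<Sigma> ar \<psi>"
| "wf_fo \<Sigma> ar (Disj \<phi> \<psi>) \<longleftrightarrow> wf_fo \<Sigma> ar \<phi> \<and> wf_fo \<Sigma> ar \<psi>"
| "wf_fo \<Sigma> ar (Forall x \<phi>) \<longleftrightarrow> wf_fo \<Sigma> ar \<phi>"
| "wf_fo \<Sigma> ar (Exists x \<phi>) \<longleftrightarrow> wf_fo \<Sigma> ar \<phi>"

text \<open>Kleene evaluation; \<open>D\<close> is a set containing all elements that may belong to the domain of
  \<open>J\<close>, so quantifiers are relativised to the (three-valued) domain of \<open>J\<close>.\<close>

primrec kleene :: "'d set \<Rightarrow> ('p, 'd) pstr \<Rightarrow> (var \<Rightarrow> 'd) \<Rightarrow> 'p fo \<Rightarrow> tv" where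
  "kleene D J \<sigma> (Rel p xs) = J (Atm p (map \<sigma> xs))"
| "kleene D J \<sigma> (Eq x y) = (if \<sigma> x = \<sigma> y then TT else FF)"
| "kleene D J \<sigma> (Neg \<phi>) = tv_not (kleene D J \<sigma> \<phi>)"
| "kleene D J \<sigma> (Conj \<phi> \<psi>) = min (kleene D J \<sigma> \<phi>) (kleene D J \<sigma> \<psi>)"
| "kleene D J \<sigma> (Disj \<phi> \<psi>) = max (kleene D J \<sigma> \<phi>) (kleene D J \<sigma> \<psi>)"
| "kleene D J \<sigma> (Forall x \<phi>) =
     (INF d\<in>D. max (tv_not (J (Elem d))) (kleene D J (\<sigma>(x := d)) \<phi>))"
| "kleene D J \<sigma> (Exists x \<phi>) =
     (SUP d\<in>D. min (J (Elem d)) (kleene D J (\<sigma>(x := d)) \<phi>))"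

datatype 'p cee =
    Atom 'p "var list"
  | Rule "'p cee" "'p fo"             (* C' \<leftarrow> \<phi> *)
  | And "'p cee" "'p cee"
  | Or "'p cee" "'p cee"
  | All var "'p fo" "'p cee"          (* All x[\<phi>]: C' *)
  | Select var "'p fo" "'p cee"       (* Select x[\<phi>]: C' *)
  | New var "'p cee"                  (* New x: C' *)

primrec fv_cee :: "'p cee \<Rightarrow> var set" where
  "fv_cee (Atom p xs) = set xs"
| "fv_cee (Rule C \<phi>) = fv_cee C \<union> fv_fo \<phi>"
| "fv_cee (And C1 C2) = fv_cee C1 \<union> fv_cee C2"
| "fv_cee (Or C1 C2) = fv_cee C1 \<union> fv_cee C2"
| "fv_cee (All x \<phi> C) = (fv_fo \<phi> \<union> fv_cee C) - {x}"
| "fv_cee (Select x \<phi> C) = (fv_fo \<phi> \<union> fv_cee C) - {x}"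
| "fv_cee (New x C) = fv_cee C - {x}"

primrec wf_cee :: "'p list \<Rightarrow> ('p \<Rightarrow> nat) \<Rightarrow> 'p cee \<Rightarrow> bool" where
  "wf_cee \<Sigma> ar (Atom p xs) \<longleftrightarrow> p \<in> set \<Sigma> \<and> length xs = ar p"
| "wf_cee \<Sigma> ar (Rule C \<phi>) \<longleftrightarrow> wf_cee \<Sigma> ar C \<and> wf_fo \<Sigma> ar \<phi>"
| "wf_cee \<Sigma> ar (And C1 C2) \<longleftrightarrow> wf_cee \<Sigma> ar C1 \<and> wf_cee \<Sigma> ar C2"
| "wf_cee \<Sigma> ar (Or C1 C2) \<longleftrightarrow> wf_cee \<Sigma> ar C1 \<and> wf_cee \<Sigma> ar C2"
| "wf_cee \<Sigma> ar (All x \<phi> C) \<longleftrightarrow> wf_fo \<Sigma> ar \<phi> \<and> wf_cee \<Sigma> ar C"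
| "wf_cee \<Sigma> ar (Select x \<phi> C) \<longleftrightarrow> wf_fo \<Sigma> ar \<phi> \<and> wf_cee \<Sigma> ar C"
| "wf_cee \<Sigma> ar (New x C) \<longleftrightarrow> wf_cee \<Sigma> ar C"

definition clog_theory :: "'p list \<Rightarrow> ('p \<Rightarrow> nat) \<Rightarrow> 'p cee \<Rightarrow> bool" where
  "clog_theory \<Sigma> ar \<Delta> \<longleftrightarrow> distinct \<Sigma> \<and> wf_cee \<Sigma> ar \<Delta> \<and> fv_cee \<Delta> = {}"

primrec endogenous :: "'p cee \<Rightarrow> 'p set" where
  "endogenous (Atom p xs) = {p}"
| "endogenous (Rule C \<phi>) = endogenous C"
| "endogenous (And C1 C2) = endogenous C1 \<union> endogenous C2"
| "endogenous (Or C1 C2) = endogenous C1 \<union> endogenous C2"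
| "endogenous (All x \<phi> C) = endogenous C"
| "endogenous (Select x \<phi> C) = endogenous C"
| "endogenous (New x C) = endogenous C"


section \<open>Selection functions and effect sets\<close>

text \<open>An occurrence of a subexpression is identified by its path in the parse tree (a list of
  child numbers 1 or 2, innermost first). \<open>occs \<Delta> [] 0\<close> is the set of all triples of the path of
  an occurrence, the length of its variable context, and the expression at that occurrence.\<close>

type_synonym path = "nat list"

primrec occs :: "'p cee \<Rightarrow> path \<Rightarrow> nat \<Rightarrow> (path \<times> nat \<times> 'p cee) set" where
  "occs (Atom p xs) \<pi> n = {(\<pi>, n, Atom p xs)}"
| "occs (Rule C \<phi>) \<pi> n = insert (\<pi>, n, Rule C \<phi>) (occs C (1 # \<pi>) n)"
| "occs (And C1 C2) \<pi> n =
     insert (\<pi>, n, And C1 C2) (occs C1 (1 # \<pi>) n \<union> occs C2 (2 # \<pi>) n)"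
| "occs (Or C1 C2) \<pi> n =
     insert (\<pi>, n, Or C1 C2) (occs C1 (1 # \<pi>) n \<union> occs C2 (2 # \<pi>) n)"
| "occs (All x \<phi> C) \<pi> n = insert (\<pi>, n, All x \<phi> C) (occs C (1 # \<pi>) (Suc n))"
| "occs (Select x \<phi> C) \<pi> n = insert (\<pi>, n, Select x \<phi> C) (occs C (1 # \<pi>) (Suc n))"
| "occs (New x C) \<pi> n = insert (\<pi>, n, New x C) (occs C (1 # \<pi>) (Suc n))"

definition is_new :: "'p cee \<Rightarrow> bool" where "is_new C \<longleftrightarrow> (\<exists>x C'. C = New x C')"
definition is_select :: "'p cee \<Rightarrow> bool" where "is_select C \<longleftrightarrow> (\<exists>x \<phi> C'. C = Select x \<phi> C')"
definition is_or :: "'p cee \<Rightarrow> bool" where "is_or C \<longleftrightarrow> (\<exists>C1 C2. C = Or C1 C2)"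

definition contains_new :: "'p cee \<Rightarrow> bool" where
  "contains_new \<Delta> \<longleftrightarrow> (\<exists>(\<pi>, n, C)\<in>occs \<Delta> [] 0. is_new C)"
definition contains_select :: "'p cee \<Rightarrow> bool" where
  "contains_select \<Delta> \<longleftrightarrow> (\<exists>(\<pi>, n, C)\<in>occs \<Delta> [] 0. is_select C)"

text \<open>A selection in the set \<open>base\<close>. The second argument of the choice functions is the tuple of
  values of the variable context of the occurrence, innermost variable first.\<close>

record 'd selection =
  base :: "'d set"
  selc :: "path \<Rightarrow> 'd list \<Rightarrow> 'd"
  orc :: "path \<Rightarrow> 'd list \<Rightarrow> nat"
  newc :: "path \<Rightarrow> 'd list \<Rightarrow> 'd option"

definition tuples_over :: "'d set \<Rightarrow> nat \<Rightarrow> 'd list set" where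
  "tuples_over D n = {ds. set ds \<subseteq> D \<and> length ds = n}"

text \<open>The pairs of a \<open>New\<close>-occurrence and a value of its variable context.\<close>

definition new_instances :: "'p cee \<Rightarrow> 'd set \<Rightarrow> (path \<times> 'd list) set" where
  "new_instances \<Delta> D =
     {(\<pi>, ds). \<exists>n C. (\<pi>, n, C) \<in> occs \<Delta> [] 0 \<and> is_new C \<and> ds \<in> tuples_over D n}"

text \<open>The last conjunct says at once that every creation function is injective and that the
  images of different creation functions are disjoint.\<close>

definition is_selection :: "'p cee \<Rightarrow> 'd selection \<Rightarrow> bool" where
  "is_selection \<Delta> \<zeta> \<longleftrightarrow> base \<zeta> \<noteq> {} \<and>
     (\<forall>(\<pi>, n, C)\<in>occs \<Delta> [] 0. \<forall>ds\<in>tuples_over (base \<zeta>) n.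
        (is_select C \<longrightarrow> selc \<zeta> \<pi> ds \<in> base \<zeta>) \<and>
        (is_or C \<longrightarrow> orc \<zeta> \<pi> ds \<in> {1, 2}) \<and>
        (is_new C \<longrightarrow> set_option (newc \<zeta> \<pi> ds) \<subseteq> base \<zeta>)) \<and>
     (\<forall>(\<pi>, ds)\<in>new_instances \<Delta> (base \<zeta>). \<forall>(\<pi>', ds')\<in>new_instances \<Delta> (base \<zeta>). \<forall>e.
        newc \<zeta> \<pi> ds = Some e \<longrightarrow> newc \<zeta> \<pi>' ds' = Some e \<longrightarrow> (\<pi>, ds) = (\<pi>', ds'))"

definition initial :: "'p cee \<Rightarrow> 'd selection \<Rightarrow> 'd set" where
  "initial \<Delta> \<zeta> =
     base \<zeta> - {e. \<exists>(\<pi>, ds)\<in>new_instances \<Delta> (base \<zeta>). newc \<zeta> \<pi> ds = Some e}"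

text \<open>A variable context together with values for its variables is an association list with the
  innermost variable at the head, so that inner bindings shadow outer ones.\<close>

type_synonym 'd ctx = "(var \<times> 'd) list"

definition env :: "'d ctx \<Rightarrow> var \<Rightarrow> 'd" where "env \<Gamma> x = the (map_of \<Gamma> x)"
definition vals :: "'d ctx \<Rightarrow> 'd list" where "vals \<Gamma> = map snd \<Gamma>"

primrec effect :: "'d selection \<Rightarrow> ('p, 'd) pstr \<Rightarrow> 'p cee \<Rightarrow> path \<Rightarrow> 'd ctx \<Rightarrow> ('p, 'd) datom \<Rightarrow> tv"
where
  "effect \<zeta> J (Atom p xs) \<pi> \<Gamma> a = (if a = Atm p (map (env \<Gamma>) xs) then TT else FF)"
| "effect \<zeta> J (Rule C \<phi>) \<pi> \<Gamma> a =
     min (kleene (base \<zeta>) J (env \<Gamma>) \<phi>) (effect \<zeta> J C (1 # \<pi>) \<Gamma> a)"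
| "effect \<zeta> J (And C1 C2) \<pi> \<Gamma> a =
     max (effect \<zeta> J C1 (1 # \<pi>) \<Gamma> a) (effect \<zeta> J C2 (2 # \<pi>) \<Gamma> a)"
| "effect \<zeta> J (Or C1 C2) \<pi> \<Gamma> a =
     (if orc \<zeta> \<pi> (vals \<Gamma>) = 1 then effect \<zeta> J C1 (1 # \<pi>) \<Gamma> a
      else effect \<zeta> J C2 (2 # \<pi>) \<Gamma> a)"
| "effect \<zeta> J (All x \<phi> C) \<pi> \<Gamma> a =
     (SUP d\<in>base \<zeta>. min (min (J (Elem d)) (kleene (base \<zeta>) J (env ((x, d) # \<Gamma>)) \<phi>))
        (effect \<zeta> J C (1 # \<pi>) ((x, d) # \<Gamma>) a))"
| "effect \<zeta> J (Select x \<phi> C) \<pi> \<Gamma> a =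
     (let d = selc \<zeta> \<pi> (vals \<Gamma>) in
        min (min (J (Elem d)) (kleene (base \<zeta>) J (env ((x, d) # \<Gamma>)) \<phi>))
          (effect \<zeta> J C (1 # \<pi>) ((x, d) # \<Gamma>) a))"
| "effect \<zeta> J (New x C) \<pi> \<Gamma> a =
     (case newc \<zeta> \<pi> (vals \<Gamma>) of
        None \<Rightarrow> FF
      | Some d \<Rightarrow> max (if a = Elem d then TT else FF) (effect \<zeta> J C (1 # \<pi>) ((x, d) # \<Gamma>) a))"

text \<open>The partial immediate causality operator for a fixed interpretation \<open>E\<close> of the exogenous
  symbols; \<open>E\<close> is only consulted on exogenous atoms.\<close>

definition causality_op ::
  "'p cee \<Rightarrow> 'd selection \<Rightarrow> ('p, 'd) pstr \<Rightarrow> ('p, 'd) pstr \<Rightarrow> ('p, 'd) pstr" where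
  "causality_op \<Delta> \<zeta> E J a =
     (case a of
        Elem d \<Rightarrow> if d \<in> initial \<Delta> \<zeta> then TT else effect \<zeta> J \<Delta> [] [] a
      | Atm p ds \<Rightarrow> if p \<in> endogenous \<Delta> then effect \<zeta> J \<Delta> [] [] a else E a)"


section \<open>Well-founded fixpoints of approximators\<close>

text \<open>A three-valued set \<open>J\<close> is the consistent pair of two-valued sets \<open>(lower J, upper J)\<close>; for
  \<open>X \<subseteq> Y\<close>, the three-valued set given by \<open>(X, Y)\<close> is \<open>of_pair X Y\<close>. As in approximation fixpoint
  theory, a pair \<open>(x, y)\<close> is a stable fixpoint of \<open>A\<close> if \<open>x\<close> is the least fixpoint of
  \<open>A(\<cdot>, y)\<^sub>1\<close> on the interval from bottom to \<open>y\<close> and \<open>y\<close> is the least fixpoint of \<open>A(x, \<cdot>)\<^sub>2\<close> on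
  the interval from \<open>x\<close> to top; the well-founded fixpoint is the least precise stable fixpoint.\<close>

definition lower :: "('a \<Rightarrow> tv) \<Rightarrow> 'a set" where "lower J = {a. J a = TT}"
definition upper :: "('a \<Rightarrow> tv) \<Rightarrow> 'a set" where "upper J = {a. J a \<noteq> FF}"

definition of_pair :: "'a set \<Rightarrow> 'a set \<Rightarrow> 'a \<Rightarrow> tv" where
  "of_pair X Y a = (if a \<in> X then TT else if a \<in> Y then UU else FF)"

definition least_fixpoint_on :: "'a set set \<Rightarrow> ('a set \<Rightarrow> 'a set) \<Rightarrow> 'a set \<Rightarrow> bool" where
  "least_fixpoint_on S F X \<longleftrightarrow> X \<in> S \<and> F X = X \<and> (\<forall>Z\<in>S. F Z = Z \<longrightarrow> X \<subseteq> Z)"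

definition stable_fixpoint :: "(('a \<Rightarrow> tv) \<Rightarrow> ('a \<Rightarrow> tv)) \<Rightarrow> ('a \<Rightarrow> tv) \<Rightarrow> bool" where
  "stable_fixpoint A J \<longleftrightarrow>
     least_fixpoint_on {X. X \<subseteq> upper J} (\<lambda>X. lower (A (of_pair X (upper J)))) (lower J) \<and>
     least_fixpoint_on {Y. lower J \<subseteq> Y} (\<lambda>Y. upper (A (of_pair (lower J) Y))) (upper J)"

definition wf_fixpoint :: "(('a \<Rightarrow> tv) \<Rightarrow> ('a \<Rightarrow> tv)) \<Rightarrow> ('a \<Rightarrow> tv)" where
  "wf_fixpoint A =
     (THE J. stable_fixpoint A J \<and> (\<forall>J'. stable_fixpoint A J' \<longrightarrow> J \<le>\<^sub>p J'))"


section \<open>Models and total theories\<close>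

inductive relevant ::
  "'p cee \<Rightarrow> 'd selection \<Rightarrow> ('p, 'd) pstr \<Rightarrow> 'p cee \<Rightarrow> path \<Rightarrow> 'd ctx \<Rightarrow> bool"
  for \<Delta> :: "'p cee" and \<zeta> :: "'d selection" and I :: "('p, 'd) pstr"
where
  "relevant \<Delta> \<zeta> I \<Delta> [] []"
| "relevant \<Delta> \<zeta> I (Rule C \<phi>) \<pi> \<Gamma> \<Longrightarrow> kleene (base \<zeta>) I (env \<Gamma>) \<phi> = TT
   \<Longrightarrow> relevant \<Delta> \<zeta> I C (1 # \<pi>) \<Gamma>"
| "relevant \<Delta> \<zeta> I (And C1 C2) \<pi> \<Gamma> \<Longrightarrow> relevant \<Delta> \<zeta> I C1 (1 # \<pi>) \<Gamma>"
| "relevant \<Delta> \<zeta> I (And C1 C2) \<pi> \<Gamma> \<Longrightarrow> relevant \<Delta> \<zeta> I C2 (2 # \<pi>) \<Gamma>"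
| "relevant \<Delta> \<zeta> I (Or C1 C2) \<pi> \<Gamma> \<Longrightarrow> orc \<zeta> \<pi> (vals \<Gamma>) = 1 \<Longrightarrow> relevant \<Delta> \<zeta> I C1 (1 # \<pi>) \<Gamma>"
| "relevant \<Delta> \<zeta> I (Or C1 C2) \<pi> \<Gamma> \<Longrightarrow> orc \<zeta> \<pi> (vals \<Gamma>) = 2 \<Longrightarrow> relevant \<Delta> \<zeta> I C2 (2 # \<pi>) \<Gamma>"
| "relevant \<Delta> \<zeta> I (All x \<phi> C) \<pi> \<Gamma> \<Longrightarrow> I (Elem d) = TT
   \<Longrightarrow> kleene (base \<zeta>) I (env ((x, d) # \<Gamma>)) \<phi> = TT \<Longrightarrow> relevant \<Delta> \<zeta> I C (1 # \<pi>) ((x, d) # \<Gamma>)"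
| "relevant \<Delta> \<zeta> I (Select x \<phi> C) \<pi> \<Gamma> \<Longrightarrow> d = selc \<zeta> \<pi> (vals \<Gamma>) \<Longrightarrow> I (Elem d) = TT
   \<Longrightarrow> kleene (base \<zeta>) I (env ((x, d) # \<Gamma>)) \<phi> = TT \<Longrightarrow> relevant \<Delta> \<zeta> I C (1 # \<pi>) ((x, d) # \<Gamma>)"
| "relevant \<Delta> \<zeta> I (New x C) \<pi> \<Gamma> \<Longrightarrow> newc \<zeta> \<pi> (vals \<Gamma>) = Some d
   \<Longrightarrow> relevant \<Delta> \<zeta> I C (1 # \<pi>) ((x, d) # \<Gamma>)"

definition succeeds :: "'p cee \<Rightarrow> 'd selection \<Rightarrow> ('p, 'd) pstr \<Rightarrow> bool" where
  "succeeds \<Delta> \<zeta> I \<longleftrightarrow>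
     (\<forall>x \<phi> C \<pi> \<Gamma>. relevant \<Delta> \<zeta> I (Select x \<phi> C) \<pi> \<Gamma> \<longrightarrow>
        (let d = selc \<zeta> \<pi> (vals \<Gamma>) in
           I (Elem d) = TT \<and> kleene (base \<zeta>) I (env ((x, d) # \<Gamma>)) \<phi> = TT)) \<and>
     (\<forall>x C \<pi> \<Gamma>. relevant \<Delta> \<zeta> I (New x C) \<pi> \<Gamma> \<longrightarrow> newc \<zeta> \<pi> (vals \<Gamma>) \<noteq> None)"

definition is_model :: "'p list \<Rightarrow> ('p \<Rightarrow> nat) \<Rightarrow> 'p cee \<Rightarrow> ('p, 'd) pstr \<Rightarrow> bool" where
  "is_model \<Sigma> ar \<Delta> I \<longleftrightarrow> structure_over \<Sigma> ar I \<and>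
     (\<exists>\<zeta>. is_selection \<Delta> \<zeta> \<and> wf_fixpoint (causality_op \<Delta> \<zeta> I) = I \<and> succeeds \<Delta> \<zeta> I)"

text \<open>Selections range over all nonempty sets of natural numbers, i.e. (up to isomorphism) over
  all nonempty countable sets; the exogenous symbols range over all interpretations on the base
  set of the selection.\<close>

definition total_theory :: "'p list \<Rightarrow> ('p \<Rightarrow> nat) \<Rightarrow> 'p cee \<Rightarrow> bool" where
  "total_theory \<Sigma> ar \<Delta> \<longleftrightarrow>
     (\<forall>(\<zeta> :: nat selection) E. is_selection \<Delta> \<zeta> \<and> structure_over \<Sigma> ar E \<and>
        {d. E (Elem d) = TT} = base \<zeta> \<longrightarrow> two_valued (wf_fixpoint (causality_op \<Delta> \<zeta> E)))"


section \<open>Polynomial time\<close>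

text \<open>Deterministic multi-tape Turing machines with two-way infinite tapes. Symbol 0 is the blank,
  tape 0 is the input tape and tape 1 the output tape.\<close>

record tm =
  tm_tapes :: nat
  tm_states :: "nat set"
  tm_symbols :: "nat set"
  tm_start :: nat
  tm_halt :: nat
  tm_delta :: "nat \<Rightarrow> nat list \<Rightarrow> nat \<times> (nat \<times> int) list"

definition tm_wf :: "tm \<Rightarrow> bool" where
  "tm_wf M \<longleftrightarrow> 2 \<le> tm_tapes M \<and> finite (tm_states M) \<and> finite (tm_symbols M) \<and>
     0 \<in> tm_symbols M \<and> tm_start M \<in> tm_states M \<and> tm_halt M \<in> tm_states M \<and>
     (\<forall>q\<in>tm_states M. \<forall>ss\<in>tuples_over (tm_symbols M) (tm_tapes M).
        fst (tm_delta M q ss) \<in> tm_states M \<and>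
        snd (tm_delta M q ss) \<in> tuples_over (tm_symbols M \<times> {-1, 0, 1}) (tm_tapes M))"

type_synonym tape = "(int \<Rightarrow> nat) \<times> int"
type_synonym config = "nat \<times> tape list"

definition read_tape :: "tape \<Rightarrow> nat" where
  "read_tape tp = fst tp (snd tp)"

definition act_tape :: "nat \<times> int \<Rightarrow> tape \<Rightarrow> tape" where
  "act_tape am tp = ((fst tp)(snd tp := fst am), snd tp + snd am)"

definition tm_step :: "tm \<Rightarrow> config \<Rightarrow> config" where
  "tm_step M c =
     (if fst c = tm_halt M then c
      else let (q, acts) = tm_delta M (fst c) (map read_tape (snd c))
           in (q, map2 act_tape acts (snd c)))"

definition word_cells :: "nat list \<Rightarrow> int \<Rightarrow> nat" where
  "word_cells w i = (if 0 \<le> i \<and> i < int (length w) then w ! nat i else 0)"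

definition tm_init :: "tm \<Rightarrow> nat list \<Rightarrow> config" where
  "tm_init M w =
     (tm_start M, (word_cells w, 0) # replicate (tm_tapes M - 1) (word_cells [], 0))"

definition tm_computes :: "tm \<Rightarrow> nat list \<Rightarrow> nat list \<Rightarrow> nat \<Rightarrow> bool" where
  "tm_computes M w v t \<longleftrightarrow>
     (let c = (tm_step M ^^ t) (tm_init M w)
      in fst c = tm_halt M \<and> fst (snd c ! 1) = word_cells v)"

text \<open>The search problem with instances \<open>X\<close>, encoded as words by \<open>enc\<close>, and correct answers
  \<open>R\<close>, is solvable in deterministic polynomial time.\<close>

definition poly_time_solvable ::
  "('i \<Rightarrow> nat list) \<Rightarrow> 'i set \<Rightarrow> ('i \<Rightarrow> nat list \<Rightarrow> bool) \<Rightarrow> bool" where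
  "poly_time_solvable enc X R \<longleftrightarrow>
     (\<exists>M c k. tm_wf M \<and> (\<forall>x\<in>X. set (enc x) \<subseteq> tm_symbols M \<and>
        (\<exists>v t. R x v \<and> tm_computes M (enc x) v t \<and> t \<le> c * length (enc x) ^ k + c)))"


section \<open>Endogenous model expansion\<close>

text \<open>A partial structure with two-valued domain \<open>{..<n}\<close> is encoded by \<open>n\<close> in unary (symbol 4),
  followed by the value tables of the predicates in the order of \<open>\<Sigma>\<close>, each listing all tuples.\<close>

primrec tv_code :: "tv \<Rightarrow> nat" where
  "tv_code FF = 1"
| "tv_code UU = 2"
| "tv_code TT = 3"

definition encode :: "'p list \<Rightarrow> ('p \<Rightarrow> nat) \<Rightarrow> ('p, nat) pstr \<Rightarrow> nat list" where
  "encode \<Sigma> ar J =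
     (let n = card {d. J (Elem d) = TT} in
        replicate n 4 @
        concat (map (\<lambda>p. map (\<lambda>ds. tv_code (J (Atm p ds))) (List.n_lists (ar p) [0..<n])) \<Sigma>))"

definition unsat :: "nat list" where "unsat = [5]"

definition endogenous_mx_instance ::
  "'p list \<Rightarrow> ('p \<Rightarrow> nat) \<Rightarrow> 'p cee \<Rightarrow> ('p, nat) pstr \<Rightarrow> bool" where
  "endogenous_mx_instance \<Sigma> ar \<Delta> J \<longleftrightarrow> partial_structure \<Sigma> ar J \<and>
     (\<exists>n. \<forall>d. J (Elem d) = (if d < n then TT else FF)) \<and>
     (\<forall>p\<in>set \<Sigma> - endogenous \<Delta>. \<forall>ds. J (Atm p ds) \<noteq> UU) \<and>
     (\<forall>p\<in>endogenous \<Delta>. \<forall>ds\<in>tuples_over {d. J (Elem d) = TT} (ar p). J (Atm p ds) = UU)"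

definition model_expansion ::
  "'p list \<Rightarrow> ('p \<Rightarrow> nat) \<Rightarrow> 'p cee \<Rightarrow> ('p, 'd) pstr \<Rightarrow> ('p, 'd) pstr \<Rightarrow> bool" where
  "model_expansion \<Sigma> ar \<Delta> J I \<longleftrightarrow> is_model \<Sigma> ar \<Delta> I \<and> J \<le>\<^sub>p I"

definition mx_answer ::
  "'p list \<Rightarrow> ('p \<Rightarrow> nat) \<Rightarrow> 'p cee \<Rightarrow> ('p, nat) pstr \<Rightarrow> nat list \<Rightarrow> bool" where
  "mx_answer \<Sigma> ar \<Delta> J v \<longleftrightarrow>
     (if \<exists>I. model_expansion \<Sigma> ar \<Delta> J I
      then \<exists>I. model_expansion \<Sigma> ar \<Delta> J I \<and> v = encode \<Sigma> ar I
      else v = unsat)"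

definition endogenous_mx_in_P :: "'p list \<Rightarrow> ('p \<Rightarrow> nat) \<Rightarrow> 'p cee \<Rightarrow> bool" where
  "endogenous_mx_in_P \<Sigma> ar \<Delta> \<longleftrightarrow>
     poly_time_solvable (encode \<Sigma> ar) {J. endogenous_mx_instance \<Sigma> ar \<Delta> J} (mx_answer \<Sigma> ar \<Delta>)"

end

theory Submission
  imports Defs
begin

text \<open>
  Without \<open>New\<close> and \<open>Select\<close>, every selection succeeds, so the selection that always takes the first
  branch of every \<open>Or\<close> yields a model by totality: an expansion always exists and it suffices to
  compute one well-founded fixpoint. Evaluating positive and negative occurrences of atoms in two
  different sets \<open>X\<close> and \<open>Y\<close> turns the immediate causality operator into a two-valued operator
  \<open>P X Y\<close>, monotone in \<open>X\<close> and antitone in \<open>Y\<close>; with \<open>gam Y = lfp (\<lambda>X. P X Y)\<close>, the lower bound of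
  the well-founded fixpoint is the least fixpoint of \<open>gam \<circ> gam\<close>. As there are polynomially many
  domain atoms, both levels of this iteration stabilise after polynomially many rounds.

  The iteration is written in a language of loop programs over \<open>{..<n}\<close>-indexed arrays. Each such
  program terminates, and it runs in polynomial time on a Turing machine that keeps an array as a
  table on a tape and the value of a loop variable as a head position on a ruler of length \<open>n\<close>.
\<close>

section \<open>Structured tape programs and Turing machines\<close>

text \<open>The well-founded fixpoint is defined through stable fixpoints on intervals of consistent
  pairs. The link to one operator is a symmetry: once \<open>New\<close> and \<open>Select\<close>
  are absent and the \<open>Or\<close> branches are fixed, Kleene evaluation sends
  \<open>(X, Y)\<close> to \<open>(P X Y, P Y X)\<close>, so both halves of a stable fixpoint are
  values of the same antitone \<open>gam\<close>. Loop programs have no unbounded loop and cannot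
  test for stabilisation. The number of rounds is therefore fixed beforehand: nested loops run their
  body as often as the sum of \<open>n ^ ar p\<close> over the endogenous predicates, which is at
  least the number of endogenous atoms, and every round before the limit adds an atom. A pass over
  the theory writes into the table that it reads, so its result is no function of the operator; a
  round is specified by a relation that keeps it between one application of the operator and the
  least fixpoint. Totality enters once: it makes the two bounds coincide, so the table of the lower
  bound is already the answer.\<close>

datatype 'a prog =
    Nop
  | Wr 'a nat
  | Mv 'a int
  | Sq "'a prog" "'a prog"
  | Ift 'a nat "'a prog" "'a prog"
  | Whl 'a nat "'a prog"

text \<open>The control is a stack of programs still to be run. The next stack and the head actions
  are a function of the present stack and the symbols read, as a transition function requires; tapes
  that are not addressed rewrite their symbol.\<close>

fun pctl :: "'a prog list \<Rightarrow> ('a \<Rightarrow> nat) \<Rightarrow> 'a prog list \<times> ('a \<Rightarrow> nat \<times> int)" where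
  "pctl [] rd = ([], \<lambda>y. (rd y, 0))"
| "pctl (Nop # K) rd = (K, \<lambda>y. (rd y, 0))"
| "pctl (Wr x s # K) rd = (K, (\<lambda>y. (rd y, 0))(x := (s, 0)))"
| "pctl (Mv x z # K) rd = (K, (\<lambda>y. (rd y, 0))(x := (rd x, z)))"
| "pctl (Sq p q # K) rd = (p # q # K, \<lambda>y. (rd y, 0))"
| "pctl (Ift x s p q # K) rd = ((if rd x = s then p else q) # K, \<lambda>y. (rd y, 0))"
| "pctl (Whl x s p # K) rd =
     ((if rd x = s then p # Whl x s p # K else K), \<lambda>y. (rd y, 0))"

definition pstep :: "'a prog list \<times> ('a \<Rightarrow> tape) \<Rightarrow> 'a prog list \<times> ('a \<Rightarrow> tape)" where
  "pstep c = (let (K, act) = pctl (fst c) (\<lambda>x. read_tape (snd c x))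
              in (K, \<lambda>x. act_tape (act x) (snd c x)))"

lemma act_tape_read [simp]:
  "act_tape (read_tape tp, z) tp = (fst tp, snd tp + z)"
  "act_tape (s, 0) tp = ((fst tp)(snd tp := s), snd tp)"
  by (simp_all add: act_tape_def read_tape_def)

lemma fun_upd_read_tape [simp]: "((fst tp)(snd tp := read_tape tp), snd tp) = tp"
  by (simp add: read_tape_def)

lemma pstep_simps [simp]:
  "pstep ([], T) = ([], T)"
  "pstep (Nop # K, T) = (K, T)"
  "pstep (Wr x s # K, T) = (K, T(x := ((fst (T x))(snd (T x) := s), snd (T x))))"
  "pstep (Mv x z # K, T) = (K, T(x := (fst (T x), snd (T x) + z)))"
  "pstep (Sq p q # K, T) = (p # q # K, T)"
  "pstep (Ift x s p q # K, T) = ((if read_tape (T x) = s then p else q) # K, T)"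
  "pstep (Whl x s p # K, T) =
     ((if read_tape (T x) = s then p # Whl x s p # K else K), T)"
  by (simp_all add: pstep_def fun_eq_iff)

text \<open>The stacks that can occur while \<open>p\<close> runs on top of \<open>K\<close>. A loop
  body runs on top of its own loop, so iterating does not deepen the stack; this finiteness is what
  allows stacks to serve as machine states.\<close>

primrec conts :: "'a prog \<Rightarrow> 'a prog list \<Rightarrow> 'a prog list set" where
  "conts Nop K = {Nop # K}"
| "conts (Wr x s) K = {Wr x s # K}"
| "conts (Mv x z) K = {Mv x z # K}"
| "conts (Sq p q) K = insert (Sq p q # K) (conts p (q # K) \<union> conts q K)"
| "conts (Ift x s p q) K = insert (Ift x s p q # K) (conts p K \<union> conts q K)"
| "conts (Whl x s p) K = insert (Whl x s p # K) (conts p (Whl x s p # K))"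

primrec ptapes :: "'a prog \<Rightarrow> 'a set" where
  "ptapes Nop = {}"
| "ptapes (Wr x s) = {x}"
| "ptapes (Mv x z) = {x}"
| "ptapes (Sq p q) = ptapes p \<union> ptapes q"
| "ptapes (Ift x s p q) = insert x (ptapes p \<union> ptapes q)"
| "ptapes (Whl x s p) = insert x (ptapes p)"

primrec prog_ok :: "'a prog \<Rightarrow> bool" where
  "prog_ok Nop \<longleftrightarrow> True"
| "prog_ok (Wr x s) \<longleftrightarrow> s \<le> 5"
| "prog_ok (Mv x z) \<longleftrightarrow> z \<in> {-1, 0, 1}"
| "prog_ok (Sq p q) \<longleftrightarrow> prog_ok p \<and> prog_ok q"
| "prog_ok (Ift x s p q) \<longleftrightarrow> prog_ok p \<and> prog_ok q"
| "prog_ok (Whl x s p) \<longleftrightarrow> prog_ok p"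

lemma finite_conts [simp]: "finite (conts p K)"
  by (induction p arbitrary: K) auto

lemma finite_ptapes [simp]: "finite (ptapes p)"
  by (induction p) auto

lemma Cons_in_conts [simp]: "p # K \<in> conts p K"
  by (cases p) auto

lemma pctl_conts: "K' \<in> conts p K \<Longrightarrow> fst (pctl K' rd) \<in> insert K (conts p K)"
proof (induction p arbitrary: K K')
  case (Sq p q)
  have "K' = Sq p q # K \<or> K' \<in> conts p (q # K) \<or> K' \<in> conts q K" using Sq.prems by simp
  then show ?case
  proof (elim disjE)
    assume "K' \<in> conts p (q # K)"
    with Sq.IH(1)[of K' "q # K"] show ?thesis by auto
  next
    assume "K' \<in> conts q K"
    with Sq.IH(2)[of K' K] show ?thesis by auto
  qed auto
next
  case (Ift x s p q)
  have "K' = Ift x s p q # K \<or> K' \<in> conts p K \<or> K' \<in> conts q K" using Ift.prems by simp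
  then show ?case
  proof (elim disjE)
    assume "K' \<in> conts p K"
    with Ift.IH(1)[of K' K] show ?thesis by auto
  next
    assume "K' \<in> conts q K"
    with Ift.IH(2)[of K' K] show ?thesis by auto
  qed auto
next
  case (Whl x s p)
  have "K' = Whl x s p # K \<or> K' \<in> conts p (Whl x s p # K)" using Whl.prems by simp
  then show ?case
  proof (elim disjE)
    assume "K' \<in> conts p (Whl x s p # K)"
    with Whl.IH[of K' "Whl x s p # K"] show ?thesis by auto
  qed auto
qed auto

lemma conts_hd:
  "K' \<in> conts p K \<Longrightarrow> \<exists>i L. K' = i # L \<and> ptapes i \<subseteq> ptapes p \<and> (prog_ok p \<longrightarrow> prog_ok i)"
proof (induction p arbitrary: K)
  case (Sq p q)
  then show ?case using Sq.IH(1)[of "q # K"] Sq.IH(2)[of K] by fastforce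
next
  case (Ift x s p q)
  then show ?case using Ift.IH(1)[of K] Ift.IH(2)[of K] by fastforce
next
  case (Whl x s p)
  then show ?case using Whl.IH[of "Whl x s p # K"] by fastforce
qed auto

definition prog_states :: "'a prog \<Rightarrow> 'a prog list set" where
  "prog_states p = insert [] (conts p [])"

text \<open>Machine states are numbers, so stacks are encoded by an injection \<open>enc\<close> and
  decoded with \<open>inv_into\<close>. The order of \<open>xs\<close> numbers the tapes; its first
  two entries become the input and the output tape.\<close>

definition tm_of :: "'a list \<Rightarrow> 'a prog \<Rightarrow> ('a prog list \<Rightarrow> nat) \<Rightarrow> tm" where
  "tm_of xs p enc =
     \<lparr>tm_tapes = length xs, tm_states = enc ` prog_states p, tm_symbols = {..5},
      tm_start = enc [p], tm_halt = enc [],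
      tm_delta = (\<lambda>q ss.
        let (K, act) = pctl (inv_into (prog_states p) enc q) (\<lambda>x. the (map_of (zip xs ss) x))
        in (enc K, map act xs))\<rparr>"

lemma prog_states_pctl: "K \<in> prog_states p \<Longrightarrow> fst (pctl K rd) \<in> prog_states p"
  using pctl_conts[of K p "[]" rd] by (auto simp: prog_states_def)

lemma pctl_act_ok:
  assumes "K \<noteq> [] \<longrightarrow> prog_ok (hd K)" "rd x \<le> 5"
  shows "snd (pctl K rd) x \<in> {..5} \<times> {-1, 0, 1}"
proof (cases K)
  case (Cons p L)
  then show ?thesis using assms by (cases p) auto
qed (use assms in auto)

text \<open>The machine knows the symbols of the listed tapes only, whereas \<open>pstep\<close> has
  a function on all tape names. Control inspects just the tapes of the program on top of the stack,
  so the two agree.\<close>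

lemma pctl_cong:
  assumes "K \<noteq> [] \<longrightarrow> ptapes (hd K) \<subseteq> X" "\<And>x. x \<in> X \<Longrightarrow> rd x = rd' x"
  shows "fst (pctl K rd) = fst (pctl K rd') \<and> (\<forall>x\<in>X. snd (pctl K rd) x = snd (pctl K rd') x)"
proof (cases K)
  case (Cons p L)
  then show ?thesis using assms by (cases p) auto
qed (use assms in auto)

lemma prog_states_hd:
  "K \<in> prog_states p \<Longrightarrow> K \<noteq> [] \<longrightarrow> ptapes (hd K) \<subseteq> ptapes p \<and> (prog_ok p \<longrightarrow> prog_ok (hd K))"
  using conts_hd[of K p "[]"] by (fastforce simp: prog_states_def)

lemma tm_wf_tm_of:
  assumes inj: "inj_on enc (prog_states p)" and "prog_ok p" and "2 \<le> length xs"
  shows "tm_wf (tm_of xs p enc)"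
proof -
  have "fst (tm_delta (tm_of xs p enc) q ss) \<in> enc ` prog_states p \<and>
        snd (tm_delta (tm_of xs p enc) q ss) \<in> tuples_over ({..5} \<times> {-1, 0, 1}) (length xs)"
    if q: "q \<in> enc ` prog_states p" and ss: "ss \<in> tuples_over {..5} (length xs)" for q ss
  proof -
    let ?rd = "\<lambda>x. the (map_of (zip xs ss) x)"
    obtain K where K: "K \<in> prog_states p" "q = enc K" using q by auto
    have d: "tm_delta (tm_of xs p enc) q ss = (enc (fst (pctl K ?rd)), map (snd (pctl K ?rd)) xs)"
      using K inj by (simp add: tm_of_def case_prod_beta Let_def)
    have rd: "?rd x \<le> 5" if "x \<in> set xs" for x
    proof -
      have len: "length ss = length xs" "set ss \<subseteq> {..5}" using ss by (auto simp: tuples_over_def)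
      then obtain y where y: "map_of (zip xs ss) x = Some y"
        using \<open>x \<in> set xs\<close> map_of_zip_is_Some[of xs ss x] by auto
      then have "y \<in> set ss" by (metis map_of_SomeD set_zip_rightD)
      then show ?thesis using y len by auto
    qed
    have "snd (pctl K ?rd) x \<in> {..5} \<times> {-1, 0, 1}" if "x \<in> set xs" for x
      using prog_states_hd[OF K(1)] assms(2) rd[OF that] by (intro pctl_act_ok) auto
    then have "set (map (snd (pctl K ?rd)) xs) \<subseteq> {..5} \<times> {-1, 0, 1}"
      by (simp only: set_map image_subset_iff) blast
    then show ?thesis unfolding d tuples_over_def
      using prog_states_pctl[OF K(1)] by simp
  qed
  then show ?thesis using assms(3)
    by (auto simp: tm_wf_def tm_of_def prog_states_def Let_def case_prod_beta)
qed

lemma tm_step_tm_of: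
  assumes inj: "inj_on enc (prog_states p)" and xs: "distinct xs" "ptapes p \<subseteq> set xs"
    and K: "K \<in> prog_states p"
  shows "tm_step (tm_of xs p enc) (enc K, map T xs) =
    (enc (fst (pstep (K, T))), map (snd (pstep (K, T))) xs)"
proof (cases "K = []")
  case True
  \<comment> \<open>The empty stack is the halting state, where machine and program both stand
    still.\<close>
  then show ?thesis by (simp add: tm_step_def tm_of_def)
next
  case False
  let ?rd = "\<lambda>x. the (map_of (zip xs (map (read_tape \<circ> T) xs)) x)"
  have ne: "enc K \<noteq> enc []" using False K inj by (auto simp: inj_on_def prog_states_def)
  have rd: "?rd x = read_tape (T x)" if "x \<in> set xs" for x
    using that by (simp add: map_of_zip_map)
  have hd: "K \<noteq> [] \<longrightarrow> ptapes (hd K) \<subseteq> set xs"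
    using prog_states_hd[OF K] xs(2) by auto
  have cong: "fst (pctl K ?rd) = fst (pctl K (\<lambda>x. read_tape (T x)))"
      "\<And>x. x \<in> set xs \<Longrightarrow> snd (pctl K ?rd) x = snd (pctl K (\<lambda>x. read_tape (T x))) x"
    using pctl_cong[OF hd, of ?rd "\<lambda>x. read_tape (T x)", OF rd] by blast+
  have "tm_step (tm_of xs p enc) (enc K, map T xs) =
      (enc (fst (pctl K ?rd)), map2 act_tape (map (snd (pctl K ?rd)) xs) (map T xs))"
    using ne K inj by (simp add: tm_step_def tm_of_def case_prod_beta Let_def)
  also have "map2 act_tape (map (snd (pctl K ?rd)) xs) (map T xs) =
      map (\<lambda>x. act_tape (snd (pctl K ?rd) x) (T x)) xs"
    by (simp add: zip_map_map zip_same_conv_map)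
  finally have eq: "tm_step (tm_of xs p enc) (enc K, map T xs) =
      (enc (fst (pctl K ?rd)), map (\<lambda>x. act_tape (snd (pctl K ?rd) x) (T x)) xs)" .
  have "map (\<lambda>x. act_tape (snd (pctl K ?rd) x) (T x)) xs =
      map (\<lambda>x. act_tape (snd (pctl K (\<lambda>x. read_tape (T x))) x) (T x)) xs"
    by (rule map_cong[OF refl]) (simp only: cong(2))
  then show ?thesis unfolding eq pstep_def case_prod_beta Let_def cong(1) by simp
qed

lemma pstep_prog_states: "K \<in> prog_states p \<Longrightarrow> fst (pstep (K, T)) \<in> prog_states p"
  using prog_states_pctl[of K p] by (simp add: pstep_def case_prod_beta)

lemma tm_run_tm_of:
  assumes "inj_on enc (prog_states p)" "distinct xs" "ptapes p \<subseteq> set xs"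
    and K: "K \<in> prog_states p"
  shows "(tm_step (tm_of xs p enc) ^^ t) (enc K, map T xs) =
    (enc (fst ((pstep ^^ t) (K, T))), map (snd ((pstep ^^ t) (K, T))) xs)"
proof -
  have "(tm_step (tm_of xs p enc) ^^ t) (enc K, map T xs) =
      (enc (fst ((pstep ^^ t) (K, T))), map (snd ((pstep ^^ t) (K, T))) xs) \<and>
      fst ((pstep ^^ t) (K, T)) \<in> prog_states p"
  proof (induction t)
    case (Suc t)
    then show ?case
      using tm_step_tm_of[OF assms(1-3), of "fst ((pstep ^^ t) (K, T))" "snd ((pstep ^^ t) (K, T))"]
        pstep_prog_states[of "fst ((pstep ^^ t) (K, T))" p "snd ((pstep ^^ t) (K, T))"]
      by simp
  qed (use K in auto)
  then show ?thesis ..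
qed

section \<open>Timed reachability of tape programs\<close>

text \<open>The step count is chosen before the continuation \<open>K\<close>, so runs compose;
  \<open>t\<close> is only an upper bound, so branches of different length can share one
  cost.\<close>

definition reach :: "'a prog \<Rightarrow> nat \<Rightarrow> ('a \<Rightarrow> tape) \<Rightarrow> ('a \<Rightarrow> tape) \<Rightarrow> bool" where
  "reach p t T T' \<longleftrightarrow> (\<exists>t'\<le>t. \<forall>K. (pstep ^^ t') (p # K, T) = (K, T'))"

text \<open>The machine is chosen before the input word, and each program step is one machine step,
  so time bounds carry over unchanged.\<close>

lemma reach_tm:
  fixes p :: "'a prog"
  assumes "prog_ok p" "distinct (i # j # xs)" "ptapes p \<subseteq> set (i # j # xs)"
  shows "\<exists>M. tm_wf M \<and> tm_symbols M = {..5} \<and>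
    (\<forall>w v t T' h. reach p t ((\<lambda>_. (word_cells [], 0))(i := (word_cells w, 0))) T' \<longrightarrow>
        T' j = (word_cells v, h) \<longrightarrow> (\<exists>t'\<le>t. tm_computes M w v t'))"
proof -
  let ?xs = "i # j # xs"
  obtain enc :: "'a prog list \<Rightarrow> nat" where inj: "inj_on enc (prog_states p)"
    using finite_imp_inj_to_nat_seg[of "prog_states p"] by (auto simp: prog_states_def)
  let ?M = "tm_of ?xs p enc"
  have "\<exists>t'\<le>t. tm_computes ?M w v t'"
    if "reach p t ((\<lambda>_. (word_cells [], 0))(i := (word_cells w, 0))) T'"
      "T' j = (word_cells v, h)" for w v t T' h
  proof -
    let ?T = "(\<lambda>_. (word_cells [], 0))(i := (word_cells w, 0))"
    from that(1) obtain t' where t': "t' \<le> t" "\<forall>K. (pstep ^^ t') (p # K, ?T) = (K, T')"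
      unfolding reach_def by (elim exE conjE)
    have "tm_init ?M w = (enc [p], map ?T ?xs)"
      using assms(2) by (auto simp: tm_init_def tm_of_def map_replicate_const)
    then have "(tm_step ?M ^^ t') (tm_init ?M w) = (enc [], map T' ?xs)"
      using tm_run_tm_of[OF inj assms(2,3), of "[p]" t' ?T] t'(2)
      by (simp add: prog_states_def)
    then show ?thesis using t'(1) that(2) by (auto simp: tm_computes_def tm_of_def)
  qed
  moreover have "tm_wf ?M" using inj assms by (intro tm_wf_tm_of) auto
  ultimately show ?thesis by (intro exI[of _ ?M]) (auto simp: tm_of_def)
qed

lemma reach_mono: "reach p t T T' \<Longrightarrow> t \<le> u \<Longrightarrow> reach p u T T'"
  unfolding reach_def using order_trans by blast

lemma reach_Nop: "reach Nop 1 T T"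
  unfolding reach_def by (intro exI[of _ 1]) auto

lemma reach_Wr: "reach (Wr x s) 1 T (T(x := ((fst (T x))(snd (T x) := s), snd (T x))))"
  unfolding reach_def by (intro exI[of _ 1]) auto

lemma reach_Mv: "reach (Mv x z) 1 T (T(x := (fst (T x), snd (T x) + z)))"
  unfolding reach_def by (intro exI[of _ 1]) auto

lemma funpow_swap_add: "(f ^^ (a + b)) x = (f ^^ b) ((f ^^ a) x)"
  by (metis add.commute comp_apply funpow_add)

lemma reach_Sq:
  assumes "reach p a T T1" "reach q b T1 T2"
  shows "reach (Sq p q) (a + b + 1) T T2"
proof -
  obtain a' b' where "a' \<le> a" "\<And>K. (pstep ^^ a') (p # K, T) = (K, T1)"
    "b' \<le> b" "\<And>K. (pstep ^^ b') (q # K, T1) = (K, T2)"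
    using assms unfolding reach_def by blast
  then show ?thesis unfolding reach_def
    by (intro exI[of _ "Suc (a' + b')"])
      (auto simp: funpow_swap_add funpow_Suc_right simp del: funpow.simps)
qed

lemma reach_Ift:
  assumes "reach (if read_tape (T x) = s then p else q) t T T'"
  shows "reach (Ift x s p q) (t + 1) T T'"
proof -
  obtain t' where "t' \<le> t"
    "\<And>K. (pstep ^^ t') ((if read_tape (T x) = s then p else q) # K, T) = (K, T')"
    using assms unfolding reach_def by blast
  then show ?thesis unfolding reach_def
    by (intro exI[of _ "Suc t'"]) (auto simp: funpow_Suc_right simp del: funpow.simps)
qed

text \<open>The loop invariant is an explicit sequence of tape contents \<open>S i\<close>, one per
  iteration; the extra step per round pays for the test.\<close>

lemma reach_Whl:
  assumes "\<And>i. i < m \<Longrightarrow> read_tape (S i x) = s \<and> reach p t (S i) (S (Suc i))"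
    and "read_tape (S m x) \<noteq> s"
  shows "reach (Whl x s p) (m * (t + 1) + 1) (S 0) (S m)"
  using assms
proof (induction m arbitrary: S)
  case 0
  then show ?case unfolding reach_def by (intro exI[of _ 1]) auto
next
  case (Suc m)
  have "reach (Whl x s p) (m * (t + 1) + 1) (S 1) (S (Suc m))"
    using Suc.IH[of "\<lambda>i. S (Suc i)"] Suc.prems by auto
  then obtain b where b: "b \<le> m * (t + 1) + 1"
    "\<And>K. (pstep ^^ b) (Whl x s p # K, S 1) = (K, S (Suc m))"
    unfolding reach_def by blast
  obtain a where a: "a \<le> t" "\<And>K. (pstep ^^ a) (p # K, S 0) = (K, S 1)"
    using Suc.prems(1)[of 0] unfolding reach_def by auto
  have "read_tape (S 0 x) = s" using Suc.prems(1) by auto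
  then show ?case unfolding reach_def using a b
    by (intro exI[of _ "Suc (a + b)"])
      (auto simp: funpow_swap_add funpow_Suc_right simp del: funpow.simps)
qed

section \<open>Loop programs over arrays\<close>

datatype 'b tname = In | Out | Aux | Reg nat | Scr nat | Arr 'b

definition ruler :: "nat \<Rightarrow> int \<Rightarrow> nat" where
  "ruler n = word_cells (replicate n 4)"

lemma read_ruler [simp]: "read_tape (ruler n, i) = (if 0 \<le> i \<and> i < int n then 4 else 0)"
  by (auto simp: read_tape_def ruler_def word_cells_def)

lemma reach_Mv': "T' = T(x := (fst (T x), snd (T x) + z)) \<Longrightarrow> reach (Mv x z) 1 T T'"
  by (simp only: reach_Mv)

lemma reach_Wr': "T' = T(x := ((fst (T x))(snd (T x) := s), snd (T x))) \<Longrightarrow> reach (Wr x s) 1 T T'"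
  by (simp only: reach_Wr)

text \<open>After the pass the head has left the ruler on the right. It steps left, returns over the
  marks until it leaves on the left, and steps right; thus it ends on cell 0 even if the ruler is
  empty.\<close>

definition sweep :: "'a \<Rightarrow> 'a prog \<Rightarrow> 'a prog" where
  "sweep x p = Sq (Whl x 4 (Sq p (Mv x 1)))
     (Sq (Mv x (-1)) (Sq (Whl x 4 (Mv x (-1))) (Mv x 1)))"

text \<open>\<open>G i\<close> describes all tapes but \<open>x\<close>. The head of
  \<open>x\<close> on cell \<open>i\<close> is the loop counter, which the body has to leave in
  place.\<close>

lemma reach_sweep:
  assumes "\<And>i. i < n \<Longrightarrow> reach p t ((G i)(x := (ruler n, int i))) ((G (Suc i))(x := (ruler n, int i)))"
  shows "reach (sweep x p) (n * (t + 5) + 8) ((G 0)(x := (ruler n, 0))) ((G n)(x := (ruler n, 0)))"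
proof -
  define S where "S i = (G i)(x := (ruler n, int i))" for i
  define S' where "S' i = (G n)(x := (ruler n, int n - 1 - int i))" for i
  have "reach (Sq p (Mv x 1)) (t + 1 + 1) (S i) (S (Suc i))" if "i < n" for i
    by (rule reach_Sq[OF assms[OF that, folded S_def] reach_Mv']) (auto simp: S_def fun_eq_iff)
  then have 1: "reach (Whl x 4 (Sq p (Mv x 1))) (n * (t + 1 + 1 + 1) + 1) (S 0) (S n)"
    by (intro reach_Whl[where S = S]) (auto simp: S_def)
  have 2: "reach (Mv x (-1)) 1 (S n) (S' 0)"
    by (rule reach_Mv') (auto simp: S_def S'_def)
  have "reach (Mv x (-1)) 1 (S' i) (S' (Suc i))" for i
    by (rule reach_Mv') (auto simp: S'_def)
  then have 3: "reach (Whl x 4 (Mv x (-1))) (n * (1 + 1) + 1) (S' 0) (S' n)"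
    by (intro reach_Whl[where S = S']) (auto simp: S'_def)
  have 4: "reach (Mv x 1) 1 (S' n) ((G n)(x := (ruler n, 0)))"
    by (rule reach_Mv') (auto simp: S'_def)
  have "(G 0)(x := (ruler n, 0)) = S 0" by (simp add: S_def)
  then show ?thesis unfolding sweep_def
    using reach_Sq[OF 1 reach_Sq[OF 2 reach_Sq[OF 3 4]]]
    by (auto elim!: reach_mono simp: algebra_simps)
qed

primrec sweepN :: "nat \<Rightarrow> 'b tname prog \<Rightarrow> 'b tname prog" where
  "sweepN 0 p = p"
| "sweepN (Suc r) p = sweep (Scr r) (sweepN r p)"

primrec sweep_cost :: "nat \<Rightarrow> nat \<Rightarrow> nat \<Rightarrow> nat" where
  "sweep_cost n t 0 = t"
| "sweep_cost n t (Suc r) = n * (sweep_cost n t r + 5) + 8"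

definition set_scr :: "nat \<Rightarrow> nat \<Rightarrow> (nat \<Rightarrow> nat) \<Rightarrow> ('b tname \<Rightarrow> tape) \<Rightarrow> 'b tname \<Rightarrow> tape" where
  "set_scr N n q T = (\<lambda>x. case x of Scr j \<Rightarrow> if j < N then (ruler n, int (q j)) else T x | _ \<Rightarrow> T x)"

lemma set_scr_upd:
  "r < N \<Longrightarrow> (set_scr N n q T)(Scr r := (ruler n, int i)) = set_scr N n (q(r := i)) T"
  by (auto simp: set_scr_def fun_eq_iff split: tname.split)

text \<open>The scratch heads are base-\<open>n\<close> digits: with the outermost one on cell
  \<open>k\<close>, inner pass \<open>i\<close> is iteration \<open>k * n ^ r + i\<close>. The body
  is required to work for every position \<open>q\<close> of the scratch heads because they move
  between its runs.\<close>

lemma reach_sweepN_scr: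
  assumes "\<And>q i. i < n ^ r \<Longrightarrow> reach p t (set_scr N n q (G i)) (set_scr N n q (G (Suc i)))"
    and "r \<le> N" and "\<forall>j<r. q j = 0"
  shows "reach (sweepN r p) (sweep_cost n t r) (set_scr N n q (G 0)) (set_scr N n q (G (n ^ r)))"
  using assms
proof (induction r arbitrary: G q)
  case 0
  then show ?case by simp
next
  case (Suc r)
  have "reach (sweepN r p) (sweep_cost n t r)
      (set_scr N n (q(r := k)) (G (k * n ^ r))) (set_scr N n (q(r := k)) (G (Suc k * n ^ r)))"
    if "k < n" for k
  proof -
    have *: "reach p t (set_scr N n q (G (k * n ^ r + i))) (set_scr N n q (G (Suc (k * n ^ r + i))))"
      if "i < n ^ r" for q i
    proof (rule Suc.prems(1))
      have "k * n ^ r + i < Suc k * n ^ r" using that by simp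
      also have "\<dots> \<le> n * n ^ r" using \<open>k < n\<close> by (intro mult_le_mono1) simp
      finally show "k * n ^ r + i < n ^ Suc r" by simp
    qed
    show ?thesis
      using Suc.IH[of "\<lambda>i. G (k * n ^ r + i)" "q(r := k)"] * Suc.prems(2,3)
      by (simp add: add.commute fun_upd_def)
  qed
  then have "reach (sweep (Scr r) (sweepN r p)) (n * (sweep_cost n t r + 5) + 8)
     ((set_scr N n q (G (0 * n ^ r)))(Scr r := (ruler n, 0)))
     ((set_scr N n q (G (n * n ^ r)))(Scr r := (ruler n, 0)))"
    using Suc.prems(2)
    by (intro reach_sweep[where G = "\<lambda>k. set_scr N n q (G (k * n ^ r))"])
      (simp add: set_scr_upd)
  moreover have "(set_scr N n q T)(Scr r := (ruler n, 0)) = set_scr N n q T" for T :: "'a tname \<Rightarrow> tape"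
    using Suc.prems(2,3) by (auto simp: set_scr_def fun_eq_iff)
  ultimately show ?case by simp
qed

lemma set_scr_id: "\<forall>j<N. T (Scr j) = (ruler n, 0) \<Longrightarrow> set_scr N n (\<lambda>_. 0) T = T"
  by (auto simp: set_scr_def fun_eq_iff split: tname.split)

lemma reach_sweepN:
  assumes "\<And>q i. i < n ^ r \<Longrightarrow> reach p t (set_scr N n q (G i)) (set_scr N n q (G (Suc i)))"
    and "r \<le> N" and "\<And>i. \<forall>j<N. G i (Scr j) = (ruler n, 0)"
  shows "reach (sweepN r p) (sweep_cost n t r) (G 0) (G (n ^ r))"
  using reach_sweepN_scr[where q = "\<lambda>_. 0" and G = G and p = p and t = t, OF assms(1,2)] assms(3)
  by (simp add: set_scr_id)

lemma set_scr_simps [simp]: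
  "set_scr N n q T In = T In"
  "set_scr N n q T Out = T Out"
  "set_scr N n q T Aux = T Aux"
  "set_scr N n q T (Reg v) = T (Reg v)"
  "set_scr N n q T (Arr b) = T (Arr b)"
  "set_scr N n q (T(Arr b := a)) = (set_scr N n q T)(Arr b := a)"
  "set_scr N n q (T(In := a)) = (set_scr N n q T)(In := a)"
  "set_scr N n q (T(Out := a)) = (set_scr N n q T)(Out := a)"
  by (auto simp: set_scr_def fun_eq_iff split: tname.split)

lemma reach_move:
  assumes "\<forall>j<N. T (Scr j) = (ruler n, 0)" "r \<le> N"
  shows "reach (sweepN r (Mv (Arr b) z)) (sweep_cost n 1 r) T
    (T(Arr b := (fst (T (Arr b)), snd (T (Arr b)) + z * int (n ^ r))))"
proof -
  define G where "G i = T(Arr b := (fst (T (Arr b)), snd (T (Arr b)) + z * int i))" for i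
  have "reach (sweepN r (Mv (Arr b) z)) (sweep_cost n 1 r) (G 0) (G (n ^ r))"
    using assms
    by (intro reach_sweepN[where N = N and G = G] reach_Mv') (auto simp: G_def algebra_simps)
  moreover have "G 0 = T" by (simp add: G_def)
  ultimately show ?thesis by (simp add: G_def)
qed

text \<open>Counting a register down destroys its value, so every step is recorded on
  \<open>Aux\<close>, from which the register is restored. After the initial step left, exactly the
  \<open>d\<close> marks on cells \<open>d - 1\<close> down to \<open>0\<close> remain to be
  consumed.\<close>

definition jump :: "int \<Rightarrow> 'b \<Rightarrow> nat \<Rightarrow> nat \<Rightarrow> 'b tname prog" where
  "jump z b j v =
     Sq (Mv (Reg v) (-1))
    (Sq (Whl (Reg v) 4 (Sq (Mv (Reg v) (-1)) (Sq (Mv Aux 1) (sweepN j (Mv (Arr b) z)))))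
    (Sq (Mv (Reg v) 1)
    (Sq (Mv Aux (-1))
    (Sq (Whl Aux 4 (Sq (Mv Aux (-1)) (Mv (Reg v) 1)))
        (Mv Aux 1)))))"

lemma reach_jump:
  assumes T: "\<forall>j<N. T (Scr j) = (ruler n, 0)" "T Aux = (ruler n, 0)" "T (Reg v) = (ruler n, int d)"
    and "d < n" "j \<le> N"
  shows "reach (jump z b j v) (n * (sweep_cost n 1 j + 9) + 11) T
    (T(Arr b := (fst (T (Arr b)), snd (T (Arr b)) + z * int (d * n ^ j))))"
proof -
  define c h where "c = fst (T (Arr b))" and "h = snd (T (Arr b))"
  define S where "S i = T(Reg v := (ruler n, int d - 1 - int i), Aux := (ruler n, int i),
    Arr b := (c, h + z * int (i * n ^ j)))" for i
  define S' where "S' i = T(Reg v := (ruler n, int i), Aux := (ruler n, int d - 1 - int i),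
    Arr b := (c, h + z * int (d * n ^ j)))" for i
  define U where "U = T(Reg v := (ruler n, 0), Aux := (ruler n, int d),
    Arr b := (c, h + z * int (d * n ^ j)))"
  have 1: "reach (Mv (Reg v) (-1)) 1 T (S 0)"
    using T by (intro reach_Mv') (auto simp: S_def c_def h_def fun_eq_iff)
  have "reach (Sq (Mv (Reg v) (-1)) (Sq (Mv Aux 1) (sweepN j (Mv (Arr b) z))))
      (1 + (1 + sweep_cost n 1 j + 1) + 1) (S i) (S (Suc i))" for i
  proof (rule reach_Sq[OF reach_Mv reach_Sq[OF reach_Mv]])
    let ?T = "(S i)(Reg v := (fst (S i (Reg v)), snd (S i (Reg v)) + - 1))"
    let ?T' = "?T(Aux := (fst (?T Aux), snd (?T Aux) + 1))"
    have "reach (sweepN j (Mv (Arr b) z)) (sweep_cost n 1 j) ?T'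
      (?T'(Arr b := (fst (?T' (Arr b)), snd (?T' (Arr b)) + z * int (n ^ j))))"
      using T assms(5) by (intro reach_move[where N = N]) (auto simp: S_def)
    moreover have "?T'(Arr b := (fst (?T' (Arr b)), snd (?T' (Arr b)) + z * int (n ^ j))) = S (Suc i)"
      by (auto simp: S_def fun_eq_iff algebra_simps)
    ultimately show "reach (sweepN j (Mv (Arr b) z)) (sweep_cost n 1 j) ?T' (S (Suc i))" by simp
  qed
  then have 2: "reach (Whl (Reg v) 4 (Sq (Mv (Reg v) (-1)) (Sq (Mv Aux 1) (sweepN j (Mv (Arr b) z)))))
      (d * (1 + (1 + sweep_cost n 1 j + 1) + 1 + 1) + 1) (S 0) (S d)"
    using \<open>d < n\<close> by (intro reach_Whl[where S = S]) (auto simp: S_def)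
  have 3: "reach (Mv (Reg v) 1) 1 (S d) U"
    by (rule reach_Mv') (auto simp: S_def U_def fun_eq_iff)
  have 4: "reach (Mv Aux (-1)) 1 U (S' 0)"
    by (rule reach_Mv') (auto simp: S'_def U_def fun_eq_iff)
  have "reach (Sq (Mv Aux (-1)) (Mv (Reg v) 1)) (1 + 1 + 1) (S' i) (S' (Suc i))" for i
    by (rule reach_Sq[OF reach_Mv reach_Mv']) (auto simp: S'_def fun_eq_iff)
  then have 5: "reach (Whl Aux 4 (Sq (Mv Aux (-1)) (Mv (Reg v) 1))) (d * (1 + 1 + 1 + 1) + 1) (S' 0) (S' d)"
    using \<open>d < n\<close> by (intro reach_Whl[where S = S']) (auto simp: S'_def)
  have 6: "reach (Mv Aux 1) 1 (S' d) (T(Arr b := (c, h + z * int (d * n ^ j))))"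
    using T by (intro reach_Mv') (auto simp: S'_def fun_eq_iff)
  have "d * (sweep_cost n 1 j + 9) \<le> n * (sweep_cost n 1 j + 9)"
    using \<open>d < n\<close> by (intro mult_le_mono1) simp
  then show ?thesis unfolding jump_def c_def[symmetric] h_def[symmetric]
    by (intro reach_mono[OF reach_Sq[OF 1 reach_Sq[OF 2 reach_Sq[OF 3 reach_Sq[OF 4 reach_Sq[OF 5 6]]]]]])
      (simp add: algebra_simps)
qed

primrec walk :: "int \<Rightarrow> 'b \<Rightarrow> nat \<Rightarrow> nat list \<Rightarrow> 'b tname prog" where
  "walk z b j [] = Nop"
| "walk z b j (v # vs) = Sq (jump z b j v) (walk z b (Suc j) vs)"

primrec walk_cost :: "nat \<Rightarrow> nat \<Rightarrow> nat list \<Rightarrow> nat" where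
  "walk_cost n j [] = 1"
| "walk_cost n j (v # vs) = n * (sweep_cost n 1 j + 9) + 11 + walk_cost n (Suc j) vs + 1"

text \<open>Little-endian base-\<open>n\<close> value, because \<open>List.n_lists\<close> varies
  the first component fastest.\<close>

primrec addr :: "nat \<Rightarrow> nat list \<Rightarrow> nat" where
  "addr n [] = 0"
| "addr n (d # ds) = d + n * addr n ds"

lemma reach_walk:
  assumes "\<forall>j<N. T (Scr j) = (ruler n, 0)" "T Aux = (ruler n, 0)"
    and "\<forall>v\<in>set vs. T (Reg v) = (ruler n, int (\<rho> v)) \<and> \<rho> v < n" "j + length vs \<le> N"
  shows "reach (walk z b j vs) (walk_cost n j vs) T
    (T(Arr b := (fst (T (Arr b)), snd (T (Arr b)) + z * int (n ^ j * addr n (map \<rho> vs)))))"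
  using assms
proof (induction vs arbitrary: j T)
  case Nil
  then show ?case using reach_Nop by simp
next
  case (Cons v vs)
  let ?T = "T(Arr b := (fst (T (Arr b)), snd (T (Arr b)) + z * int (\<rho> v * n ^ j)))"
  have 1: "reach (jump z b j v) (n * (sweep_cost n 1 j + 9) + 11) T ?T"
    using Cons.prems by (intro reach_jump[where N = N]) auto
  have "reach (walk z b (Suc j) vs) (walk_cost n (Suc j) vs) ?T
    (?T(Arr b := (fst (?T (Arr b)), snd (?T (Arr b)) + z * int (n ^ Suc j * addr n (map \<rho> vs)))))"
    using Cons.prems by (intro Cons.IH) auto
  then have 2: "reach (walk z b (Suc j) vs) (walk_cost n (Suc j) vs) ?T
    (T(Arr b := (fst (T (Arr b)), snd (T (Arr b)) + z * int (n ^ j * addr n (map \<rho> (v # vs))))))"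
    by (simp add: algebra_simps)
  show ?case using reach_Sq[OF 1 2] by (simp add: fun_upd_def)
qed

lemma nth_concat_uniform:
  assumes "\<forall>xs\<in>set xss. length xs = n" "i < length xss" "j < n"
  shows "concat xss ! (j + n * i) = xss ! i ! j \<and> j + n * i < length (concat xss)"
  using assms
proof (induction xss arbitrary: i)
  case (Cons xs xss)
  show ?case
  proof (cases i)
    case (Suc k)
    have "j + n * i = length xs + (j + n * k)" using Suc Cons.prems by simp
    then show ?thesis using Cons.IH[of k] Cons.prems Suc by (simp add: nth_append)
  qed (use Cons.prems in \<open>auto simp: nth_append\<close>)
qed simp

lemma nth_n_lists_addr:
  assumes "set ds \<subseteq> {..<n}"
  shows "List.n_lists (length ds) [0..<n] ! addr n ds = ds \<and>
    addr n ds < length (List.n_lists (length ds) [0..<n])"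
  using assms
proof (induction ds)
  case (Cons d ds)
  let ?L = "List.n_lists (length ds) [0..<n]"
  have "concat (map (\<lambda>ys. map (\<lambda>y. y # ys) [0..<n]) ?L) ! (d + n * addr n ds) =
      map (\<lambda>ys. map (\<lambda>y. y # ys) [0..<n]) ?L ! addr n ds ! d \<and>
      d + n * addr n ds < length (concat (map (\<lambda>ys. map (\<lambda>y. y # ys) [0..<n]) ?L))"
    using Cons by (intro nth_concat_uniform) auto
  then show ?case using Cons by simp
qed simp

lemma length_n_lists_upt [simp]: "length (List.n_lists r [0..<n]) = n ^ r"
  by (simp add: length_n_lists)

lemma word_cells_nth: "i < length w \<Longrightarrow> word_cells w (int i) = w ! i"
  by (simp add: word_cells_def)

lemma word_cells_update: "i < length w \<Longrightarrow> (word_cells w)(int i := s) = word_cells (w[i := s])"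
  by (auto simp: word_cells_def fun_eq_iff nth_list_update)

lemma word_cells_snoc: "(word_cells w)(int (length w) := s) = word_cells (w @ [s])"
  by (auto simp: word_cells_def fun_eq_iff nth_append)

text \<open>Only tuples over \<open>{..<n}\<close> have a cell. The values of \<open>f\<close>
  elsewhere are invisible on the tape, so \<open>Fill\<close> may replace the whole
  function.\<close>

definition array_cells :: "nat \<Rightarrow> nat \<Rightarrow> (nat list \<Rightarrow> nat) \<Rightarrow> int \<Rightarrow> nat" where
  "array_cells n r f = word_cells (map f (List.n_lists r [0..<n]))"

lemma array_cells_addr:
  "set ds \<subseteq> {..<n} \<Longrightarrow> length ds = r \<Longrightarrow> array_cells n r f (int (addr n ds)) = f ds"
  using nth_n_lists_addr[of ds n] by (simp add: array_cells_def word_cells_nth)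

lemma map_fun_upd_nth:
  "distinct xs \<Longrightarrow> i < length xs \<Longrightarrow> (map f xs)[i := s] = map (f(xs ! i := s)) xs"
  by (auto simp: list_eq_iff_nth_eq nth_list_update nth_eq_iff_index_eq)

lemma array_cells_update:
  assumes "set ds \<subseteq> {..<n}" "length ds = r"
  shows "(array_cells n r f)(int (addr n ds) := s) = array_cells n r (f(ds := s))"
  using nth_n_lists_addr[OF assms(1)] assms(2)
    map_fun_upd_nth[of "List.n_lists r [0..<n]" "addr n ds" f s]
  by (simp add: array_cells_def word_cells_update distinct_n_lists)

section \<open>A language of bounded loops and its compilation\<close>

datatype 'b cmd =
    Skip
  | Put 'b "nat list" nat
  | Test 'b "nat list" nat "'b cmd" "'b cmd"
  | Seq "'b cmd" "'b cmd"
  | For nat "'b cmd"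
  | Fill 'b nat

type_synonym 'b store = "'b \<Rightarrow> nat list \<Rightarrow> nat"

primrec sem :: "nat \<Rightarrow> 'b cmd \<Rightarrow> (nat \<Rightarrow> nat) \<Rightarrow> 'b store \<Rightarrow> 'b store" where
  "sem n Skip \<rho> A = A"
| "sem n (Put b vs s) \<rho> A = A(b := (A b)(map \<rho> vs := s))"
| "sem n (Test b vs s C D) \<rho> A = (if A b (map \<rho> vs) = s then sem n C \<rho> A else sem n D \<rho> A)"
| "sem n (Seq C D) \<rho> A = sem n D \<rho> (sem n C \<rho> A)"
| "sem n (For v C) \<rho> A = fold (\<lambda>i. sem n C (\<rho>(v := i))) [0..<n] A"
| "sem n (Fill b s) \<rho> A = A(b := \<lambda>_. s)"

text \<open>\<open>V\<close> holds the registers of the enclosing loops. A loop register lies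
  outside \<open>V\<close> because the sweep over its ruler starts with the head on cell 0.
  \<open>N\<close> bounds the registers and also the arities, since moving along a table nests
  sweeps over scratch tapes.\<close>

primrec cmd_ok :: "('b \<Rightarrow> nat) \<Rightarrow> nat \<Rightarrow> nat set \<Rightarrow> 'b cmd \<Rightarrow> bool" where
  "cmd_ok arity N V Skip \<longleftrightarrow> True"
| "cmd_ok arity N V (Put b vs s) \<longleftrightarrow>
     length vs = arity b \<and> arity b \<le> N \<and> set vs \<subseteq> {..<N} \<and> s \<le> 5"
| "cmd_ok arity N V (Test b vs s C D) \<longleftrightarrow>
     length vs = arity b \<and> arity b \<le> N \<and> set vs \<subseteq> {..<N} \<and> cmd_ok arity N V C \<and> cmd_ok arity N V D"
| "cmd_ok arity N V (Seq C D) \<longleftrightarrow> cmd_ok arity N V C \<and> cmd_ok arity N V D"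
| "cmd_ok arity N V (For v C) \<longleftrightarrow> v \<notin> V \<and> v < N \<and> cmd_ok arity N (insert v V) C"
| "cmd_ok arity N V (Fill b s) \<longleftrightarrow> arity b \<le> N \<and> s \<le> 5"

text \<open>Between commands every array head stands on cell 0. \<open>Test\<close> branches while
  the head is at the address, so the way back is duplicated into both branches.\<close>

primrec compile :: "('b \<Rightarrow> nat) \<Rightarrow> 'b cmd \<Rightarrow> 'b tname prog" where
  "compile arity Skip = Nop"
| "compile arity (Put b vs s) = Sq (walk 1 b 0 vs) (Sq (Wr (Arr b) s) (walk (-1) b 0 vs))"
| "compile arity (Test b vs s C D) = Sq (walk 1 b 0 vs)
     (Ift (Arr b) s (Sq (walk (-1) b 0 vs) (compile arity C)) (Sq (walk (-1) b 0 vs) (compile arity D)))"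
| "compile arity (Seq C D) = Sq (compile arity C) (compile arity D)"
| "compile arity (For v C) = sweep (Reg v) (compile arity C)"
| "compile arity (Fill b s) = Sq (sweepN (arity b) (Sq (Wr (Arr b) s) (Mv (Arr b) 1)))
     (sweepN (arity b) (Mv (Arr b) (-1)))"

text \<open>Both branches of a \<open>Test\<close> are charged, so the bound is a function of
  \<open>n\<close> alone and independent of the store.\<close>

primrec cmd_cost :: "('b \<Rightarrow> nat) \<Rightarrow> 'b cmd \<Rightarrow> nat \<Rightarrow> nat" where
  "cmd_cost arity Skip n = 1"
| "cmd_cost arity (Put b vs s) n = 2 * walk_cost n 0 vs + 3"
| "cmd_cost arity (Test b vs s C D) n =
     2 * walk_cost n 0 vs + cmd_cost arity C n + cmd_cost arity D n + 3"
| "cmd_cost arity (Seq C D) n = cmd_cost arity C n + cmd_cost arity D n + 1"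
| "cmd_cost arity (For v C) n = n * (cmd_cost arity C n + 5) + 8"
| "cmd_cost arity (Fill b s) n = sweep_cost n 3 (arity b) + sweep_cost n 1 (arity b) + 1"

definition store_tapes ::
  "('b \<Rightarrow> nat) \<Rightarrow> nat \<Rightarrow> nat \<Rightarrow> tape \<Rightarrow> tape \<Rightarrow> (nat \<Rightarrow> nat) \<Rightarrow> 'b store \<Rightarrow> 'b tname \<Rightarrow> tape" where
  "store_tapes arity N n ti to \<rho> A x = (case x of
      In \<Rightarrow> ti
    | Out \<Rightarrow> to
    | Aux \<Rightarrow> (ruler n, 0)
    | Reg v \<Rightarrow> (if v < N then (ruler n, int (\<rho> v)) else (word_cells [], 0))
    | Scr j \<Rightarrow> (if j < N then (ruler n, 0) else (word_cells [], 0))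
    | Arr b \<Rightarrow> (array_cells n (arity b) (A b), 0))"

lemma store_tapes_simps [simp]:
  "store_tapes arity N n ti to \<rho> A In = ti"
  "store_tapes arity N n ti to \<rho> A Out = to"
  "store_tapes arity N n ti to \<rho> A Aux = (ruler n, 0)"
  "v < N \<Longrightarrow> store_tapes arity N n ti to \<rho> A (Reg v) = (ruler n, int (\<rho> v))"
  "j < N \<Longrightarrow> store_tapes arity N n ti to \<rho> A (Scr j) = (ruler n, 0)"
  "store_tapes arity N n ti to \<rho> A (Arr b) = (array_cells n (arity b) (A b), 0)"
  by (simp_all add: store_tapes_def)

lemma store_tapes_upd [simp]:
  "(store_tapes arity N n ti to \<rho> A)(Arr b := (array_cells n (arity b) f, 0)) =
     store_tapes arity N n ti to \<rho> (A(b := f))"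
  "v < N \<Longrightarrow> (store_tapes arity N n ti to \<rho> A)(Reg v := (ruler n, int i)) =
     store_tapes arity N n ti to (\<rho>(v := i)) A"
  "(store_tapes arity N n ti to \<rho> A)(In := ti') = store_tapes arity N n ti' to \<rho> A"
  "(store_tapes arity N n ti to \<rho> A)(Out := to') = store_tapes arity N n ti to' \<rho> A"
  by (auto simp: store_tapes_def fun_eq_iff split: tname.split)

text \<open>While a table is filled from left to right, its tape holds a prefix of the new table
  followed by a suffix of the old one.\<close>

lemma word_cells_scan:
  assumes "length w = length w'" "i < length w"
  shows "(word_cells (take i w' @ drop i w))(int i := w' ! i) =
    word_cells (take (Suc i) w' @ drop (Suc i) w)"
proof -
  have "(take i w' @ drop i w)[i := w' ! i] = take (Suc i) w' @ drop (Suc i) w"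
    using assms by (simp add: list_update_append take_Suc_conv_app_nth flip: Cons_nth_drop_Suc)
  then show ?thesis using assms by (subst word_cells_update) auto
qed

lemma reach_rewind_array:
  assumes "\<forall>j<N. T (Scr j) = (ruler n, 0)" "r \<le> N" "T (Arr b) = (c, int (n ^ r))"
  shows "reach (sweepN r (Mv (Arr b) (-1))) (sweep_cost n 1 r) T (T(Arr b := (c, 0)))"
  using reach_move[OF assms(1,2), of b "-1"] assms(3) by simp

lemma reach_compile:
  assumes "cmd_ok arity N V C" "\<forall>v. \<rho> v < n" "\<forall>v. v \<notin> V \<longrightarrow> \<rho> v = 0"
  shows "reach (compile arity C) (cmd_cost arity C n)
    (store_tapes arity N n ti to \<rho> A) (store_tapes arity N n ti to \<rho> (sem n C \<rho> A))"
  using assms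
proof (induction C arbitrary: V \<rho> A)
  case Skip
  then show ?case using reach_Nop by simp
next
  case (Put b vs s)
  let ?S = "store_tapes arity N n ti to \<rho>" and ?ds = "map \<rho> vs"
  let ?U = "(?S A)(Arr b := (array_cells n (arity b) (A b), int (addr n ?ds)))"
  let ?A = "A(b := (A b)(?ds := s))"
  let ?U' = "(?S ?A)(Arr b := (array_cells n (arity b) (?A b), int (addr n ?ds)))"
  have ds: "set ?ds \<subseteq> {..<n}" "length ?ds = arity b" using Put.prems by auto
  have 1: "reach (walk 1 b 0 vs) (walk_cost n 0 vs) (?S A) ?U"
    using reach_walk[of N "?S A" n vs \<rho> 0 1 b] Put.prems by (auto simp: subset_iff)
  have 2: "reach (Wr (Arr b) s) 1 ?U ?U'"
    using ds by (intro reach_Wr') (auto simp: fun_eq_iff array_cells_update[symmetric] store_tapes_def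
        split: tname.split)
  have 3: "reach (walk (-1) b 0 vs) (walk_cost n 0 vs) ?U' (?S ?A)"
    using reach_walk[of N ?U' n vs \<rho> 0 "-1" b] Put.prems by (auto simp: subset_iff)
  have "reach (compile arity (Put b vs s)) (2 * walk_cost n 0 vs + 3) (?S A) (?S ?A)"
    using reach_Sq[OF 1 reach_Sq[OF 2 3]] by (auto elim!: reach_mono)
  then show ?case by (simp only: sem.simps cmd_cost.simps)
next
  case (Test b vs s C D)
  let ?S = "store_tapes arity N n ti to \<rho>" and ?ds = "map \<rho> vs"
  let ?U = "(?S A)(Arr b := (array_cells n (arity b) (A b), int (addr n ?ds)))"
  have ds: "set ?ds \<subseteq> {..<n}" "length ?ds = arity b" using Test.prems by auto
  have 1: "reach (walk 1 b 0 vs) (walk_cost n 0 vs) (?S A) ?U"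
    using reach_walk[of N "?S A" n vs \<rho> 0 1 b] Test.prems by (auto simp: subset_iff)
  have 2: "reach (walk (-1) b 0 vs) (walk_cost n 0 vs) ?U (?S A)"
    using reach_walk[of N ?U n vs \<rho> 0 "-1" b] Test.prems by (auto simp: subset_iff)
  have rd: "read_tape (?U (Arr b)) = A b ?ds"
    using ds by (simp add: read_tape_def array_cells_addr)
  have "reach (if A b ?ds = s then Sq (walk (-1) b 0 vs) (compile arity C)
      else Sq (walk (-1) b 0 vs) (compile arity D))
      (walk_cost n 0 vs + (cmd_cost arity C n + cmd_cost arity D n) + 1) ?U
      (?S (sem n (Test b vs s C D) \<rho> A))"
    using reach_Sq[OF 2 Test.IH(1)[of V \<rho> A]] reach_Sq[OF 2 Test.IH(2)[of V \<rho> A]] Test.prems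
    by (auto elim!: reach_mono)
  then have "reach (Ift (Arr b) s (Sq (walk (-1) b 0 vs) (compile arity C))
      (Sq (walk (-1) b 0 vs) (compile arity D)))
      (walk_cost n 0 vs + (cmd_cost arity C n + cmd_cost arity D n) + 1 + 1) ?U
      (?S (sem n (Test b vs s C D) \<rho> A))"
    by (intro reach_Ift) (simp only: rd)
  from reach_Sq[OF 1 this] show ?case by (auto elim!: reach_mono)
next
  case (Seq C D)
  then show ?case
    using reach_Sq[OF Seq.IH(1)[of V \<rho> A] Seq.IH(2)[of V \<rho> "sem n C \<rho> A"]] by simp
next
  case (For v C)
  let ?S = "store_tapes arity N n ti to \<rho>"
  define G where "G i = ?S (fold (\<lambda>i. sem n C (\<rho>(v := i))) [0..<i] A)" for i
  have "reach (sweep (Reg v) (compile arity C)) (n * (cmd_cost arity C n + 5) + 8)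
     ((G 0)(Reg v := (ruler n, 0))) ((G n)(Reg v := (ruler n, 0)))"
  proof (rule reach_sweep[where G = G])
    fix i assume "i < n"
    have "reach (compile arity C) (cmd_cost arity C n)
        (store_tapes arity N n ti to (\<rho>(v := i)) B)
        (store_tapes arity N n ti to (\<rho>(v := i)) (sem n C (\<rho>(v := i)) B))" for B
      by (rule For.IH[of "insert v V"]) (use For.prems \<open>i < n\<close> in auto)
    then show "reach (compile arity C) (cmd_cost arity C n)
      ((G i)(Reg v := (ruler n, int i))) ((G (Suc i))(Reg v := (ruler n, int i)))"
      using For.prems by (simp add: G_def)
  qed
  \<comment> \<open>The loop register is not in \<open>V\<close>, so its value outside the loop is
    already 0.\<close>
  moreover have "(?S B)(Reg v := (ruler n, 0)) = ?S B" for B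
    using For.prems by (auto simp: fun_eq_iff store_tapes_def)
  ultimately show ?case by (simp add: G_def)
next
  case (Fill b s)
  let ?S = "store_tapes arity N n ti to \<rho>"
  let ?r = "arity b" and ?w = "map (A b) (List.n_lists (arity b) [0..<n])"
  let ?w' = "map (\<lambda>_. s) (List.n_lists (arity b) [0..<n])"
  define G where "G i = (?S A)(Arr b := (word_cells (take i ?w' @ drop i ?w), int i))" for i
  have "reach (Sq (Wr (Arr b) s) (Mv (Arr b) 1)) (1 + 1 + 1)
      (set_scr N n q (G i)) (set_scr N n q (G (Suc i)))" if "i < n ^ ?r" for q i
    using word_cells_scan[of ?w ?w' i] that
    by (intro reach_Sq[OF reach_Wr reach_Mv']) (auto simp: G_def)
  then have 1: "reach (sweepN ?r (Sq (Wr (Arr b) s) (Mv (Arr b) 1))) (sweep_cost n (1 + 1 + 1) ?r)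
      (G 0) (G (n ^ ?r))"
    using Fill.prems by (intro reach_sweepN[where N = N and G = G]) (auto simp: G_def)
  have 2: "reach (sweepN ?r (Mv (Arr b) (-1))) (sweep_cost n 1 ?r) (G (n ^ ?r))
      ((G (n ^ ?r))(Arr b := (word_cells ?w', 0)))"
    using Fill.prems by (intro reach_rewind_array[where N = N]) (auto simp: G_def)
  have "G 0 = ?S A" by (auto simp: G_def fun_eq_iff array_cells_def)
  moreover have "(G (n ^ ?r))(Arr b := (word_cells ?w', 0)) = ?S (A(b := \<lambda>_. s))"
    using store_tapes_upd(1)[of arity N n ti to \<rho> A b "\<lambda>_. s"] by (simp add: G_def array_cells_def)
  ultimately have "reach (compile arity (Fill b s)) (cmd_cost arity (Fill b s) n)
      (?S A) (?S (A(b := \<lambda>_. s)))"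
    using reach_Sq[OF 1 2] by (simp add: numeral_3_eq_3)
  then show ?case by (simp only: sem.simps)
qed

section \<open>Reading the input and writing the output\<close>

primrec each :: "('c \<Rightarrow> 'a prog) \<Rightarrow> 'c list \<Rightarrow> 'a prog" where
  "each f [] = Nop"
| "each f (x # xs) = Sq (f x) (each f xs)"

lemma reach_each:
  assumes "\<And>x T. x \<in> set xs \<Longrightarrow> P (T x) \<Longrightarrow> reach (f x) t T (T(x := g (T x)))"
    and "distinct xs" "\<forall>x\<in>set xs. P (T x)"
  shows "reach (each f xs) (length xs * (t + 1) + 1) T (\<lambda>x. if x \<in> set xs then g (T x) else T x)"
  using assms
proof (induction xs arbitrary: T)
  case Nil
  then show ?case using reach_Nop by simp
next
  case (Cons x xs)
  let ?T = "T(x := g (T x))"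
  have 1: "reach (f x) t T ?T" by (rule Cons.prems(1)) (use Cons.prems in auto)
  have 2: "reach (each f xs) (length xs * (t + 1) + 1) ?T
      (\<lambda>y. if y \<in> set xs then g (?T y) else ?T y)"
  proof (rule Cons.IH)
    show "reach (f y) t T (T(y := g (T y)))" if "y \<in> set xs" "P (T y)" for y T
      using that by (intro Cons.prems(1)) auto
  qed (use Cons.prems in auto)
  have "(\<lambda>y. if y \<in> set xs then g (?T y) else ?T y) =
      (\<lambda>y. if y \<in> set (x # xs) then g (T y) else T y)"
    using Cons.prems(2) by auto
  with reach_Sq[OF 1 2] show ?case by (auto elim!: reach_mono)
qed

definition mark :: "'a \<Rightarrow> 'a prog" where
  "mark x = Sq (Wr x 4) (Mv x 1)"

definition rewind :: "'a \<Rightarrow> 'a prog" where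
  "rewind x = Sq (Mv x (-1)) (Sq (Whl x 4 (Mv x (-1))) (Mv x 1))"

definition rulers :: "nat \<Rightarrow> 'b tname list" where
  "rulers N = Aux # map Reg [0..<N] @ map Scr [0..<N]"

text \<open>The unary prefix of the input is copied to all rulers. It is also the prefix of the
  answer, so \<open>Out\<close> is marked along with them but not rewound: the tables are appended
  there. \<open>In\<close> is left at the first table entry.\<close>

definition init :: "nat \<Rightarrow> 'b tname prog" where
  "init N = Sq (Whl In 4 (Sq (each mark (Out # rulers N)) (Mv In 1))) (each rewind (rulers N))"

definition init_cost :: "nat \<Rightarrow> nat \<Rightarrow> nat" where
  "init_cost N n = n * ((2 * N + 2) * 4 + 4) + (2 * N + 1) * (2 * n + 6) + 3"

lemma distinct_rulers: "distinct (Out # rulers N)" "In \<notin> set (rulers N)" "Out \<notin> set (rulers N)"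
  by (auto simp: rulers_def distinct_map inj_on_def)

lemma length_rulers: "length (rulers N) = 2 * N + 1"
  by (simp add: rulers_def)

lemma array_cells_zero: "array_cells n r (\<lambda>_. 0) = word_cells []"
  by (auto simp: array_cells_def word_cells_def fun_eq_iff map_replicate_const nat_less_iff)

lemma reach_mark: "reach (mark x) 3 T (T(x := ((fst (T x))(snd (T x) := 4), snd (T x) + 1)))"
proof -
  have "reach (Sq (Wr x 4) (Mv x 1)) (1 + 1 + 1) T
      (T(x := ((fst (T x))(snd (T x) := 4), snd (T x) + 1)))"
    by (rule reach_Sq[OF reach_Wr reach_Mv']) simp
  then show ?thesis by (simp add: mark_def numeral_3_eq_3)
qed

lemma reach_rewind:
  assumes "T x = (ruler n, int n)"
  shows "reach (rewind x) (2 * n + 5) T (T(x := (ruler n, 0)))"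
proof -
  define S where "S i = T(x := (ruler n, int n - 1 - int i))" for i
  have 1: "reach (Mv x (-1)) 1 T (S 0)"
    using assms by (intro reach_Mv') (auto simp: S_def)
  have 2: "reach (Whl x 4 (Mv x (-1))) (n * (1 + 1) + 1) (S 0) (S n)"
    by (intro reach_Whl[where S = S] conjI reach_Mv') (auto simp: S_def)
  have 3: "reach (Mv x 1) 1 (S n) (T(x := (ruler n, 0)))"
    by (intro reach_Mv') (auto simp: S_def)
  show ?thesis unfolding rewind_def
    using reach_Sq[OF 1 reach_Sq[OF 2 3]] by (auto elim!: reach_mono)
qed

lemma reach_init:
  fixes arity :: "'b \<Rightarrow> nat"
  assumes w: "word_cells w (int n) \<noteq> 4" "\<forall>i<n. word_cells w (int i) = 4"
  shows "reach (init N) (init_cost N n) ((\<lambda>_. (word_cells [], 0))(In := (word_cells w, 0)))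
    (store_tapes arity N n (word_cells w, int n) (ruler n, int n) (\<lambda>_. 0) (\<lambda>_ _. 0))"
proof -
  let ?X = "set (Out # rulers N) :: 'b tname set"
  define S where "S i = (\<lambda>x. if x \<in> ?X then (word_cells (replicate i 4), int i)
      else if x = In then (word_cells w, int i) else (word_cells [], 0))" for i
  let ?g = "\<lambda>tp :: tape. ((fst tp)(snd tp := 4), snd tp + 1)"
  have step: "reach (Sq (each mark (Out # rulers N)) (Mv In 1)) ((2 * N + 2) * 4 + 3) (S i) (S (Suc i))" for i
  proof -
    have 1: "reach (each mark (Out # rulers N)) (length (Out # rulers N :: 'b tname list) * (3 + 1) + 1) (S i)
        (\<lambda>x. if x \<in> ?X then ?g (S i x) else S i x)"
      using distinct_rulers(1)
      by (intro reach_each[where P = "\<lambda>_. True" and g = ?g] reach_mark) auto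
    have app: "replicate i 4 @ [4 :: nat] = replicate (Suc i) 4" by (simp add: replicate_append_same)
    have 2: "reach (Mv In 1) 1 (\<lambda>x. if x \<in> ?X then ?g (S i x) else S i x) (S (Suc i))"
      using distinct_rulers(2) word_cells_snoc[of "replicate i 4" 4] app
      by (intro reach_Mv') (auto simp: S_def fun_eq_iff)
    show ?thesis
      using reach_Sq[OF 1 2] by (rule reach_mono) (simp add: length_rulers)
  qed
  have 1: "reach (Whl In 4 (Sq (each mark (Out # rulers N)) (Mv In 1)))
      (n * ((2 * N + 2) * 4 + 3 + 1) + 1) (S 0) (S n)"
    using w distinct_rulers(2) step
    by (intro reach_Whl[where S = S]) (auto simp: S_def read_tape_def)
  have 2: "reach (each rewind (rulers N)) (length (rulers N :: 'b tname list) * (2 * n + 5 + 1) + 1) (S n)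
      (\<lambda>x. if x \<in> set (rulers N) then (ruler n, 0) else S n x)"
    using distinct_rulers(1)
    by (intro reach_each[where P = "\<lambda>tp. tp = (ruler n, int n)" and g = "\<lambda>_. (ruler n, 0)"]
        reach_rewind) (auto simp: S_def ruler_def)
  have "S 0 = (\<lambda>_. (word_cells [], 0))(In := (word_cells w, 0))"
    using distinct_rulers(2) by (auto simp: S_def fun_eq_iff)
  moreover have "(\<lambda>x. if x \<in> set (rulers N) then (ruler n, 0) else S n x) =
      store_tapes arity N n (word_cells w, int n) (ruler n, int n) (\<lambda>_. 0) (\<lambda>_ _. 0)"
    by (auto simp: S_def fun_eq_iff store_tapes_def rulers_def ruler_def array_cells_zero
        split: tname.split)
  ultimately show ?thesis unfolding init_def using reach_Sq[OF 1 2]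
    by (simp only: length_rulers) (erule reach_mono, simp add: init_cost_def)
qed

text \<open>Unknown is loaded as false. In an instance only endogenous atoms are unknown, and false
  is their value in the lower bound from which the iteration starts.\<close>

definition bit_code :: "nat \<Rightarrow> nat" where
  "bit_code s = (if s = 3 then 3 else 1)"

definition load :: "('b \<Rightarrow> nat) \<Rightarrow> 'b \<Rightarrow> 'b tname prog" where
  "load arity b = Sq
     (sweepN (arity b) (Sq (Ift In 3 (Wr (Arr b) 3) (Wr (Arr b) 1)) (Sq (Mv In 1) (Mv (Arr b) 1))))
     (sweepN (arity b) (Mv (Arr b) (-1)))"

definition emit :: "('b \<Rightarrow> nat) \<Rightarrow> 'b \<Rightarrow> 'b tname prog" where
  "emit arity b = Sq
     (sweepN (arity b) (Sq (Ift (Arr b) 3 (Wr Out 3) (Wr Out 1)) (Sq (Mv Out 1) (Mv (Arr b) 1))))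
     (sweepN (arity b) (Mv (Arr b) (-1)))"

definition copy_cost :: "nat \<Rightarrow> nat \<Rightarrow> nat" where
  "copy_cost r n = sweep_cost n 6 r + sweep_cost n 1 r + 1"

lemma reach_bit_code:
  "reach (Ift x 3 (Wr y 3) (Wr y 1)) 2 T
    (T(y := ((fst (T y))(snd (T y) := bit_code (read_tape (T x))), snd (T y))))"
proof -
  have "reach (if read_tape (T x) = 3 then Wr y 3 else Wr y 1) 1 T
      (T(y := ((fst (T y))(snd (T y) := bit_code (read_tape (T x))), snd (T y))))"
    by (auto simp: bit_code_def reach_Wr simp del: One_nat_def)
  then show ?thesis using reach_Ift by (metis one_add_one)
qed

lemma word_cells_append: "i < length v \<Longrightarrow> word_cells (u @ v @ w) (int (length u) + int i) = v ! i"
  by (auto simp: word_cells_def nth_append nat_add_distrib)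

abbreviation table :: "nat \<Rightarrow> nat \<Rightarrow> (nat list \<Rightarrow> nat) \<Rightarrow> nat list" where
  "table n r f \<equiv> map f (List.n_lists r [0..<n])"

lemma reach_load:
  assumes "arity b \<le> N" and w: "w = u @ table n (arity b) g @ v"
  shows "reach (load arity b) (copy_cost (arity b) n)
    (store_tapes arity N n (word_cells w, int (length u)) to \<rho> A)
    (store_tapes arity N n (word_cells w, int (length u + n ^ arity b)) to \<rho> (A(b := (\<lambda>ds. bit_code (g ds)))))"
proof -
  let ?S = "\<lambda>k. store_tapes arity N n (word_cells w, k) to \<rho>"
  let ?k = "int (length u)" and ?r = "arity b" and ?w = "table n (arity b) (A b)"
    and ?w' = "table n (arity b) (\<lambda>ds. bit_code (g ds))"
  define G where "G i = (?S (?k + int i) A)(Arr b := (word_cells (take i ?w' @ drop i ?w), int i))" for i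
  have "reach (Sq (Ift In 3 (Wr (Arr b) 3) (Wr (Arr b) 1)) (Sq (Mv In 1) (Mv (Arr b) 1))) (2 + (1 + 1 + 1) + 1)
      (set_scr N n q (G i)) (set_scr N n q (G (Suc i)))" if i: "i < n ^ ?r" for q i
  proof (rule reach_Sq[OF reach_bit_code reach_Sq[OF reach_Mv reach_Mv']])
    let ?T = "set_scr N n q (G i)"
    let ?T' = "?T(Arr b := ((fst (?T (Arr b)))(snd (?T (Arr b)) := bit_code (read_tape (?T In))), snd (?T (Arr b))))"
    let ?T'' = "?T'(In := (fst (?T' In), snd (?T' In) + 1))"
    have "read_tape (?T In) = table n ?r g ! i"
      using word_cells_append[of i "table n ?r g" u v] i by (simp add: G_def read_tape_def w)
    then have "bit_code (read_tape (?T In)) = ?w' ! i" using i by simp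
    then have arr: "?T' (Arr b) = (word_cells (take (Suc i) ?w' @ drop (Suc i) ?w), int i)"
      using word_cells_scan[of ?w ?w' i] i by (simp add: G_def)
    show "set_scr N n q (G (Suc i)) = ?T''(Arr b := (fst (?T'' (Arr b)), snd (?T'' (Arr b)) + 1))"
      using arr by (auto simp: G_def fun_eq_iff set_scr_def store_tapes_def split: tname.split)
  qed
  then have 1: "reach (sweepN ?r (Sq (Ift In 3 (Wr (Arr b) 3) (Wr (Arr b) 1)) (Sq (Mv In 1) (Mv (Arr b) 1))))
      (sweep_cost n (2 + (1 + 1 + 1) + 1) ?r) (G 0) (G (n ^ ?r))"
    using assms by (intro reach_sweepN[where N = N and G = G]) (auto simp: G_def)
  have 2: "reach (sweepN ?r (Mv (Arr b) (-1))) (sweep_cost n 1 ?r) (G (n ^ ?r))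
      ((G (n ^ ?r))(Arr b := (word_cells ?w', 0)))"
    using assms by (intro reach_rewind_array[where N = N]) (auto simp: G_def)
  have "G 0 = ?S ?k A" by (auto simp: G_def fun_eq_iff array_cells_def)
  moreover have "(G (n ^ ?r))(Arr b := (word_cells ?w', 0)) = ?S (?k + int (n ^ ?r)) (A(b := (\<lambda>ds. bit_code (g ds))))"
    by (auto simp: G_def fun_eq_iff array_cells_def store_tapes_def split: tname.split)
  ultimately show ?thesis using reach_Sq[OF 1 2] by (simp add: load_def copy_cost_def)
qed

lemma reach_emit:
  assumes "arity b \<le> N"
  shows "reach (emit arity b) (copy_cost (arity b) n)
    (store_tapes arity N n ti (word_cells u, int (length u)) \<rho> A)
    (store_tapes arity N n ti (word_cells (u @ table n (arity b) (\<lambda>ds. bit_code (A b ds))),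
       int (length u + n ^ arity b)) \<rho> A)"
proof -
  let ?S = "\<lambda>to. store_tapes arity N n ti to \<rho> A"
  let ?k = "int (length u)" and ?r = "arity b" and ?w = "table n (arity b) (A b)"
    and ?w' = "table n (arity b) (\<lambda>ds. bit_code (A b ds))"
  define G where "G i = (?S (word_cells (u @ take i ?w'), ?k + int i))(Arr b := (word_cells ?w, int i))" for i
  have "reach (Sq (Ift (Arr b) 3 (Wr Out 3) (Wr Out 1)) (Sq (Mv Out 1) (Mv (Arr b) 1))) (2 + (1 + 1 + 1) + 1)
      (set_scr N n q (G i)) (set_scr N n q (G (Suc i)))" if i: "i < n ^ ?r" for q i
  proof (rule reach_Sq[OF reach_bit_code reach_Sq[OF reach_Mv reach_Mv']])
    let ?T = "set_scr N n q (G i)"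
    let ?T' = "?T(Out := ((fst (?T Out))(snd (?T Out) := bit_code (read_tape (?T (Arr b)))), snd (?T Out)))"
    let ?T'' = "?T'(Out := (fst (?T' Out), snd (?T' Out) + 1))"
    have "read_tape (?T (Arr b)) = ?w ! i"
      using i by (simp add: G_def read_tape_def word_cells_nth)
    then have "bit_code (read_tape (?T (Arr b))) = ?w' ! i" using i by simp
    then have out: "?T' Out = (word_cells (u @ take (Suc i) ?w'), ?k + int i)"
      using word_cells_snoc[of "u @ take i ?w'" "?w' ! i"] i by (simp add: G_def take_Suc_conv_app_nth)
    show "set_scr N n q (G (Suc i)) = ?T''(Arr b := (fst (?T'' (Arr b)), snd (?T'' (Arr b)) + 1))"
      using out by (auto simp: G_def fun_eq_iff set_scr_def store_tapes_def split: tname.split)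
  qed
  then have 1: "reach (sweepN ?r (Sq (Ift (Arr b) 3 (Wr Out 3) (Wr Out 1)) (Sq (Mv Out 1) (Mv (Arr b) 1))))
      (sweep_cost n (2 + (1 + 1 + 1) + 1) ?r) (G 0) (G (n ^ ?r))"
    using assms by (intro reach_sweepN[where N = N and G = G]) (auto simp: G_def)
  have 2: "reach (sweepN ?r (Mv (Arr b) (-1))) (sweep_cost n 1 ?r) (G (n ^ ?r))
      ((G (n ^ ?r))(Arr b := (word_cells ?w, 0)))"
    using assms by (intro reach_rewind_array[where N = N]) (auto simp: G_def)
  have "G 0 = ?S (word_cells u, ?k)" by (auto simp: G_def fun_eq_iff array_cells_def)
  moreover have "(G (n ^ ?r))(Arr b := (word_cells ?w, 0)) = ?S (word_cells (u @ ?w'), ?k + int (n ^ ?r))"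
    by (auto simp: G_def fun_eq_iff array_cells_def store_tapes_def split: tname.split)
  ultimately show ?thesis using reach_Sq[OF 1 2] by (simp add: emit_def copy_cost_def)
qed

definition copies_cost :: "('b \<Rightarrow> nat) \<Rightarrow> 'b list \<Rightarrow> nat \<Rightarrow> nat" where
  "copies_cost arity bs n = (\<Sum>b\<leftarrow>bs. copy_cost (arity b) n + 1) + 1"

lemma reach_loads:
  assumes "\<forall>b\<in>set bs. arity b \<le> N"
    and "w = u @ concat (map (\<lambda>b. table n (arity b) (g b)) bs)"
  shows "\<exists>k. reach (each (load arity) bs) (copies_cost arity bs n)
    (store_tapes arity N n (word_cells w, int (length u)) to \<rho> A)
    (store_tapes arity N n (word_cells w, k) to \<rho> (\<lambda>b. if b \<in> set bs then (\<lambda>ds. bit_code (g b ds)) else A b))"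
  using assms
proof (induction bs arbitrary: u A)
  case Nil
  then show ?case using reach_Nop by (auto simp: copies_cost_def)
next
  case (Cons b bs)
  let ?u = "u @ table n (arity b) (g b)" and ?A = "A(b := (\<lambda>ds. bit_code (g b ds)))"
  have w: "w = u @ table n (arity b) (g b) @ concat (map (\<lambda>b. table n (arity b) (g b)) bs)"
    using Cons.prems(2) by simp
  have 1: "reach (load arity b) (copy_cost (arity b) n)
      (store_tapes arity N n (word_cells w, int (length u)) to \<rho> A)
      (store_tapes arity N n (word_cells w, int (length ?u)) to \<rho> ?A)"
    using reach_load[where arity = arity and b = b, OF _ w] Cons.prems(1) by simp
  have "\<exists>k. reach (each (load arity) bs) (copies_cost arity bs n)
      (store_tapes arity N n (word_cells w, int (length ?u)) to \<rho> ?A)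
      (store_tapes arity N n (word_cells w, k) to \<rho> (\<lambda>b. if b \<in> set bs then (\<lambda>ds. bit_code (g b ds)) else ?A b))"
    by (rule Cons.IH) (use Cons.prems in auto)
  then obtain k where 2: "reach (each (load arity) bs) (copies_cost arity bs n)
      (store_tapes arity N n (word_cells w, int (length ?u)) to \<rho> ?A)
      (store_tapes arity N n (word_cells w, k) to \<rho>
        (\<lambda>b. if b \<in> set bs then (\<lambda>ds. bit_code (g b ds)) else ?A b))"
    by blast
  have "(\<lambda>c. if c \<in> set bs then (\<lambda>ds. bit_code (g c ds)) else ?A c) =
      (\<lambda>c. if c \<in> set (b # bs) then (\<lambda>ds. bit_code (g c ds)) else A c)" by auto
  with reach_Sq[OF 1 2] show ?case
    by (intro exI[of _ k]) (auto simp: copies_cost_def elim!: reach_mono)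
qed

lemma reach_emits:
  assumes "\<forall>b\<in>set bs. arity b \<le> N"
  shows "\<exists>k. reach (each (emit arity) bs) (copies_cost arity bs n)
    (store_tapes arity N n ti (word_cells u, int (length u)) \<rho> A)
    (store_tapes arity N n ti
      (word_cells (u @ concat (map (\<lambda>b. table n (arity b) (\<lambda>ds. bit_code (A b ds))) bs)), k) \<rho> A)"
  using assms
proof (induction bs arbitrary: u)
  case Nil
  then show ?case using reach_Nop by (auto simp: copies_cost_def)
next
  case (Cons b bs)
  let ?u = "u @ table n (arity b) (\<lambda>ds. bit_code (A b ds))"
  have 1: "reach (emit arity b) (copy_cost (arity b) n)
      (store_tapes arity N n ti (word_cells u, int (length u)) \<rho> A)
      (store_tapes arity N n ti (word_cells ?u, int (length ?u)) \<rho> A)"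
    using Cons.prems reach_emit[of arity b N n ti u \<rho> A] by simp
  obtain k where 2: "reach (each (emit arity) bs) (copies_cost arity bs n)
      (store_tapes arity N n ti (word_cells ?u, int (length ?u)) \<rho> A)
      (store_tapes arity N n ti
        (word_cells (?u @ concat (map (\<lambda>b. table n (arity b) (\<lambda>ds. bit_code (A b ds))) bs)), k) \<rho> A)"
    using Cons.IH[of ?u] Cons.prems by auto
  from reach_Sq[OF 1 2] show ?case
    by (intro exI[of _ k]) (auto simp: copies_cost_def elim!: reach_mono)
qed

section \<open>Polynomial cost bounds\<close>

text \<open>For \<open>n \<ge> 1\<close> a monomial absorbs constants and lower powers, so this form
  is closed under sums and products. Domains of instances are nonempty.\<close>

definition poly_bounded :: "(nat \<Rightarrow> nat) \<Rightarrow> bool" where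
  "poly_bounded f \<longleftrightarrow> (\<exists>c k. \<forall>n\<ge>1. f n \<le> c * n ^ k)"

lemma poly_bounded_const: "poly_bounded (\<lambda>_. c)"
  unfolding poly_bounded_def by (intro exI[of _ c] exI[of _ 0]) simp

lemma poly_bounded_id: "poly_bounded (\<lambda>n. n)"
  unfolding poly_bounded_def by (intro exI[of _ 1] exI[of _ 1]) simp

lemma poly_bounded_add:
  assumes "poly_bounded f" "poly_bounded g"
  shows "poly_bounded (\<lambda>n. f n + g n)"
proof -
  obtain c k d l where f: "\<And>n. n \<ge> 1 \<Longrightarrow> f n \<le> c * n ^ k" and g: "\<And>n. n \<ge> 1 \<Longrightarrow> g n \<le> d * n ^ l"
    using assms unfolding poly_bounded_def by blast
  have "f n + g n \<le> (c + d) * n ^ (k + l)" if n: "n \<ge> 1" for n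
  proof -
    have "f n + g n \<le> c * n ^ k + d * n ^ l" using f[OF n] g[OF n] by simp
    also have "\<dots> \<le> c * n ^ (k + l) + d * n ^ (k + l)"
      using n by (intro add_mono mult_le_mono2 power_increasing) auto
    finally show ?thesis by (simp add: algebra_simps)
  qed
  then show ?thesis unfolding poly_bounded_def by blast
qed

lemma poly_bounded_mult:
  assumes "poly_bounded f" "poly_bounded g"
  shows "poly_bounded (\<lambda>n. f n * g n)"
proof -
  obtain c k d l where f: "\<And>n. n \<ge> 1 \<Longrightarrow> f n \<le> c * n ^ k" and g: "\<And>n. n \<ge> 1 \<Longrightarrow> g n \<le> d * n ^ l"
    using assms unfolding poly_bounded_def by blast
  have "f n * g n \<le> (c * d) * n ^ (k + l)" if n: "n \<ge> 1" for n
    using mult_le_mono[OF f[OF n] g[OF n]] by (simp add: power_add ac_simps)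
  then show ?thesis unfolding poly_bounded_def by blast
qed

lemma poly_bounded_Suc: "poly_bounded f \<Longrightarrow> poly_bounded (\<lambda>n. Suc (f n))"
  using poly_bounded_add[OF poly_bounded_const[of 1]] by simp

lemmas poly_bounded_intros =
  poly_bounded_const poly_bounded_id poly_bounded_Suc poly_bounded_add poly_bounded_mult

lemma poly_bounded_sum_list:
  "(\<And>x. poly_bounded (f x)) \<Longrightarrow> poly_bounded (\<lambda>n. \<Sum>x\<leftarrow>xs. f x n)"
  by (induction xs) (auto intro!: poly_bounded_intros)

lemma poly_bounded_sweep_cost: "poly_bounded (\<lambda>n. sweep_cost n t r)"
  by (induction r) (auto intro!: poly_bounded_intros)

lemma poly_bounded_walk_cost: "poly_bounded (\<lambda>n. walk_cost n j vs)"
  by (induction vs arbitrary: j) (auto intro!: poly_bounded_intros poly_bounded_sweep_cost)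

lemma poly_bounded_cmd_cost: "poly_bounded (cmd_cost arity C)"
proof -
  have "poly_bounded (\<lambda>n. cmd_cost arity C n)"
    by (induction C)
      (auto intro!: poly_bounded_intros poly_bounded_sweep_cost poly_bounded_walk_cost)
  then show ?thesis .
qed

lemma poly_bounded_copies_cost: "poly_bounded (\<lambda>n. copies_cost arity bs n)"
  unfolding copies_cost_def copy_cost_def
  by (intro poly_bounded_intros poly_bounded_sum_list poly_bounded_sweep_cost)

lemma prog_ok_sweep [simp]: "prog_ok (sweep x p) \<longleftrightarrow> prog_ok p"
  by (simp add: sweep_def)

lemma prog_ok_sweepN [simp]: "prog_ok (sweepN r p) \<longleftrightarrow> prog_ok p"
  by (induction r) auto

lemma prog_ok_walk [simp]: "z \<in> {-1, 1} \<Longrightarrow> prog_ok (walk z b j vs)"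
  by (induction vs arbitrary: j) (auto simp: jump_def)

lemma prog_ok_compile: "cmd_ok arity N V C \<Longrightarrow> prog_ok (compile arity C)"
  by (induction C arbitrary: V) auto

lemma prog_ok_each [simp]: "prog_ok (each f xs) \<longleftrightarrow> (\<forall>x\<in>set xs. prog_ok (f x))"
  by (induction xs) auto

text \<open>The tables must avoid the symbol 4 because its first absence ends the unary prefix.
  Arrays outside \<open>bs\<close> start on blank tapes, that is, with constant value 0.\<close>

lemma loop_program_tm:
  fixes bs :: "'b list"
  assumes "cmd_ok arity N {} C" "\<forall>b\<in>set bs. arity b \<le> N"
  shows "\<exists>M c k. tm_wf M \<and> tm_symbols M = {..5} \<and>
    (\<forall>n g. 1 \<le> n \<longrightarrow> (\<forall>b ds. g b ds \<noteq> 4) \<longrightarrow>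
      (let A = sem n C (\<lambda>_. 0) (\<lambda>b. if b \<in> set bs then (\<lambda>ds. bit_code (g b ds)) else (\<lambda>_. 0))
       in \<exists>t\<le>c * n ^ k. tm_computes M
          (replicate n 4 @ concat (map (\<lambda>b. table n (arity b) (g b)) bs))
          (replicate n 4 @ concat (map (\<lambda>b. table n (arity b) (\<lambda>ds. bit_code (A b ds))) bs)) t))"
proof -
  define p where "p = Sq (init N) (Sq (each (load arity) bs) (Sq (compile arity C) (each (emit arity) bs)))"
  define cost where "cost n =
    init_cost N n + (copies_cost arity bs n + (cmd_cost arity C n + copies_cost arity bs n + 1) + 1) + 1" for n
  have "poly_bounded (\<lambda>n. cost n)"
    unfolding cost_def init_cost_def
    by (intro poly_bounded_intros poly_bounded_copies_cost poly_bounded_cmd_cost)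
  then obtain c k where ck: "\<And>n. n \<ge> 1 \<Longrightarrow> cost n \<le> c * n ^ k"
    unfolding poly_bounded_def by blast
  have ok: "prog_ok p"
    using prog_ok_compile[OF assms(1)]
    by (simp add: p_def init_def load_def emit_def mark_def rewind_def)
  \<comment> \<open>\<open>In\<close> and \<open>Out\<close> are put in front of the list, which
    makes them tapes 0 and 1.\<close>
  obtain xs where xs: "distinct xs" "set xs = ptapes p - {In, Out}"
    using finite_distinct_list[of "ptapes p - {In, Out}"] by auto
  then have "distinct (In # Out # xs)" "ptapes p \<subseteq> set (In # Out # xs)" by auto
  from reach_tm[OF ok this] obtain M where M: "tm_wf M" "tm_symbols M = {..5}"
    "\<forall>w v t T' h. reach p t ((\<lambda>_. (word_cells [], 0))(In := (word_cells w, 0))) T' \<longrightarrow>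
        T' Out = (word_cells v, h) \<longrightarrow> (\<exists>t'\<le>t. tm_computes M w v t')"
    by (elim exE conjE)
  have "\<exists>t\<le>c * n ^ k. tm_computes M
          (replicate n 4 @ concat (map (\<lambda>b. table n (arity b) (g b)) bs))
          (replicate n 4 @ concat (map (\<lambda>b. table n (arity b) (\<lambda>ds. bit_code
            (sem n C (\<lambda>_. 0) (\<lambda>b. if b \<in> set bs then (\<lambda>ds. bit_code (g b ds)) else (\<lambda>_. 0)) b ds))) bs)) t"
    if n: "n \<ge> 1" and g: "\<forall>b ds. g b ds \<noteq> 4" for n and g :: "'b \<Rightarrow> nat list \<Rightarrow> nat"
  proof -
    let ?u = "replicate n (4 :: nat)" and ?t = "concat (map (\<lambda>b. table n (arity b) (g b)) bs)"
    let ?w = "?u @ ?t" and ?B = "\<lambda>b. if b \<in> set bs then (\<lambda>ds. bit_code (g b ds)) else (\<lambda>_. 0)"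
    let ?A = "sem n C (\<lambda>_. 0) ?B"
    let ?v = "?u @ concat (map (\<lambda>b. table n (arity b) (\<lambda>ds. bit_code (?A b ds))) bs)"
    have t: "4 \<notin> set ?t" using g by auto
    \<comment> \<open>The prefix is followed by the first table entry or, if there is no entry, by a
      blank.\<close>
    have "word_cells ?w (int n) \<noteq> 4"
      using t nth_mem[of 0 ?t] by (cases "?t = []") (auto simp: word_cells_def nth_append)
    then have 1: "reach (init N) (init_cost N n) ((\<lambda>_. (word_cells [], 0))(In := (word_cells ?w, 0)))
        (store_tapes arity N n (word_cells ?w, int (length ?u)) (word_cells ?u, int (length ?u)) (\<lambda>_. 0) (\<lambda>_ _. 0))"
      using reach_init[of ?w n N arity] by (simp add: ruler_def word_cells_def nth_append)
    obtain h where 2: "reach (each (load arity) bs) (copies_cost arity bs n)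
        (store_tapes arity N n (word_cells ?w, int (length ?u)) (word_cells ?u, int (length ?u)) (\<lambda>_. 0) (\<lambda>_ _. 0))
        (store_tapes arity N n (word_cells ?w, h) (word_cells ?u, int (length ?u)) (\<lambda>_. 0) ?B)"
      using reach_loads[OF assms(2) refl] by blast
    have 3: "reach (compile arity C) (cmd_cost arity C n)
        (store_tapes arity N n (word_cells ?w, h) (word_cells ?u, int (length ?u)) (\<lambda>_. 0) ?B)
        (store_tapes arity N n (word_cells ?w, h) (word_cells ?u, int (length ?u)) (\<lambda>_. 0) ?A)"
      using n by (intro reach_compile[OF assms(1)]) auto
    obtain h' where 4: "reach (each (emit arity) bs) (copies_cost arity bs n)
        (store_tapes arity N n (word_cells ?w, h) (word_cells ?u, int (length ?u)) (\<lambda>_. 0) ?A)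
        (store_tapes arity N n (word_cells ?w, h) (word_cells ?v, h') (\<lambda>_. 0) ?A)"
      using reach_emits[OF assms(2)] by blast
    have "\<exists>t'\<le>cost n. tm_computes M ?w ?v t'"
      by (rule M(3)[rule_format, OF reach_Sq[OF 1 reach_Sq[OF 2 reach_Sq[OF 3 4]], folded p_def cost_def]]) simp
    then show ?thesis using ck[OF n] order_trans by blast
  qed
  then show ?thesis using M(1,2) unfolding Let_def by blast
qed

section \<open>Well-founded fixpoints of symmetric approximators\<close>

lemma of_pair_simps:
  "of_pair X Y a = TT \<longleftrightarrow> a \<in> X"
  "X \<subseteq> Y \<Longrightarrow> of_pair X Y a = FF \<longleftrightarrow> a \<notin> Y"
  by (auto simp: of_pair_def)

lemma lower_of_pair [simp]: "lower (of_pair X Y) = X"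
  by (auto simp: lower_def of_pair_def)

lemma upper_of_pair [simp]: "X \<subseteq> Y \<Longrightarrow> upper (of_pair X Y) = Y"
  by (auto simp: upper_def of_pair_def)

lemma lower_subset_upper: "lower J \<subseteq> upper J"
  by (auto simp: lower_def upper_def)

text \<open>The upper bound comes from the same operator with exchanged arguments. Only consistent
  pairs are three-valued sets, hence the premises \<open>X \<subseteq> Y\<close> on
  \<open>A\<close>.\<close>

locale symmetric_approximator =
  fixes A :: "('a \<Rightarrow> tv) \<Rightarrow> 'a \<Rightarrow> tv" and P :: "'a set \<Rightarrow> 'a set \<Rightarrow> 'a set"
  assumes P_mono: "X \<subseteq> X' \<Longrightarrow> Y' \<subseteq> Y \<Longrightarrow> P X Y \<subseteq> P X' Y'"
    and lower_A: "X \<subseteq> Y \<Longrightarrow> lower (A (of_pair X Y)) = P X Y"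
    and upper_A: "X \<subseteq> Y \<Longrightarrow> upper (A (of_pair X Y)) = P Y X"
begin

text \<open>The stable operator, analogous to the least model of the reduct in logic
  programming.\<close>

definition gam :: "'a set \<Rightarrow> 'a set" where
  "gam Y = lfp (\<lambda>X. P X Y)"

definition wf_lower :: "'a set" where
  "wf_lower = lfp (\<lambda>X. gam (gam X))"

lemma mono_P: "mono (\<lambda>X. P X Y)"
  by (rule monoI) (rule P_mono, auto)

lemma gam_unfold: "P (gam Y) Y = gam Y"
  unfolding gam_def by (rule lfp_unfold[OF mono_P, symmetric])

lemma gam_least: "P X Y \<subseteq> X \<Longrightarrow> gam Y \<subseteq> X"
  unfolding gam_def by (rule lfp_lowerbound)

lemma gam_antimono: "X \<subseteq> Y \<Longrightarrow> gam Y \<subseteq> gam X"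
  using P_mono[of "gam X" "gam X" X Y] gam_unfold[of X] by (intro gam_least) auto

lemma mono_gam2: "mono (\<lambda>X. gam (gam X))"
  by (intro monoI gam_antimono)

lemma wf_lower_unfold: "gam (gam wf_lower) = wf_lower"
  unfolding wf_lower_def by (rule lfp_unfold[OF mono_gam2, symmetric])

lemma wf_lower_least: "gam (gam X) \<subseteq> X \<Longrightarrow> wf_lower \<subseteq> X"
  unfolding wf_lower_def by (rule lfp_lowerbound)

text \<open>\<open>gam wf_lower\<close> is again a fixpoint of \<open>gam \<circ> gam\<close>, so it
  lies above the least one. This is the consistency of the well-founded pair.\<close>

lemma wf_lower_subset: "wf_lower \<subseteq> gam wf_lower"
  by (rule wf_lower_least) (simp add: wf_lower_unfold)

lemma stable_of_pair:
  assumes "X \<subseteq> Y" "gam Y = X" "gam X = Y"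
  shows "stable_fixpoint A (of_pair X Y)"
  unfolding stable_fixpoint_def least_fixpoint_on_def
proof (intro conjI ballI impI)
  show "lower (A (of_pair (lower (of_pair X Y)) (upper (of_pair X Y)))) = lower (of_pair X Y)"
    using assms gam_unfold[of Y] by (simp add: lower_A)
  show "upper (A (of_pair (lower (of_pair X Y)) (upper (of_pair X Y)))) = upper (of_pair X Y)"
    using assms gam_unfold[of X] by (simp add: upper_A)
next
  fix Z assume "Z \<in> {Z. Z \<subseteq> upper (of_pair X Y)}"
    "lower (A (of_pair Z (upper (of_pair X Y)))) = Z"
  then show "lower (of_pair X Y) \<subseteq> Z"
    using assms gam_least[of Z Y] by (simp add: lower_A)
next
  fix Z assume "Z \<in> {Z. lower (of_pair X Y) \<subseteq> Z}"
    "upper (A (of_pair (lower (of_pair X Y)) Z)) = Z"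
  then show "upper (of_pair X Y) \<subseteq> Z"
    using assms gam_least[of Z X] by (simp add: upper_A)
qed (use assms in auto)

text \<open>Stability speaks of least fixpoints on intervals; they are the unrestricted ones because
  \<open>gam\<close> of either bound falls into the interval. \<open>gam (upper J)\<close> lies
  below the fixpoint \<open>lower J\<close>, hence below \<open>upper J\<close>; antitonicity then
  puts \<open>lower J\<close> below \<open>gam (lower J)\<close>.\<close>

lemma stable_fixpointD:
  assumes "stable_fixpoint A J"
  shows "gam (upper J) = lower J" "gam (lower J) = upper J"
proof -
  let ?X = "lower J" and ?Y = "upper J"
  note sub = lower_subset_upper[of J]
  have X: "P ?X ?Y = ?X" "\<And>Z. Z \<subseteq> ?Y \<Longrightarrow> P Z ?Y = Z \<Longrightarrow> ?X \<subseteq> Z"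
    and Y: "P ?Y ?X = ?Y" "\<And>Z. ?X \<subseteq> Z \<Longrightarrow> P Z ?X = Z \<Longrightarrow> ?Y \<subseteq> Z"
    using assms sub by (auto simp: stable_fixpoint_def least_fixpoint_on_def lower_A upper_A)
  have "gam ?Y \<subseteq> ?X" using X(1) by (intro gam_least) simp
  then show 1: "gam ?Y = ?X" using X(2)[of "gam ?Y"] gam_unfold[of ?Y] sub by auto
  have "gam ?X \<subseteq> ?Y" using Y(1) by (intro gam_least) simp
  moreover have "?X \<subseteq> gam ?X" using gam_antimono[OF sub] 1 by simp
  ultimately show "gam ?X = ?Y" using Y(2)[of "gam ?X"] gam_unfold[of ?X] by auto
qed

text \<open>The lower half of any stable fixpoint is a fixpoint of \<open>gam \<circ> gam\<close>,
  hence above \<open>wf_lower\<close>; by antitonicity its upper half is below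
  \<open>gam wf_lower\<close>. So this pair is the least precise one, and two least precise stable
  fixpoints are equal.\<close>

lemma wf_fixpoint_eq: "wf_fixpoint A = of_pair wf_lower (gam wf_lower)"
  unfolding wf_fixpoint_def
proof (rule the_equality)
  let ?W = "of_pair wf_lower (gam wf_lower)"
  have W: "stable_fixpoint A ?W"
    by (rule stable_of_pair) (simp_all add: wf_lower_subset wf_lower_unfold)
  have least: "?W \<le>\<^sub>p J" if "stable_fixpoint A J" for J
  proof -
    note D = stable_fixpointD[OF that]
    have 1: "wf_lower \<subseteq> lower J" by (rule wf_lower_least) (simp add: D)
    have "upper J \<subseteq> gam wf_lower" using gam_antimono[OF 1] by (simp add: D)
    with 1 have "?W a = UU \<or> ?W a = J a" for a
      by (cases "J a") (auto simp: of_pair_def lower_def upper_def subset_iff)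
    then show ?thesis by (simp add: less_precise_def)
  qed
  show "stable_fixpoint A ?W \<and> (\<forall>J'. stable_fixpoint A J' \<longrightarrow> ?W \<le>\<^sub>p J')"
    using W least by simp
  fix J assume J: "stable_fixpoint A J \<and> (\<forall>J'. stable_fixpoint A J' \<longrightarrow> J \<le>\<^sub>p J')"
  then have "J \<le>\<^sub>p ?W" "?W \<le>\<^sub>p J" using W least by auto
  then show "J = ?W" unfolding less_precise_def by (metis ext)
qed

lemma two_valued_wf_fixpoint:
  assumes "two_valued (wf_fixpoint A)"
  shows "gam wf_lower = wf_lower"
proof -
  have "a \<in> wf_lower" if "a \<in> gam wf_lower" for a
  proof -
    have "of_pair wf_lower (gam wf_lower) a \<noteq> UU"
      using assms by (simp add: wf_fixpoint_eq two_valued_def)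
    with that show ?thesis by (auto simp: of_pair_def split: if_splits)
  qed
  then show ?thesis using wf_lower_subset by auto
qed

end

section \<open>Two-valued evaluation with separated polarities\<close>

text \<open>Positive occurrences of atoms are looked up in \<open>X\<close>, negative ones in \<open>Y\<close>.\<close>

primrec holds :: "'d set \<Rightarrow> 'p fo \<Rightarrow> ('p, 'd) datom set \<Rightarrow> ('p, 'd) datom set \<Rightarrow> (var \<Rightarrow> 'd) \<Rightarrow> bool" where
  "holds D (Rel p xs) X Y \<sigma> \<longleftrightarrow> Atm p (map \<sigma> xs) \<in> X"
| "holds D (Eq x y) X Y \<sigma> \<longleftrightarrow> \<sigma> x = \<sigma> y"
| "holds D (Neg \<phi>) X Y \<sigma> \<longleftrightarrow> \<not> holds D \<phi> Y X \<sigma>"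
| "holds D (Conj \<phi> \<psi>) X Y \<sigma> \<longleftrightarrow> holds D \<phi> X Y \<sigma> \<and> holds D \<psi> X Y \<sigma>"
| "holds D (Disj \<phi> \<psi>) X Y \<sigma> \<longleftrightarrow> holds D \<phi> X Y \<sigma> \<or> holds D \<psi> X Y \<sigma>"
| "holds D (Forall x \<phi>) X Y \<sigma> \<longleftrightarrow> (\<forall>d\<in>D. Elem d \<in> Y \<longrightarrow> holds D \<phi> X Y (\<sigma>(x := d)))"
| "holds D (Exists x \<phi>) X Y \<sigma> \<longleftrightarrow> (\<exists>d\<in>D. Elem d \<in> X \<and> holds D \<phi> X Y (\<sigma>(x := d)))"

lemma holds_mono:
  "X \<subseteq> X' \<Longrightarrow> Y' \<subseteq> Y \<Longrightarrow> holds D \<phi> X Y \<sigma> \<Longrightarrow> holds D \<phi> X' Y' \<sigma>"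
proof (induction \<phi> arbitrary: X Y X' Y' \<sigma>)
  case (Neg \<phi>)
  then show ?case using Neg.IH[of Y' Y X X' \<sigma>] by auto
next
  case (Conj \<phi> \<psi>)
  then show ?case using Conj.IH(1)[of X X' Y' Y \<sigma>] Conj.IH(2)[of X X' Y' Y \<sigma>] by auto
next
  case (Disj \<phi> \<psi>)
  then show ?case using Disj.IH(1)[of X X' Y' Y \<sigma>] Disj.IH(2)[of X X' Y' Y \<sigma>] by auto
next
  case (Forall x \<phi>)
  then show ?case by (auto intro: Forall.IH[of X X' Y' Y])
next
  case (Exists x \<phi>)
  then show ?case by (auto intro: Exists.IH[of X X' Y' Y])
qed auto

lemma tv_min_iff: "min x y = TT \<longleftrightarrow> x = TT \<and> y = TT" "min x y = FF \<longleftrightarrow> x = FF \<or> y = FF"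
  by (cases x; cases y; simp add: min_def less_eq_tv_def)+

lemma tv_max_iff: "max x y = TT \<longleftrightarrow> x = TT \<or> y = TT" "max x y = FF \<longleftrightarrow> x = FF \<and> y = FF"
  by (cases x; cases y; simp add: max_def less_eq_tv_def)+

lemma tv_not_iff: "tv_not x = TT \<longleftrightarrow> x = FF" "tv_not x = FF \<longleftrightarrow> x = TT"
  by (cases x; simp)+

lemma tv_mem_image:
  fixes f :: "'a \<Rightarrow> tv"
  shows "c \<in> f ` D \<longleftrightarrow> (\<exists>d\<in>D. f d = c)"
  by blast

lemma tv_TT_iff: "x = TT \<longleftrightarrow> x \<noteq> FF \<and> x \<noteq> UU"
  by (cases x) auto

lemma tv_FF_iff: "x = FF \<longleftrightarrow> x \<noteq> TT \<and> x \<noteq> UU"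
  by (cases x) auto

lemma tv_INF_iff:
  fixes f :: "'a \<Rightarrow> tv"
  shows "(INF d\<in>D. f d) = TT \<longleftrightarrow> (\<forall>d\<in>D. f d = TT)" "(INF d\<in>D. f d) = FF \<longleftrightarrow> (\<exists>d\<in>D. f d = FF)"
  by (auto simp: Inf_tv_def tv_mem_image tv_TT_iff simp del: image_iff)

lemma tv_SUP_iff:
  fixes f :: "'a \<Rightarrow> tv"
  shows "(SUP d\<in>D. f d) = TT \<longleftrightarrow> (\<exists>d\<in>D. f d = TT)" "(SUP d\<in>D. f d) = FF \<longleftrightarrow> (\<forall>d\<in>D. f d = FF)"
  by (auto simp: Sup_tv_def tv_mem_image tv_FF_iff simp del: image_iff)

lemmas tv_iff = tv_min_iff tv_max_iff tv_not_iff tv_INF_iff tv_SUP_iff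

text \<open>A Kleene value is \<open>FF\<close> exactly if the formula fails even under the generous
  reading, with positive occurrences in \<open>Y\<close> and negative ones in \<open>X\<close>.
  Negation exchanges the two readings, and the domain guard of \<open>Forall\<close> is itself a
  negative occurrence.\<close>

lemma kleene_of_pair:
  assumes "X \<subseteq> Y"
  shows "(kleene D (of_pair X Y) \<sigma> \<phi> = TT \<longleftrightarrow> holds D \<phi> X Y \<sigma>) \<and>
    (kleene D (of_pair X Y) \<sigma> \<phi> = FF \<longleftrightarrow> \<not> holds D \<phi> Y X \<sigma>)"
  using assms by (induction \<phi> arbitrary: \<sigma>) (auto simp: tv_iff of_pair_simps simp del: fun_upd_apply)

section \<open>Effect sets without \<open>New\<close> and \<open>Select\<close>\<close>

text \<open>The condition on occurrences in a form fit for structural induction.\<close>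

primrec no_choice :: "'p cee \<Rightarrow> bool" where
  "no_choice (Atom p xs) \<longleftrightarrow> True"
| "no_choice (Rule C \<phi>) \<longleftrightarrow> no_choice C"
| "no_choice (And C1 C2) \<longleftrightarrow> no_choice C1 \<and> no_choice C2"
| "no_choice (Or C1 C2) \<longleftrightarrow> no_choice C1 \<and> no_choice C2"
| "no_choice (All x \<phi> C) \<longleftrightarrow> no_choice C"
| "no_choice (Select x \<phi> C) \<longleftrightarrow> False"
| "no_choice (New x C) \<longleftrightarrow> False"

lemma no_choice_occs:
  "\<forall>(\<pi>, n, C)\<in>occs \<Delta> \<pi> n. \<not> is_new C \<and> \<not> is_select C \<Longrightarrow> no_choice \<Delta>"
proof (induction \<Delta> arbitrary: \<pi> n)
  case (And C1 C2)
  then show ?case using And.IH(1)[of "1 # \<pi>" n] And.IH(2)[of "2 # \<pi>" n] by auto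
next
  case (Or C1 C2)
  then show ?case using Or.IH(1)[of "1 # \<pi>" n] Or.IH(2)[of "2 # \<pi>" n] by auto
next
  case (Rule C \<phi>)
  then show ?case using Rule.IH[of "1 # \<pi>" n] by auto
next
  case (All x \<phi> C)
  then show ?case using All.IH[of "1 # \<pi>" "Suc n"] by auto
qed (auto simp: is_new_def is_select_def)

lemma no_choiceI: "\<not> contains_new \<Delta> \<Longrightarrow> \<not> contains_select \<Delta> \<Longrightarrow> no_choice \<Delta>"
  by (rule no_choice_occs[of \<Delta> "[]" 0]) (auto simp: contains_new_def contains_select_def)

lemma no_choice_relevant: "relevant \<Delta> \<zeta> I C \<pi> \<Gamma> \<Longrightarrow> no_choice \<Delta> \<Longrightarrow> no_choice C"
  by (induction rule: relevant.induct) auto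

text \<open>The atoms caused when every \<open>Or\<close> takes its first branch.\<close>

primrec caused :: "'d set \<Rightarrow> 'p cee \<Rightarrow> ('p, 'd) datom set \<Rightarrow> ('p, 'd) datom set \<Rightarrow> (var \<Rightarrow> 'd) \<Rightarrow>
    ('p, 'd) datom set" where
  "caused D (Atom p xs) X Y \<sigma> = {Atm p (map \<sigma> xs)}"
| "caused D (Rule C \<phi>) X Y \<sigma> = (if holds D \<phi> X Y \<sigma> then caused D C X Y \<sigma> else {})"
| "caused D (And C1 C2) X Y \<sigma> = caused D C1 X Y \<sigma> \<union> caused D C2 X Y \<sigma>"
| "caused D (Or C1 C2) X Y \<sigma> = caused D C1 X Y \<sigma>"
| "caused D (All x \<phi> C) X Y \<sigma> = (\<Union>d\<in>D. if Elem d \<in> X \<and> holds D \<phi> X Y (\<sigma>(x := d))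
     then caused D C X Y (\<sigma>(x := d)) else {})"
| "caused D (Select x \<phi> C) X Y \<sigma> = {}"
| "caused D (New x C) X Y \<sigma> = {}"

lemma caused_mono:
  "X \<subseteq> X' \<Longrightarrow> Y' \<subseteq> Y \<Longrightarrow> caused D C X Y \<sigma> \<subseteq> caused D C X' Y' \<sigma>"
proof (induction C arbitrary: \<sigma>)
  case (Rule C \<phi>)
  then show ?case using Rule.IH[of \<sigma>] holds_mono[of X X' Y' Y D \<phi> \<sigma>] by auto
next
  case (And C1 C2)
  then show ?case using And.IH(1)[of \<sigma>] And.IH(2)[of \<sigma>] by auto
next
  case (All x \<phi> C)
  have "(if Elem d \<in> X \<and> holds D \<phi> X Y (\<sigma>(x := d)) then caused D C X Y (\<sigma>(x := d)) else {})
    \<subseteq> (if Elem d \<in> X' \<and> holds D \<phi> X' Y' (\<sigma>(x := d)) then caused D C X' Y' (\<sigma>(x := d)) else {})" for d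
    using All.prems All.IH[of "\<sigma>(x := d)"] holds_mono[of X X' Y' Y D \<phi> "\<sigma>(x := d)"]
    by (simp del: fun_upd_apply) blast
  then show ?case by (simp only: caused.simps) (intro UN_mono subset_refl)
qed auto

lemma env_Cons: "env ((x, d) # \<Gamma>) = (env \<Gamma>)(x := d)"
  by (auto simp: env_def)

text \<open>This is the source of the symmetry: an atom is possibly caused exactly if it is caused
  with the two bounds exchanged. As \<open>orc\<close> is constantly 1, \<open>caused\<close> can do
  without paths.\<close>

lemma effect_of_pair:
  assumes "X \<subseteq> Y" "no_choice C" "\<forall>\<pi> ds. orc \<zeta> \<pi> ds = 1"
  shows "(effect \<zeta> (of_pair X Y) C \<pi> \<Gamma> a = TT \<longleftrightarrow> a \<in> caused (base \<zeta>) C X Y (env \<Gamma>)) \<and>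
    (effect \<zeta> (of_pair X Y) C \<pi> \<Gamma> a = FF \<longleftrightarrow> a \<notin> caused (base \<zeta>) C Y X (env \<Gamma>))"
  using assms(2)
proof (induction C arbitrary: \<pi> \<Gamma>)
  case (Atom p xs)
  then show ?case by simp
next
  case (Rule C \<phi>)
  then show ?case using kleene_of_pair[OF assms(1)] by (auto simp: tv_iff)
next
  case (And C1 C2)
  then show ?case by (auto simp: tv_iff)
next
  case (Or C1 C2)
  then show ?case using assms(3) by auto
next
  case (All x \<phi> C)
  then show ?case using kleene_of_pair[OF assms(1)] assms(1)
    by (auto simp: tv_iff of_pair_simps env_Cons simp del: fun_upd_apply split: if_splits)
qed auto

lemma caused_endogenous: "a \<in> caused D C X Y \<sigma> \<Longrightarrow> \<exists>p ds. a = Atm p ds \<and> p \<in> endogenous C"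
  by (induction C arbitrary: \<sigma>) (simp_all split: if_splits, blast+)

text \<open>All effects have a cell in some table, which both justifies storing them and bounds the
  number of rounds.\<close>

lemma caused_wf:
  assumes "wf_cee \<Sigma> ar C" "\<forall>y\<in>fv_cee C. \<sigma> y \<in> D"
  shows "caused D C X Y \<sigma> \<subseteq> {Atm p ds | p ds. p \<in> endogenous C \<and> ds \<in> tuples_over D (ar p)}"
  using assms
proof (induction C arbitrary: \<sigma>)
  case (Atom p xs)
  then show ?case by (auto simp: tuples_over_def)
next
  case (Rule C \<phi>)
  then show ?case using Rule.IH[of \<sigma>] by auto
next
  case (And C1 C2)
  then show ?case using And.IH(1)[of \<sigma>] And.IH(2)[of \<sigma>] by (simp add: subset_iff) blast
next
  case (Or C1 C2)
  then show ?case using Or.IH(1)[of \<sigma>] by (simp add: subset_iff) blast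
next
  case (All x \<phi> C)
  have "caused D C X Y (\<sigma>(x := d)) \<subseteq> {Atm p ds | p ds. p \<in> endogenous C \<and> ds \<in> tuples_over D (ar p)}"
    if "d \<in> D" for d
    using All.prems that by (intro All.IH) auto
  then show ?case by (simp add: subset_iff del: fun_upd_apply) blast
qed auto

lemma endogenous_wf: "wf_cee \<Sigma> ar C \<Longrightarrow> endogenous C \<subseteq> set \<Sigma>"
  by (induction C) auto

definition facts :: "'p cee \<Rightarrow> 'd set \<Rightarrow> ('p, 'd) pstr \<Rightarrow> ('p, 'd) datom set" where
  "facts \<Delta> D E = Elem ` D \<union> {Atm p ds | p ds. p \<notin> endogenous \<Delta> \<and> E (Atm p ds) = TT}"

definition consequences :: "'p cee \<Rightarrow> 'd set \<Rightarrow> ('p, 'd) pstr \<Rightarrow>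
    ('p, 'd) datom set \<Rightarrow> ('p, 'd) datom set \<Rightarrow> ('p, 'd) datom set" where
  "consequences \<Delta> D E X Y = facts \<Delta> D E \<union> caused D \<Delta> X Y (env [])"

text \<open>The domain is two-valued since all elements are initial, and so is \<open>E\<close>;
  both therefore enter the two bounds as the same constant set \<open>facts\<close>.\<close>

lemma symmetric_causality_op:
  assumes "no_choice \<Delta>" "\<forall>\<pi> ds. orc \<zeta> \<pi> ds = 1" "initial \<Delta> \<zeta> = base \<zeta>" "two_valued E"
  shows "symmetric_approximator (causality_op \<Delta> \<zeta> E) (consequences \<Delta> (base \<zeta>) E)"
proof
  fix X X' Y Y' :: "('a, 'b) datom set"
  show "consequences \<Delta> (base \<zeta>) E X Y \<subseteq> consequences \<Delta> (base \<zeta>) E X' Y'" if "X \<subseteq> X'" "Y' \<subseteq> Y"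
    unfolding consequences_def using caused_mono[OF that] by blast
  have *: "(causality_op \<Delta> \<zeta> E (of_pair X Y) a = TT \<longleftrightarrow> a \<in> consequences \<Delta> (base \<zeta>) E X Y) \<and>
    (causality_op \<Delta> \<zeta> E (of_pair X Y) a = FF \<longleftrightarrow> a \<notin> consequences \<Delta> (base \<zeta>) E Y X)"
    if "X \<subseteq> Y" for a
  proof (cases a)
    case (Elem d)
    then show ?thesis
      using effect_of_pair[OF that assms(1,2), of "[]" "[]" a] caused_endogenous[of a] assms(3)
      by (fastforce simp: causality_op_def consequences_def facts_def)
  next
    case (Atm p ds)
    have "E a \<noteq> UU" using assms(4) by (simp add: two_valued_def)
    then have "E a = FF \<longleftrightarrow> E a \<noteq> TT" by (cases "E a") auto
    moreover have "a \<notin> caused (base \<zeta>) \<Delta> X Y \<sigma>" if "p \<notin> endogenous \<Delta>" for X Y \<sigma>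
      using caused_endogenous[of a "base \<zeta>" \<Delta> X Y \<sigma>] Atm that by auto
    ultimately show ?thesis
      using effect_of_pair[OF that assms(1,2), of "[]" "[]" a] Atm
      by (auto simp: causality_op_def consequences_def facts_def)
  qed
  show "lower (causality_op \<Delta> \<zeta> E (of_pair X Y)) = consequences \<Delta> (base \<zeta>) E X Y" if "X \<subseteq> Y"
    using *[OF that] by (auto simp: lower_def)
  show "upper (causality_op \<Delta> \<zeta> E (of_pair X Y)) = consequences \<Delta> (base \<zeta>) E Y X" if "X \<subseteq> Y"
    using *[OF that] by (auto simp: upper_def)
qed

section \<open>The alternating fixpoint as a loop program\<close>

text \<open>The array \<open>Rl True p\<close> holds the current lower bound of \<open>p\<close>, the array \<open>Rl False p\<close> its upper
  bound; exogenous predicates only have the former. Truth is coded by the symbol 3.\<close>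

datatype 'p arr = Rl bool 'p | Equ | Flg

primrec arr_arity :: "('p \<Rightarrow> nat) \<Rightarrow> 'p arr \<Rightarrow> nat" where
  "arr_arity ar (Rl s p) = ar p"
| "arr_arity ar Equ = 2"
| "arr_arity ar Flg = 0"

definition source :: "'p set \<Rightarrow> bool \<Rightarrow> 'p \<Rightarrow> 'p arr" where
  "source S s p = Rl (p \<in> S \<longrightarrow> s) p"

text \<open>The result of evaluating a formula is left in \<open>Flg\<close>; the variable bound at nesting depth \<open>m\<close>
  lives in register \<open>m\<close>, and \<open>r\<close> maps variables to registers.\<close>

primrec eval_fo :: "'p set \<Rightarrow> 'p fo \<Rightarrow> bool \<Rightarrow> nat \<Rightarrow> (var \<Rightarrow> nat) \<Rightarrow> 'p arr cmd" where
  "eval_fo S (Rel p xs) s m r = Test (source S s p) (map r xs) 3 (Put Flg [] 3) (Put Flg [] 1)"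
| "eval_fo S (Eq x y) s m r = Test Equ [r x, r y] 3 (Put Flg [] 3) (Put Flg [] 1)"
| "eval_fo S (Neg \<phi>) s m r =
     Seq (eval_fo S \<phi> (\<not> s) m r) (Test Flg [] 3 (Put Flg [] 1) (Put Flg [] 3))"
| "eval_fo S (Conj \<phi> \<psi>) s m r =
     Seq (eval_fo S \<phi> s m r) (Test Flg [] 3 (eval_fo S \<psi> s m r) Skip)"
| "eval_fo S (Disj \<phi> \<psi>) s m r =
     Seq (eval_fo S \<phi> s m r) (Test Flg [] 3 Skip (eval_fo S \<psi> s m r))"
| "eval_fo S (Forall x \<phi>) s m r =
     Seq (Put Flg [] 3) (For m (Test Flg [] 3 (eval_fo S \<phi> s (Suc m) (r(x := m))) Skip))"
| "eval_fo S (Exists x \<phi>) s m r =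
     Seq (Put Flg [] 1) (For m (Test Flg [] 3 Skip (eval_fo S \<phi> s (Suc m) (r(x := m)))))"


text \<open>Effects go straight into the tables of bound \<open>s\<close>, so later parts of the
  same pass already see them. \<open>Or\<close> always runs its first branch, as in
  \<open>caused\<close>.\<close>

primrec exec_cee :: "'p set \<Rightarrow> 'p cee \<Rightarrow> bool \<Rightarrow> nat \<Rightarrow> (var \<Rightarrow> nat) \<Rightarrow> 'p arr cmd" where
  "exec_cee S (Atom p xs) s m r = Put (Rl s p) (map r xs) 3"
| "exec_cee S (Rule C \<phi>) s m r =
     Seq (eval_fo S \<phi> s m r) (Test Flg [] 3 (exec_cee S C s m r) Skip)"
| "exec_cee S (And C1 C2) s m r = Seq (exec_cee S C1 s m r) (exec_cee S C2 s m r)"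
| "exec_cee S (Or C1 C2) s m r = exec_cee S C1 s m r"
| "exec_cee S (All x \<phi> C) s m r =
     For m (Seq (eval_fo S \<phi> s (Suc m) (r(x := m)))
       (Test Flg [] 3 (exec_cee S C s (Suc m) (r(x := m))) Skip))"
| "exec_cee S (Select x \<phi> C) s m r = Skip"
| "exec_cee S (New x C) s m r = Skip"

text \<open>Evaluating a formula changes nothing but \<open>Flg\<close>. Naming this update makes
  evaluations chain, since everything else they read is unaffected by it.\<close>

definition set_flag :: "'p arr store \<Rightarrow> bool \<Rightarrow> 'p arr store" where
  "set_flag A b = A(Flg := (A Flg)([] := if b then 3 else 1))"

lemma set_flag_simps [simp]:
  "set_flag A b Flg [] = (if b then 3 else 1)"
  "set_flag (set_flag A b) c = set_flag A c"
  "set_flag A b (Rl s p) = A (Rl s p)"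
  "set_flag A b Equ = A Equ"
  by (auto simp: set_flag_def)

lemma fold_set_flag [simp]:
  "A(Flg := (A Flg)([] := 3)) = set_flag A True"
  "A(Flg := (A Flg)([] := 1)) = set_flag A False"
  "A(Flg := (A Flg)([] := Suc 0)) = set_flag A False"
  by (simp_all add: set_flag_def)

text \<open>Commands can inspect arrays but cannot compare registers, so equality is looked up in a
  precomputed table.\<close>

definition equ_ok :: "nat \<Rightarrow> 'p arr store \<Rightarrow> bool" where
  "equ_ok n A \<longleftrightarrow> (\<forall>i<n. \<forall>j<n. A Equ [i, j] = 3 \<longleftrightarrow> i = j)"

lemma equ_ok_set_flag [simp]: "equ_ok n (set_flag A b) = equ_ok n A"
  by (simp add: equ_ok_def)

lemma finite_tuples_over: "finite D \<Longrightarrow> finite (tuples_over D r)"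
  and card_tuples_over: "finite D \<Longrightarrow> card (tuples_over D r) = card D ^ r"
  by (simp_all add: tuples_over_def finite_lists_length_eq card_lists_length_eq)

locale tables =
  fixes \<Sigma> :: "'p list" and ar :: "'p \<Rightarrow> nat" and S :: "'p set" and n :: nat
begin

definition store_set :: "bool \<Rightarrow> 'p arr store \<Rightarrow> ('p, nat) datom set" where
  "store_set s A = Elem ` {..<n} \<union>
     {Atm p ds | p ds. p \<in> set \<Sigma> \<and> ds \<in> tuples_over {..<n} (ar p) \<and> A (source S s p) ds = 3}"

lemma store_set_set_flag [simp]: "store_set s (set_flag A b) = store_set s A"
  by (simp add: store_set_def source_def)

lemma Elem_store_set [simp]: "Elem d \<in> store_set s A \<longleftrightarrow> d < n"
  by (auto simp: store_set_def)

lemma Atm_store_set: "Atm p ds \<in> store_set s A \<longleftrightarrow>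
    p \<in> set \<Sigma> \<and> ds \<in> tuples_over {..<n} (ar p) \<and> A (source S s p) ds = 3"
  by (auto simp: store_set_def)

text \<open>All loop values belong to both bounds of the domain, so the quantifier guards require no
  test. Free variables live in registers below \<open>m\<close>, so the loop over register
  \<open>m\<close> cannot overwrite them. Negation flips \<open>s\<close>, hence the induction over
  arbitrary \<open>s\<close>.\<close>

lemma sem_eval_fo:
  assumes "wf_fo \<Sigma> ar \<phi>" "\<forall>y\<in>fv_fo \<phi>. r y < m \<and> \<rho> (r y) = \<sigma> y \<and> \<sigma> y < n" "equ_ok n A"
  shows "sem n (eval_fo S \<phi> s m r) \<rho> A =
    set_flag A (holds {..<n} \<phi> (store_set s A) (store_set (\<not> s) A) \<sigma>)"
  using assms
proof (induction \<phi> arbitrary: s m r \<rho> \<sigma> A)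
  case (Rel p xs)
  have "map \<rho> (map r xs) = map \<sigma> xs" using Rel.prems by auto
  moreover have "map \<sigma> xs \<in> tuples_over {..<n} (ar p)"
    using Rel.prems by (auto simp: tuples_over_def)
  ultimately show ?case using Rel.prems by (simp add: Atm_store_set del: map_map)
next
  case (Eq x y)
  then show ?case by (simp add: equ_ok_def)
next
  case (Neg \<phi>)
  have "sem n (eval_fo S \<phi> (\<not> s) m r) \<rho> A =
    set_flag A (holds {..<n} \<phi> (store_set (\<not> s) A) (store_set (\<not> \<not> s) A) \<sigma>)"
    using Neg.prems by (intro Neg.IH) auto
  then show ?case by simp
next
  case (Conj \<phi> \<psi>)
  have 1: "sem n (eval_fo S \<phi> s m r) \<rho> A =
    set_flag A (holds {..<n} \<phi> (store_set s A) (store_set (\<not> s) A) \<sigma>)"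
    using Conj.prems by (intro Conj.IH) auto
  have 2: "sem n (eval_fo S \<psi> s m r) \<rho> (set_flag A b) =
    set_flag A (holds {..<n} \<psi> (store_set s A) (store_set (\<not> s) A) \<sigma>)" for b
    using Conj.IH(2)[where A = "set_flag A b" and s = s and m = m and r = r and \<sigma> = \<sigma> and \<rho> = \<rho>]
      Conj.prems by auto
  show ?case by (simp add: 1 2)
next
  case (Disj \<phi> \<psi>)
  have 1: "sem n (eval_fo S \<phi> s m r) \<rho> A =
    set_flag A (holds {..<n} \<phi> (store_set s A) (store_set (\<not> s) A) \<sigma>)"
    using Disj.prems by (intro Disj.IH) auto
  have 2: "sem n (eval_fo S \<psi> s m r) \<rho> (set_flag A b) =
    set_flag A (holds {..<n} \<psi> (store_set s A) (store_set (\<not> s) A) \<sigma>)" for b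
    using Disj.IH(2)[where A = "set_flag A b" and s = s and m = m and r = r and \<sigma> = \<sigma> and \<rho> = \<rho>]
      Disj.prems by auto
  show ?case by (simp add: 1 2)
next
  case (Forall x \<phi>)
  let ?h = "\<lambda>d. holds {..<n} \<phi> (store_set s A) (store_set (\<not> s) A) (\<sigma>(x := d))"
  have 1: "sem n (eval_fo S \<phi> s (Suc m) (r(x := m))) (\<rho>(m := d)) (set_flag A b) = set_flag A (?h d)"
    if "d < n" for d b
  proof -
    have "sem n (eval_fo S \<phi> s (Suc m) (r(x := m))) (\<rho>(m := d)) (set_flag A b) = set_flag (set_flag A b)
      (holds {..<n} \<phi> (store_set s (set_flag A b)) (store_set (\<not> s) (set_flag A b)) (\<sigma>(x := d)))"
      by (rule Forall.IH) (use Forall.prems that in \<open>force+\<close>)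
    then show ?thesis by (simp del: fun_upd_apply)
  qed
  have 2: "sem n (Test Flg [] 3 (eval_fo S \<phi> s (Suc m) (r(x := m))) Skip) (\<rho>(m := d)) (set_flag A b) =
      set_flag A (b \<and> ?h d)" if "d < n" for d b
    using that by (simp add: 1 del: fun_upd_apply)
  have "fold (\<lambda>i. sem n (Test Flg [] 3 (eval_fo S \<phi> s (Suc m) (r(x := m))) Skip) (\<rho>(m := i)))
      [0..<k] (set_flag A True) = set_flag A (\<forall>d<k. ?h d)" if "k \<le> n" for k
    using that by (induction k) (simp_all add: 2 All_less_Suc conj_commute del: sem.simps fun_upd_apply)
  from this[of n] show ?case by (simp add: Ball_def del: fun_upd_apply)
next
  case (Exists x \<phi>)
  let ?h = "\<lambda>d. holds {..<n} \<phi> (store_set s A) (store_set (\<not> s) A) (\<sigma>(x := d))"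
  have 1: "sem n (eval_fo S \<phi> s (Suc m) (r(x := m))) (\<rho>(m := d)) (set_flag A b) = set_flag A (?h d)"
    if "d < n" for d b
  proof -
    have "sem n (eval_fo S \<phi> s (Suc m) (r(x := m))) (\<rho>(m := d)) (set_flag A b) = set_flag (set_flag A b)
      (holds {..<n} \<phi> (store_set s (set_flag A b)) (store_set (\<not> s) (set_flag A b)) (\<sigma>(x := d)))"
      by (rule Exists.IH) (use Exists.prems that in \<open>force+\<close>)
    then show ?thesis by (simp del: fun_upd_apply)
  qed
  have 2: "sem n (Test Flg [] 3 Skip (eval_fo S \<phi> s (Suc m) (r(x := m)))) (\<rho>(m := d)) (set_flag A b) =
      set_flag A (b \<or> ?h d)" if "d < n" for d b
    using that by (simp add: 1 del: fun_upd_apply)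
  have "fold (\<lambda>i. sem n (Test Flg [] 3 Skip (eval_fo S \<phi> s (Suc m) (r(x := m)))) (\<rho>(m := i)))
      [0..<k] (set_flag A False) = set_flag A (\<exists>d<k. ?h d)" if "k \<le> n" for k
    using that by (induction k) (simp_all add: 2 Ex_less_Suc disj_commute del: sem.simps fun_upd_apply)
  from this[of n] show ?case by (simp add: Bex_def del: fun_upd_apply)
qed

text \<open>Since effects are added in place, a step may add more than \<open>e\<close> of the old set, but it stays
  below every set that is closed under \<open>e\<close>.\<close>

definition adds :: "bool \<Rightarrow> ('p, nat) datom set \<Rightarrow> (('p, nat) datom set \<Rightarrow> ('p, nat) datom set) \<Rightarrow>
    'p arr store \<Rightarrow> 'p arr store \<Rightarrow> bool" where
  "adds s Y e A A' \<longleftrightarrow> (equ_ok n A \<and> store_set (\<not> s) A = Y \<longrightarrow>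
     equ_ok n A' \<and> store_set (\<not> s) A' = Y \<and> store_set s A \<subseteq> store_set s A' \<and>
     e (store_set s A) \<subseteq> store_set s A' \<and>
     (\<forall>L. store_set s A \<subseteq> L \<longrightarrow> e L \<subseteq> L \<longrightarrow> store_set s A' \<subseteq> L))"

lemma adds_cong:
  "(\<And>L. store_set s A \<subseteq> L \<Longrightarrow> e L = e' L) \<Longrightarrow> adds s Y e A A' = adds s Y e' A A'"
  by (simp add: adds_def cong: imp_cong)

lemma adds_none: "adds s Y (\<lambda>_. {}) A A"
  by (auto simp: adds_def)

text \<open>The second part runs on an enlarged set; monotonicity of \<open>e'\<close> ensures that
  its effect on the original set is still included.\<close>

lemma adds_Un:
  assumes "adds s Y e A A1" "adds s Y e' A1 A2" "mono e'"
  shows "adds s Y (\<lambda>L. e L \<union> e' L) A A2"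
  unfolding adds_def
proof (intro impI)
  assume pre: "equ_ok n A \<and> store_set (\<not> s) A = Y"
  then have 1: "equ_ok n A1" "store_set (\<not> s) A1 = Y" "store_set s A \<subseteq> store_set s A1"
    "e (store_set s A) \<subseteq> store_set s A1"
    "\<And>L. store_set s A \<subseteq> L \<Longrightarrow> e L \<subseteq> L \<Longrightarrow> store_set s A1 \<subseteq> L"
    using assms(1) by (auto simp: adds_def)
  then have 2: "equ_ok n A2" "store_set (\<not> s) A2 = Y" "store_set s A1 \<subseteq> store_set s A2"
    "e' (store_set s A1) \<subseteq> store_set s A2"
    "\<And>L. store_set s A1 \<subseteq> L \<Longrightarrow> e' L \<subseteq> L \<Longrightarrow> store_set s A2 \<subseteq> L"
    using assms(2) by (auto simp: adds_def)
  have "e' (store_set s A) \<subseteq> e' (store_set s A1)" using 1(3) assms(3) by (simp add: monoD)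
  then show "equ_ok n A2 \<and> store_set (\<not> s) A2 = Y \<and> store_set s A \<subseteq> store_set s A2 \<and>
     e (store_set s A) \<union> e' (store_set s A) \<subseteq> store_set s A2 \<and>
     (\<forall>L. store_set s A \<subseteq> L \<longrightarrow> e L \<union> e' L \<subseteq> L \<longrightarrow> store_set s A2 \<subseteq> L)"
    using 1 2 by auto
qed

lemma adds_fold:
  assumes "\<And>d A. d < k \<Longrightarrow> adds s Y (e d) A (f d A)" "\<And>d. mono (e d)"
  shows "adds s Y (\<lambda>L. \<Union>d<k. e d L) A (fold f [0..<k] A)"
  using assms(1)
proof (induction k)
  case 0
  then show ?case using adds_none by simp
next
  case (Suc k)
  have "adds s Y (\<lambda>L. (\<Union>d<k. e d L) \<union> e k L) A (f k (fold f [0..<k] A))"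
    using Suc assms(2) by (intro adds_Un) auto
  then show ?case by (simp add: lessThan_Suc Un_commute)
qed

text \<open>The condition is evaluated once, on the current set. If it holds there, it holds for
  every larger \<open>L\<close>, so closure under the conditional effect gives closure under
  \<open>e\<close>; if it fails, nothing is added.\<close>

lemma adds_if:
  assumes "\<And>A. equ_ok n A \<Longrightarrow> f A = set_flag A (h (store_set s A) (store_set (\<not> s) A))"
    and "\<And>A. adds s Y e A (g A)"
    and h: "\<And>X X'. X \<subseteq> X' \<Longrightarrow> h X Y \<Longrightarrow> h X' Y"
  shows "adds s Y (\<lambda>L. if h L Y then e L else {}) A (if f A Flg [] = 3 then g (f A) else f A)"
proof (cases "equ_ok n A \<and> store_set (\<not> s) A = Y")
  case True
  then have f: "f A = set_flag A (h (store_set s A) Y)" using assms(1) by simp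
  show ?thesis
  proof (cases "h (store_set s A) Y")
    case hT: True
    have "adds s Y e (set_flag A True) (g (set_flag A True))" using assms(2) by simp
    then have "adds s Y e A (g (set_flag A True))" by (simp add: adds_def)
    then show ?thesis using hT h f True unfolding adds_def by auto
  next
    case False
    then show ?thesis using f by (auto simp: adds_def)
  qed
qed (auto simp: adds_def)

lemma store_set_Put:
  assumes "p \<in> S" "p \<in> set \<Sigma>" "ds \<in> tuples_over {..<n} (ar p)"
  shows "store_set s (A(Rl s p := (A (Rl s p))(ds := 3))) = insert (Atm p ds) (store_set s A)"
    and "store_set (\<not> s) (A(Rl s p := (A (Rl s p))(ds := 3))) = store_set (\<not> s) A"
proof -
  let ?A = "A(Rl s p := (A (Rl s p))(ds := 3))"
  have "a \<in> store_set s ?A \<longleftrightarrow> a = Atm p ds \<or> a \<in> store_set s A"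
    and "a \<in> store_set (\<not> s) ?A \<longleftrightarrow> a \<in> store_set (\<not> s) A" for a
    using assms by (cases a; auto simp: Atm_store_set source_def)+
  then show "store_set s ?A = insert (Atm p ds) (store_set s A)"
    "store_set (\<not> s) ?A = store_set (\<not> s) A" by auto
qed

text \<open>During a pass writes go to bound \<open>s\<close> only, so the opposite bound is a
  constant \<open>Y\<close> and the effect is a monotone function of one set.\<close>

lemma adds_exec_cee:
  assumes "wf_cee \<Sigma> ar C" "endogenous C \<subseteq> S" "no_choice C"
    and "\<forall>y\<in>fv_cee C. r y < m \<and> \<rho> (r y) = \<sigma> y \<and> \<sigma> y < n"
  shows "adds s Y (\<lambda>L. caused {..<n} C L Y \<sigma>) A (sem n (exec_cee S C s m r) \<rho> A)"
  using assms
proof (induction C arbitrary: m r \<rho> \<sigma> A)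
  case (Atom p xs)
  have eq: "map \<rho> (map r xs) = map \<sigma> xs" using Atom.prems by auto
  let ?A = "A(Rl s p := (A (Rl s p))(map \<sigma> xs := 3))"
  have "map \<sigma> xs \<in> tuples_over {..<n} (ar p)"
    using Atom.prems by (auto simp: tuples_over_def)
  moreover have "p \<in> S" "p \<in> set \<Sigma>" using Atom.prems by auto
  ultimately have "store_set s ?A = insert (Atm p (map \<sigma> xs)) (store_set s A)"
    "store_set (\<not> s) ?A = store_set (\<not> s) A"
    by (simp_all only: store_set_Put)
  moreover have "equ_ok n ?A = equ_ok n A" by (simp add: equ_ok_def)
  ultimately have "adds s Y (\<lambda>L. {Atm p (map \<sigma> xs)}) A ?A"
    unfolding adds_def by blast
  then show ?case by (simp only: exec_cee.simps sem.simps caused.simps eq)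
next
  case (Rule C \<phi>)
  have "adds s Y (\<lambda>L. if holds {..<n} \<phi> L Y \<sigma> then caused {..<n} C L Y \<sigma> else {}) A
      (if sem n (eval_fo S \<phi> s m r) \<rho> A Flg [] = 3
       then sem n (exec_cee S C s m r) \<rho> (sem n (eval_fo S \<phi> s m r) \<rho> A)
       else sem n (eval_fo S \<phi> s m r) \<rho> A)"
    using Rule.prems
    by (intro adds_if[where h = "\<lambda>L Y. holds {..<n} \<phi> L Y \<sigma>"] sem_eval_fo Rule.IH)
      (auto intro: holds_mono)
  then show ?case by (simp add: if_distrib)
next
  case (And C1 C2)
  have 1: "adds s Y (\<lambda>L. caused {..<n} C1 L Y \<sigma>) A (sem n (exec_cee S C1 s m r) \<rho> A)" for A
    using And.prems by (intro And.IH) auto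
  have 2: "adds s Y (\<lambda>L. caused {..<n} C2 L Y \<sigma>) A (sem n (exec_cee S C2 s m r) \<rho> A)" for A
    using And.prems by (intro And.IH) auto
  have 3: "mono (\<lambda>L. caused {..<n} C2 L Y \<sigma>)"
    by (intro monoI caused_mono) auto
  show ?case unfolding sem.simps exec_cee.simps caused.simps by (rule adds_Un[OF 1 2 3])
next
  case (Or C1 C2)
  then show ?case by auto
next
  case (All x \<phi> C)
  let ?ev = "\<lambda>d. sem n (eval_fo S \<phi> s (Suc m) (r(x := m))) (\<rho>(m := d))"
  let ?e = "\<lambda>d L. if d < n \<and> holds {..<n} \<phi> L Y (\<sigma>(x := d)) then caused {..<n} C L Y (\<sigma>(x := d)) else {}"
  have "adds s Y (?e d) A
      (if ?ev d A Flg [] = 3 then sem n (exec_cee S C s (Suc m) (r(x := m))) (\<rho>(m := d)) (?ev d A) else ?ev d A)"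
    if "d < n" for d A
  proof (rule adds_if[where h = "\<lambda>L Y. d < n \<and> holds {..<n} \<phi> L Y (\<sigma>(x := d))"])
    have regs: "\<forall>y\<in>fv_fo \<phi> \<union> fv_cee C.
        (r(x := m)) y < Suc m \<and> (\<rho>(m := d)) ((r(x := m)) y) = (\<sigma>(x := d)) y \<and> (\<sigma>(x := d)) y < n"
      using All.prems(4) that by (auto simp: less_Suc_eq)
    show "adds s Y (\<lambda>L. caused {..<n} C L Y (\<sigma>(x := d))) A
        (sem n (exec_cee S C s (Suc m) (r(x := m))) (\<rho>(m := d)) A)" for A
      by (rule All.IH) (use All.prems regs in \<open>auto simp del: fun_upd_apply\<close>)
    show "?ev d A = set_flag A (d < n \<and>
        holds {..<n} \<phi> (store_set s A) (store_set (\<not> s) A) (\<sigma>(x := d)))" if "equ_ok n A" for A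
      using sem_eval_fo[of \<phi> "r(x := m)" "Suc m" "\<rho>(m := d)" "\<sigma>(x := d)" A s]
        All.prems(1) regs that \<open>d < n\<close> by (simp del: fun_upd_apply)
  qed (auto intro: holds_mono)
  moreover have "mono (?e d)" for d
  proof (rule monoI)
    fix L L' :: "('p, nat) datom set" assume "L \<subseteq> L'"
    then show "?e d L \<subseteq> ?e d L'"
      using caused_mono[of L L' Y Y "{..<n}" C "\<sigma>(x := d)"]
        holds_mono[of L L' Y Y "{..<n}" \<phi> "\<sigma>(x := d)"] by (simp del: fun_upd_apply)
  qed
  ultimately have "adds s Y (\<lambda>L. \<Union>d<n. ?e d L) A (fold (\<lambda>d A.
      if ?ev d A Flg [] = 3 then sem n (exec_cee S C s (Suc m) (r(x := m))) (\<rho>(m := d)) (?ev d A) else ?ev d A)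
      [0..<n] A)"
    by (rule adds_fold)
  moreover have "sem n (Seq (eval_fo S \<phi> s (Suc m) (r(x := m)))
      (Test Flg [] 3 (exec_cee S C s (Suc m) (r(x := m))) Skip)) (\<rho>(m := d)) =
    (\<lambda>A. if ?ev d A Flg [] = 3 then sem n (exec_cee S C s (Suc m) (r(x := m))) (\<rho>(m := d)) (?ev d A) else ?ev d A)"
    for d by (rule ext) (simp del: fun_upd_apply)
  ultimately have "adds s Y (\<lambda>L. \<Union>d<n. ?e d L) A (sem n (exec_cee S (All x \<phi> C) s m r) \<rho> A)"
    by (simp only: exec_cee.simps sem.simps(5))
  \<comment> \<open>Every \<open>L\<close> above a stored set contains the whole domain, so the
    guard \<open>Elem d \<in> L\<close> can be traded for \<open>d < n\<close>.\<close>
  moreover have "caused {..<n} (All x \<phi> C) L Y \<sigma> = (\<Union>d<n. ?e d L)" if "store_set s A \<subseteq> L" for L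
  proof -
    have "\<forall>d<n. Elem d \<in> L" using that by (auto simp: subset_iff)
    then show ?thesis by (simp del: fun_upd_apply)
  qed
  ultimately show ?case by (subst adds_cong[where e' = "\<lambda>L. \<Union>d<n. ?e d L"])
qed auto

end

section \<open>Iteration for a number of rounds fixed in advance\<close>

text \<open>A set strictly below the least fixpoint is not closed under \<open>F\<close>, so a round
  adds at least one missing element; after \<open>card U\<close> rounds none is missing, and surplus
  rounds stay at the limit. \<open>R\<close> is a relation because a round may add more than one
  application of \<open>F\<close>.\<close>

lemma iterate_reaches_lfp:
  fixes F :: "'c set \<Rightarrow> 'c set"
  assumes R: "\<And>A A'. R A A' \<Longrightarrow> Q A \<Longrightarrow> Z A \<subseteq> lfp F \<Longrightarrow>
      Q A' \<and> Z A \<subseteq> Z A' \<and> F (Z A) \<subseteq> Z A' \<and> Z A' \<subseteq> lfp F"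
    and run: "(R ^^ M) A A'" and init: "Q A" "Z A \<subseteq> lfp F"
    and bound: "lfp F - Z A \<subseteq> U" "finite U" "card U \<le> M"
  shows "Q A' \<and> Z A' = lfp F"
proof -
  have "Q B \<and> Z A \<subseteq> Z B \<and> Z B \<subseteq> lfp F \<and> (Z B = lfp F \<or> card (lfp F - Z B) + k \<le> card U)"
    if "(R ^^ k) A B" for k B
    using that
  proof (induction k arbitrary: B)
    case 0
    then show ?case using init bound by (auto intro: card_mono)
  next
    case (Suc k)
    then obtain C where C: "(R ^^ k) A C" "R C B" by auto
    note IH = Suc.IH[OF C(1)]
    then have B: "Q B" "Z C \<subseteq> Z B" "F (Z C) \<subseteq> Z B" "Z B \<subseteq> lfp F" using R[OF C(2)] by auto
    have "Z B = lfp F \<or> card (lfp F - Z B) + Suc k \<le> card U"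
    proof (cases "Z C = lfp F")
      case False
      then have "\<not> F (Z C) \<subseteq> Z C" using lfp_lowerbound[of F "Z C"] IH by auto
      then have "lfp F - Z B \<subset> lfp F - Z C" using B by auto
      moreover have "finite (lfp F - Z C)"
        using IH bound by (meson Diff_mono finite_subset subset_refl)
      ultimately have "card (lfp F - Z B) < card (lfp F - Z C)" by (rule psubset_card_mono[rotated])
      then show ?thesis using IH False by auto
    qed (use B in auto)
    then show ?case using IH B by auto
  qed
  from this[OF run] have *: "Q A'" "Z A \<subseteq> Z A'" "Z A' \<subseteq> lfp F"
    "Z A' = lfp F \<or> card (lfp F - Z A') = 0" using bound(3) by auto
  have "finite (lfp F - Z A')" using *(2) bound by (meson Diff_mono finite_subset subset_refl)
  then show ?thesis using * by auto
qed

lemma relpowp_fold: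
  assumes "\<And>i A. (R ^^ m) A (f i A)"
  shows "(R ^^ (k * m)) A (fold f [0..<k] A)"
proof (induction k)
  case (Suc k)
  have "(R ^^ (k * m + m)) A (f k (fold f [0..<k] A))"
    unfolding relpowp_add using Suc assms by blast
  then show ?case by (simp add: add.commute)
qed simp

lemma relpowp_For:
  assumes "\<And>\<rho> A. R A (sem n C \<rho> A)"
  shows "(R ^^ (n ^ length vs)) A (sem n (foldr For vs C) \<rho> A)"
  using assms
proof (induction vs arbitrary: \<rho> A)
  case (Cons v vs)
  then show ?case using relpowp_fold[of "n ^ length vs" R, OF Cons.IH] by simp
qed auto

text \<open>The loops only count. With one loop variable per argument place, \<open>C\<close> runs
  at least once for each domain atom over \<open>ps\<close>.\<close>

definition repeat_cmd :: "('p \<Rightarrow> nat list) \<Rightarrow> 'p list \<Rightarrow> 'b cmd \<Rightarrow> 'b cmd" where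
  "repeat_cmd vs ps C = foldr (\<lambda>p. Seq (foldr For (vs p) C)) ps Skip"

lemma relpowp_repeat_cmd:
  assumes "\<And>\<rho> A. R A (sem n C \<rho> A)"
  shows "(R ^^ (\<Sum>p\<leftarrow>ps. n ^ length (vs p))) A (sem n (repeat_cmd vs ps C) \<rho> A)"
proof (induction ps arbitrary: A)
  case (Cons p ps)
  have "(R ^^ (n ^ length (vs p) + (\<Sum>p\<leftarrow>ps. n ^ length (vs p)))) A
      (sem n (repeat_cmd vs ps C) \<rho> (sem n (foldr For (vs p) C) \<rho> A))"
    unfolding relpowp_add using relpowp_For[of R n C, OF assms] Cons by blast
  then show ?case by (simp add: repeat_cmd_def)
qed (simp add: repeat_cmd_def)

definition clear :: "bool \<Rightarrow> 'p list \<Rightarrow> 'p arr cmd" where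
  "clear s ps = foldr (\<lambda>p. Seq (Fill (Rl s p) 1)) ps Skip"

lemma sem_clear: "sem n (clear s ps) \<rho> A b = (if b \<in> Rl s ` set ps then (\<lambda>_. 1) else A b)"
  by (induction ps arbitrary: A) (auto simp: clear_def)

text \<open>Computes \<open>gam\<close> of the opposite bound from cleared tables. Registers below
  \<open>K\<close> count the outer rounds, those from \<open>K\<close> the inner ones, and those
  from \<open>2 * K\<close> on serve the variables of the theory; \<open>K\<close> bounds the
  arities, so the ranges are disjoint.\<close>

definition phase :: "('p \<Rightarrow> nat) \<Rightarrow> nat \<Rightarrow> 'p list \<Rightarrow> 'p cee \<Rightarrow> bool \<Rightarrow> 'p arr cmd" where
  "phase ar K ps \<Delta> s = Seq (clear s ps)
     (repeat_cmd (\<lambda>p. [K..<K + ar p]) ps (exec_cee (endogenous \<Delta>) \<Delta> s (2 * K) (\<lambda>_. 0)))"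

text \<open>A round recomputes the upper bound from the lower one and then the lower from the upper,
  which applies \<open>gam\<close> twice. The preceding loop writes the diagonal of the equality
  table.\<close>

definition alternate :: "('p \<Rightarrow> nat) \<Rightarrow> nat \<Rightarrow> 'p list \<Rightarrow> 'p cee \<Rightarrow> 'p arr cmd" where
  "alternate ar K ps \<Delta> = Seq (Fill Equ 1) (Seq (For 0 (Put Equ [0, 0] 3))
     (repeat_cmd (\<lambda>p. [0..<ar p]) ps (Seq (phase ar K ps \<Delta> False) (phase ar K ps \<Delta> True))))"

section \<open>Register discipline of the programs\<close>

text \<open>A version of \<open>cmd_ok\<close> free of \<open>N\<close>, so that no explicit
  register count has to be carried through the generated programs; a sufficient \<open>N\<close> is
  extracted at the end.\<close>

primrec cmd_wf :: "('b \<Rightarrow> nat) \<Rightarrow> nat set \<Rightarrow> 'b cmd \<Rightarrow> bool" where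
  "cmd_wf arity V Skip \<longleftrightarrow> True"
| "cmd_wf arity V (Put b vs s) \<longleftrightarrow> length vs = arity b \<and> s \<le> 5"
| "cmd_wf arity V (Test b vs s C D) \<longleftrightarrow> length vs = arity b \<and> cmd_wf arity V C \<and> cmd_wf arity V D"
| "cmd_wf arity V (Seq C D) \<longleftrightarrow> cmd_wf arity V C \<and> cmd_wf arity V D"
| "cmd_wf arity V (For v C) \<longleftrightarrow> v \<notin> V \<and> cmd_wf arity (insert v V) C"
| "cmd_wf arity V (Fill b s) \<longleftrightarrow> s \<le> 5"

lemma set_subset_lessThan: "set vs \<subseteq> {..<Suc (sum_list vs)}" for vs :: "nat list"
  by (auto simp: less_Suc_eq_le intro: member_le_sum_list)

lemma cmd_wf_ok: "cmd_wf arity V C \<Longrightarrow> \<exists>N0. \<forall>N\<ge>N0. cmd_ok arity N V C"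
proof (induction C arbitrary: V)
  case (Put b vs s)
  then show ?case using set_subset_lessThan[of vs]
    by (intro exI[of _ "arity b + Suc (sum_list vs)"]) (auto simp: subset_iff less_Suc_eq_le)
next
  case (Test b vs s C D)
  then obtain N1 N2 where "\<forall>N\<ge>N1. cmd_ok arity N V C" "\<forall>N\<ge>N2. cmd_ok arity N V D"
    by fastforce
  then show ?case using Test.prems set_subset_lessThan[of vs]
    by (intro exI[of _ "arity b + Suc (sum_list vs) + N1 + N2"])
      (auto simp: subset_iff less_Suc_eq_le)
next
  case (Seq C D)
  then obtain N1 N2 where "\<forall>N\<ge>N1. cmd_ok arity N V C" "\<forall>N\<ge>N2. cmd_ok arity N V D"
    by fastforce
  then show ?case by (intro exI[of _ "N1 + N2"]) auto
next
  case (For v C)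
  then obtain N1 where "\<forall>N\<ge>N1. cmd_ok arity N (insert v V) C" by fastforce
  then show ?case using For.prems by (intro exI[of _ "Suc v + N1"]) auto
next
  case (Fill b s)
  then show ?case by (intro exI[of _ "arity b"]) auto
qed auto

lemma cmd_wf_eval_fo:
  "wf_fo \<Sigma> ar \<phi> \<Longrightarrow> V \<subseteq> {..<m} \<Longrightarrow> cmd_wf (arr_arity ar) V (eval_fo S \<phi> s m r)"
proof (induction \<phi> arbitrary: V s m r)
  case (Forall x \<phi>)
  then have V: "insert m V \<subseteq> {..<Suc m}" by auto
  show ?case using Forall.IH[OF _ V] Forall.prems by auto
next
  case (Exists x \<phi>)
  then have V: "insert m V \<subseteq> {..<Suc m}" by auto
  show ?case using Exists.IH[OF _ V] Exists.prems by auto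
qed (auto simp: source_def)

lemma cmd_wf_exec_cee:
  "wf_cee \<Sigma> ar C \<Longrightarrow> V \<subseteq> {..<m} \<Longrightarrow> cmd_wf (arr_arity ar) V (exec_cee S C s m r)"
proof (induction C arbitrary: V m r)
  case (All x \<phi> C)
  then have V: "insert m V \<subseteq> {..<Suc m}" by auto
  show ?case using All.IH[OF _ V] cmd_wf_eval_fo[OF _ V] All.prems by auto
qed (auto intro: cmd_wf_eval_fo)

lemma cmd_wf_foldr_For:
  "cmd_wf arity (V \<union> set vs) C \<Longrightarrow> distinct vs \<Longrightarrow> set vs \<inter> V = {} \<Longrightarrow> cmd_wf arity V (foldr For vs C)"
  by (induction vs arbitrary: V) auto

lemma cmd_wf_repeat_cmd:
  assumes "\<And>p. p \<in> set ps \<Longrightarrow> cmd_wf arity (V \<union> set (vs p)) C \<and> distinct (vs p) \<and> set (vs p) \<inter> V = {}"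
  shows "cmd_wf arity V (repeat_cmd vs ps C)"
  using assms unfolding repeat_cmd_def by (induction ps) (auto intro: cmd_wf_foldr_For)

lemma cmd_wf_clear: "cmd_wf arity V (clear s ps)"
  unfolding clear_def by (induction ps) auto

lemma cmd_wf_alternate:
  assumes "wf_cee \<Sigma> ar \<Delta>" "\<forall>p\<in>set ps. ar p \<le> K"
  shows "cmd_wf (arr_arity ar) {} (alternate ar K ps \<Delta>)"
proof -
  have phase: "cmd_wf (arr_arity ar) V (phase ar K ps \<Delta> s)" if "V \<subseteq> {..<K}" for V s
    unfolding phase_def cmd_wf.simps
    using assms that
    by (intro conjI cmd_wf_clear cmd_wf_repeat_cmd cmd_wf_exec_cee[where \<Sigma> = \<Sigma>]) fastforce+
  have "cmd_wf (arr_arity ar) ({} \<union> set [0..<ar p])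
      (Seq (phase ar K ps \<Delta> False) (phase ar K ps \<Delta> True))" if "p \<in> set ps" for p
  proof -
    have "{} \<union> set [0..<ar p] \<subseteq> {..<K}" using that assms(2) by fastforce
    then show ?thesis using phase by simp
  qed
  then show ?thesis
    unfolding alternate_def by (auto intro!: cmd_wf_repeat_cmd)
qed

section \<open>Correctness of the alternating iteration\<close>

locale endogenous_expansion = tables \<Sigma> ar "endogenous \<Delta>" n
  for \<Sigma> :: "'p list" and ar :: "'p \<Rightarrow> nat" and \<Delta> :: "'p cee" and n :: nat +
  fixes E :: "('p, nat) pstr"
  assumes wf: "wf_cee \<Sigma> ar \<Delta>" "fv_cee \<Delta> = {}" and no_choice: "no_choice \<Delta>"
    and E: "structure_over \<Sigma> ar E" "\<And>d. E (Elem d) = (if d < n then TT else FF)"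
begin

text \<open>Nothing is created, so every element of \<open>{..<n}\<close> is initial.\<close>

definition first_selection :: "nat selection" where
  "first_selection = \<lparr>base = {..<n}, selc = (\<lambda>_ _. 0), orc = (\<lambda>_ _. 1), newc = (\<lambda>_ _. None)\<rparr>"

lemma base_first_selection [simp]: "base first_selection = {..<n}"
  by (simp add: first_selection_def)

sublocale symmetric_approximator "causality_op \<Delta> first_selection E" "consequences \<Delta> {..<n} E"
proof -
  have "initial \<Delta> first_selection = {..<n}"
    by (simp add: initial_def first_selection_def)
  then show "symmetric_approximator (causality_op \<Delta> first_selection E) (consequences \<Delta> {..<n} E)"
    using symmetric_causality_op[of \<Delta> first_selection E] no_choice E(1)
    by (simp add: structure_over_def) (simp add: first_selection_def)
qed

definition endogenous_atoms :: "('p, nat) datom set" where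
  "endogenous_atoms = {Atm p ds | p ds. p \<in> endogenous \<Delta> \<and> ds \<in> tuples_over {..<n} (ar p)}"

abbreviation known :: "('p, nat) datom set" where
  "known \<equiv> facts \<Delta> {..<n} E"

lemma consequences_subset: "consequences \<Delta> {..<n} E X Y \<subseteq> known \<union> endogenous_atoms"
  using caused_wf[OF wf(1), of "env []" "{..<n}" X Y] wf(2)
  by (auto simp: consequences_def endogenous_atoms_def)

lemma known_subset: "known \<subseteq> consequences \<Delta> {..<n} E X Y"
  by (auto simp: consequences_def)

lemma gam_bounds: "known \<subseteq> gam Y" "gam Y \<subseteq> known \<union> endogenous_atoms"
  using gam_unfold[of Y] known_subset consequences_subset by blast+

lemma wf_lower_bounds: "known \<subseteq> wf_lower" "wf_lower \<subseteq> known \<union> endogenous_atoms"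
  using gam_bounds[of "gam wf_lower"] by (simp_all add: wf_lower_unfold)

definition predicates :: "'p list" where
  "predicates = filter (\<lambda>p. p \<in> endogenous \<Delta>) \<Sigma>"

lemma set_predicates: "set predicates = endogenous \<Delta>"
  using endogenous_wf[OF wf(1)] by (auto simp: predicates_def)

text \<open>The bound is exactly the number of rounds that \<open>repeat_cmd\<close> performs over
  \<open>predicates\<close>.\<close>

lemma finite_endogenous_atoms: "finite endogenous_atoms"
  and card_endogenous_atoms: "card endogenous_atoms \<le> (\<Sum>p\<leftarrow>predicates. n ^ ar p)"
proof -
  let ?T = "\<lambda>p. Atm p ` tuples_over {..<n} (ar p)"
  have *: "finite (\<Union>p\<in>set ps. ?T p) \<and> card (\<Union>p\<in>set ps. ?T p) \<le> (\<Sum>p\<leftarrow>ps. n ^ ar p)" for ps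
  proof (induction ps)
    case (Cons p ps)
    have "card (?T p) \<le> n ^ ar p"
      using card_image_le[of "tuples_over {..<n} (ar p)" "Atm p"]
      by (simp add: finite_tuples_over card_tuples_over)
    then show ?case using Cons card_Un_le[of "?T p" "\<Union>p\<in>set ps. ?T p"]
      by (auto simp: finite_tuples_over)
  qed simp
  have "endogenous_atoms = (\<Union>p\<in>set predicates. ?T p)"
    by (auto simp: endogenous_atoms_def set_predicates)
  then show "finite endogenous_atoms" "card endogenous_atoms \<le> (\<Sum>p\<leftarrow>predicates. n ^ ar p)"
    using *[of predicates] by simp_all
qed

definition exog :: "('p, nat) datom set \<Rightarrow> ('p, nat) datom set" where
  "exog X = {a \<in> X. \<forall>p ds. a = Atm p ds \<longrightarrow> p \<notin> endogenous \<Delta>}"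

text \<open>For an exogenous predicate \<open>source\<close> yields the same table for both
  polarities.\<close>

lemma exog_store_set: "exog (store_set s A) = exog (store_set s' A)"
proof -
  have "a \<in> exog (store_set s A) \<longleftrightarrow> a \<in> exog (store_set s' A)" for a
    by (cases a) (auto simp: exog_def Atm_store_set source_def)
  then show ?thesis by blast
qed

text \<open>What the phases leave intact: the equality table and the exogenous part of the store,
  which is the same for both bounds.\<close>

definition inv :: "'p arr store \<Rightarrow> bool" where
  "inv A \<longleftrightarrow> equ_ok n A \<and> exog (store_set True A) = known"

lemma store_set_clear:
  assumes "inv A"
  shows "store_set s (sem n (clear s predicates) \<rho> A) = known"
    and "store_set (\<not> s) (sem n (clear s predicates) \<rho> A) = store_set (\<not> s) A"
    and "equ_ok n (sem n (clear s predicates) \<rho> A)"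
proof -
  let ?A = "sem n (clear s predicates) \<rho> A"
  have "a \<in> store_set s ?A \<longleftrightarrow> a \<in> exog (store_set s A)" for a
    by (cases a) (auto simp: exog_def Atm_store_set source_def sem_clear set_predicates image_iff)
  then have "store_set s ?A = exog (store_set s A)" by blast
  then show "store_set s ?A = known"
    using assms exog_store_set[of s A True] by (simp add: inv_def)
  have "a \<in> store_set (\<not> s) ?A \<longleftrightarrow> a \<in> store_set (\<not> s) A" for a
    by (cases a) (auto simp: Atm_store_set source_def sem_clear set_predicates image_iff)
  then show "store_set (\<not> s) ?A = store_set (\<not> s) A" by blast
  show "equ_ok n ?A" using assms by (simp add: inv_def equ_ok_def sem_clear image_iff)
qed

text \<open>Clearing leaves just the facts in bound \<open>s\<close>. From there, adding effects
  climbs to the least fixpoint of \<open>consequences\<close>, because the facts are kept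
  throughout.\<close>

lemma sem_phase:
  fixes s :: bool and K :: nat and \<rho> :: "nat \<Rightarrow> nat"
  assumes "inv A"
  defines "A' \<equiv> sem n (phase ar K predicates \<Delta> s) \<rho> A"
  shows "inv A' \<and> store_set (\<not> s) A' = store_set (\<not> s) A \<and> store_set s A' = gam (store_set (\<not> s) A)"
proof -
  let ?Y = "store_set (\<not> s) A" and ?A = "sem n (clear s predicates) \<rho> A"
  let ?F = "\<lambda>X. consequences \<Delta> {..<n} E X ?Y"
  let ?R = "adds s ?Y (\<lambda>L. caused {..<n} \<Delta> L ?Y (env []))"
  let ?Q = "\<lambda>A. equ_ok n A \<and> store_set (\<not> s) A = ?Y \<and> known \<subseteq> store_set s A"
  have "(?R ^^ (\<Sum>p\<leftarrow>predicates. n ^ length [K..<K + ar p])) ?A A'"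
    unfolding A'_def phase_def sem.simps
    using wf no_choice by (intro relpowp_repeat_cmd adds_exec_cee) auto
  then have run: "(?R ^^ (\<Sum>p\<leftarrow>predicates. n ^ ar p)) ?A A'" by simp
  have step: "?Q B' \<and> store_set s B \<subseteq> store_set s B' \<and> ?F (store_set s B) \<subseteq> store_set s B' \<and>
      store_set s B' \<subseteq> lfp ?F" if R: "?R B B'" and Q: "?Q B" and le: "store_set s B \<subseteq> lfp ?F" for B B'
  proof -
    have B': "equ_ok n B'" "store_set (\<not> s) B' = ?Y" "store_set s B \<subseteq> store_set s B'"
      "caused {..<n} \<Delta> (store_set s B) ?Y (env []) \<subseteq> store_set s B'"
      and closed: "\<And>L. store_set s B \<subseteq> L \<Longrightarrow> caused {..<n} \<Delta> L ?Y (env []) \<subseteq> L \<Longrightarrow> store_set s B' \<subseteq> L"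
      using R Q by (auto simp: adds_def)
    \<comment> \<open>The least fixpoint is closed under \<open>caused\<close>, so in-place
      additions cannot overshoot it.\<close>
    have "caused {..<n} \<Delta> (lfp ?F) ?Y (env []) \<subseteq> lfp ?F"
      using gam_unfold[of ?Y] unfolding gam_def consequences_def by blast
    then have "store_set s B' \<subseteq> lfp ?F" using closed le by blast
    then show ?thesis using B' Q by (auto simp: consequences_def)
  qed
  have "?Q A' \<and> store_set s A' = lfp ?F"
  proof (rule iterate_reaches_lfp[where R = ?R and Q = ?Q and Z = "store_set s", OF step run])
    show "?Q ?A" using store_set_clear[OF assms(1)] by simp
    show "store_set s ?A \<subseteq> lfp ?F"
      using gam_bounds(1)[of ?Y] by (simp add: store_set_clear[OF assms(1)] gam_def)
    show "lfp ?F - store_set s ?A \<subseteq> endogenous_atoms"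
      using gam_bounds(2)[of ?Y] by (auto simp: store_set_clear[OF assms(1)] gam_def)
  qed (use finite_endogenous_atoms card_endogenous_atoms in auto)
  moreover have "exog (store_set True A') = exog (store_set (\<not> s) A')"
    "exog ?Y = exog (store_set True A)" by (rule exog_store_set)+
  ultimately show ?thesis using assms(1) by (auto simp: inv_def gam_def)
qed

lemma sem_alternate:
  assumes "store_set True A = known"
  shows "store_set True (sem n (alternate ar K predicates \<Delta>) \<rho> A) = wf_lower"
proof -
  let ?F = "\<lambda>X. gam (gam X)"
  let ?R = "\<lambda>A A'. inv A \<longrightarrow> inv A' \<and> store_set True A' = ?F (store_set True A)"
  \<comment> \<open>Each round clears and rebuilds the lower bound; it still grows from round to
    round because it is kept a post-fixpoint of \<open>gam \<circ> gam\<close>.\<close>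
  let ?Q = "\<lambda>A. inv A \<and> store_set True A \<subseteq> ?F (store_set True A)"
  define A1 where "A1 = sem n (For 0 (Put Equ [0, 0] 3)) \<rho> (sem n (Fill Equ 1) \<rho> A)"
  define A2 where "A2 = sem n (repeat_cmd (\<lambda>p. [0..<ar p]) predicates
    (Seq (phase ar K predicates \<Delta> False) (phase ar K predicates \<Delta> True))) \<rho> A1"
  have diag: "fold (\<lambda>i. sem n (Put Equ [0, 0] 3) (\<rho>(0 := i))) [0..<k] B b ds =
      (if b = Equ \<and> (\<exists>i<k. ds = [i, i]) then 3 else B b ds)" for k B b ds
    by (induction k) (auto simp: less_Suc_eq)
  have A1: "A1 b ds = (if b = Equ then if \<exists>i<n. ds = [i, i] then 3 else 1 else A b ds)" for b ds
    unfolding A1_def sem.simps(5) diag by auto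
  have "source (endogenous \<Delta>) s p \<noteq> Equ" for s p by (simp add: source_def)
  then have "store_set True A1 = store_set True A" by (simp add: store_set_def A1)
  moreover have "exog known = known" by (auto simp: exog_def facts_def)
  ultimately have init: "store_set True A1 = known" "inv A1"
    using assms by (auto simp: inv_def equ_ok_def A1)
  have "?R B (sem n (Seq (phase ar K predicates \<Delta> False) (phase ar K predicates \<Delta> True)) \<rho> B)" for \<rho> B
  proof
    assume "inv B"
    let ?B = "sem n (phase ar K predicates \<Delta> False) \<rho> B"
    have "inv ?B" "store_set True ?B = store_set True B" "store_set False ?B = gam (store_set True B)"
      using sem_phase[OF \<open>inv B\<close>, of K False \<rho>] by auto
    then show "inv (sem n (Seq (phase ar K predicates \<Delta> False) (phase ar K predicates \<Delta> True)) \<rho> B) \<and>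
      store_set True (sem n (Seq (phase ar K predicates \<Delta> False) (phase ar K predicates \<Delta> True)) \<rho> B) =
      ?F (store_set True B)"
      using sem_phase[of ?B K True \<rho>] by simp
  qed
  from relpowp_repeat_cmd[where R = ?R, OF this]
  have run: "(?R ^^ (\<Sum>p\<leftarrow>predicates. n ^ length [0..<ar p])) A1 A2" unfolding A2_def .
  have "?Q A2 \<and> store_set True A2 = lfp ?F"
  proof (rule iterate_reaches_lfp[where R = ?R and Z = "store_set True" and Q = ?Q, OF _ run])
    fix B B' assume "?R B B'" and "?Q B" and le: "store_set True B \<subseteq> lfp ?F"
    then have B: "inv B'" "store_set True B' = ?F (store_set True B)"
      "store_set True B \<subseteq> ?F (store_set True B)" by auto
    then show "?Q B' \<and> store_set True B \<subseteq> store_set True B' \<and>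
        ?F (store_set True B) \<subseteq> store_set True B' \<and> store_set True B' \<subseteq> lfp ?F"
      using monoD[OF mono_gam2 B(3)] monoD[OF mono_gam2 le] lfp_unfold[OF mono_gam2] by auto
  next
    \<comment> \<open>Every value of \<open>gam\<close> contains the facts, so the set of facts is a
      post-fixpoint to start from.\<close>
    show "?Q A1" using init gam_bounds(1) by simp
    show "store_set True A1 \<subseteq> lfp ?F" using init wf_lower_bounds(1) by (simp add: wf_lower_def)
    show "lfp ?F - store_set True A1 \<subseteq> endogenous_atoms"
      using init wf_lower_bounds(2) by (auto simp: wf_lower_def)
  qed (use finite_endogenous_atoms card_endogenous_atoms in auto)
  then show ?thesis by (simp add: alternate_def A1_def A2_def wf_lower_def)
qed

lemma Atm_wf_lower: "p \<notin> endogenous \<Delta> \<Longrightarrow> Atm p ds \<in> wf_lower \<longleftrightarrow> E (Atm p ds) = TT"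
  using wf_lower_bounds by (auto simp: facts_def endogenous_atoms_def)

lemma Elem_wf_lower: "Elem d \<in> wf_lower \<longleftrightarrow> d < n"
  using wf_lower_bounds by (auto simp: facts_def endogenous_atoms_def)

lemma Atm_wf_lowerD: "Atm p ds \<in> wf_lower \<Longrightarrow> p \<in> set \<Sigma> \<and> ds \<in> tuples_over {..<n} (ar p)"
proof (cases "p \<in> endogenous \<Delta>")
  case True
  assume "Atm p ds \<in> wf_lower"
  then show ?thesis using True wf_lower_bounds(2) endogenous_wf[OF wf(1)]
    by (auto simp: facts_def endogenous_atoms_def)
next
  case False
  assume "Atm p ds \<in> wf_lower"
  then have TT: "E (Atm p ds) = TT" using Atm_wf_lower[OF False] by simp
  have "p \<notin> set \<Sigma> \<or> length ds \<noteq> ar p \<or> (\<exists>d\<in>set ds. E (Elem d) = FF) \<Longrightarrow> E (Atm p ds) = FF"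
    using E(1) by (simp add: structure_over_def partial_structure_def)
  then show ?thesis using TT E(2) by (force simp: tuples_over_def)
qed

definition expansion :: "('p, nat) pstr" where
  "expansion = of_pair wf_lower wf_lower"

lemma expansion_eq: "expansion a = (if a \<in> wf_lower then TT else FF)"
  by (simp add: expansion_def of_pair_def)

lemma is_model_expansion:
  assumes "total_theory \<Sigma> ar \<Delta>" "0 < n"
  shows "is_model \<Sigma> ar \<Delta> expansion"
proof -
  let ?\<zeta> = "first_selection"
  have sel: "is_selection \<Delta> ?\<zeta>"
    using assms(2) by (auto simp: is_selection_def first_selection_def lessThan_empty_iff)
  have "{d. E (Elem d) = TT} = base ?\<zeta>" using E(2) by auto
  then have "two_valued (wf_fixpoint (causality_op \<Delta> ?\<zeta> E))"
    using assms(1) sel E(1) unfolding total_theory_def by blast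
  then have wfp: "wf_fixpoint (causality_op \<Delta> ?\<zeta> E) = expansion"
    using two_valued_wf_fixpoint wf_fixpoint_eq by (simp add: expansion_def)
  \<comment> \<open>A model has to be the fixpoint for its own exogenous part instead of that of
    \<open>E\<close>; the two agree, so the operator is the same.\<close>
  have "expansion (Atm p ds) = E (Atm p ds)" if "p \<notin> endogenous \<Delta>" for p ds
  proof -
    have "E (Atm p ds) \<noteq> UU" using E(1) by (simp add: structure_over_def two_valued_def)
    then show ?thesis using Atm_wf_lower[OF that] by (cases "E (Atm p ds)") (auto simp: expansion_eq)
  qed
  then have "causality_op \<Delta> ?\<zeta> expansion = causality_op \<Delta> ?\<zeta> E"
    by (auto simp: causality_op_def fun_eq_iff split: datom.split)
  moreover have "structure_over \<Sigma> ar expansion"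
    using assms(2) Atm_wf_lowerD
    by (auto simp: structure_over_def partial_structure_def two_valued_def expansion_eq Elem_wf_lower
        tuples_over_def)
  \<comment> \<open>Relevance only reaches subexpressions of \<open>\<Delta>\<close>, so both
    conditions for success hold vacuously.\<close>
  moreover have "succeeds \<Delta> ?\<zeta> expansion"
    using no_choice_relevant no_choice by (fastforce simp: succeeds_def)
  ultimately show ?thesis using sel wfp by (auto simp: is_model_def)
qed

lemma encode_expansion:
  "encode \<Sigma> ar expansion = replicate n 4 @
     concat (map (\<lambda>p. table n (ar p) (\<lambda>ds. if Atm p ds \<in> wf_lower then 3 else 1)) \<Sigma>)"
proof -
  have "{d. expansion (Elem d) = TT} = {..<n}" by (auto simp: expansion_eq Elem_wf_lower)
  moreover have "tv_code (expansion a) = (if a \<in> wf_lower then 3 else 1)" for a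
    by (simp add: expansion_eq)
  ultimately show ?thesis by (simp add: encode_def)
qed

end

section \<open>Assembly of the polynomial-time procedure\<close>

theorem theorem6:
  fixes \<Sigma> :: "'p list" and ar :: "'p \<Rightarrow> nat" and \<Delta> :: "'p cee"
  assumes "clog_theory \<Sigma> ar \<Delta>"
    and "total_theory \<Sigma> ar \<Delta>"
    and "\<not> contains_new \<Delta>"
    and "\<not> contains_select \<Delta>"
  shows "endogenous_mx_in_P \<Sigma> ar \<Delta>"
proof -
  have wf: "wf_cee \<Sigma> ar \<Delta>" "fv_cee \<Delta> = {}" "no_choice \<Delta>"
    using assms no_choiceI by (auto simp: clog_theory_def)
  \<comment> \<open>The sum is a common bound on the arities that is also defined for an empty
    vocabulary.\<close>
  define K where "K = sum_list (map ar \<Sigma>)"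
  define ps where "ps = filter (\<lambda>p. p \<in> endogenous \<Delta>) \<Sigma>"
  define C where "C = alternate ar K ps \<Delta>"
  have K: "\<forall>p\<in>set \<Sigma>. ar p \<le> K" unfolding K_def by (auto intro: member_le_sum_list)
  then have "cmd_wf (arr_arity ar) {} C"
    unfolding C_def by (intro cmd_wf_alternate[OF wf(1)]) (auto simp: ps_def)
  then obtain N0 where "\<forall>N\<ge>N0. cmd_ok (arr_arity ar) N {} C" using cmd_wf_ok by blast
  then have "cmd_ok (arr_arity ar) (N0 + K) {} C" "\<forall>b\<in>set (map (Rl True) \<Sigma>). arr_arity ar b \<le> N0 + K"
    using K by auto
  from loop_program_tm[OF this] obtain M c k where M: "tm_wf M" "tm_symbols M = {..5}"
    and run: "\<And>n g. 1 \<le> n \<Longrightarrow> \<forall>b ds. g b ds \<noteq> 4 \<Longrightarrow>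
      (let A = sem n C (\<lambda>_. 0) (\<lambda>b. if b \<in> set (map (Rl True) \<Sigma>) then \<lambda>ds. bit_code (g b ds) else (\<lambda>_. 0))
       in \<exists>t\<le>c * n ^ k. tm_computes M
          (replicate n 4 @ concat (map (\<lambda>b. table n (arr_arity ar b) (g b)) (map (Rl True) \<Sigma>)))
          (replicate n 4 @ concat (map (\<lambda>b. table n (arr_arity ar b) (\<lambda>ds. bit_code (A b ds)))
            (map (Rl True) \<Sigma>))) t)"
    by (elim exE conjE) blast
  have "set (encode \<Sigma> ar J) \<subseteq> tm_symbols M \<and>
    (\<exists>v t. mx_answer \<Sigma> ar \<Delta> J v \<and> tm_computes M (encode \<Sigma> ar J) v t \<and>
       t \<le> c * length (encode \<Sigma> ar J) ^ k + c)"
    if J: "endogenous_mx_instance \<Sigma> ar \<Delta> J" for J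
  proof
    have ps: "partial_structure \<Sigma> ar J"
      and exo: "\<And>p ds. p \<in> set \<Sigma> \<Longrightarrow> p \<notin> endogenous \<Delta> \<Longrightarrow> J (Atm p ds) \<noteq> UU"
      using J by (auto simp: endogenous_mx_instance_def)
    obtain n where n: "\<And>d. J (Elem d) = (if d < n then TT else FF)"
      using J by (auto simp: endogenous_mx_instance_def)
    have dom: "{d. J (Elem d) = TT} = {..<n}" using n by auto
    have endo: "\<And>p ds. p \<in> endogenous \<Delta> \<Longrightarrow> ds \<in> tuples_over {..<n} (ar p) \<Longrightarrow> J (Atm p ds) = UU"
      using J dom by (auto simp: endogenous_mx_instance_def)
    have outside: "J (Atm p ds) = FF" if "p \<notin> set \<Sigma> \<or> ds \<notin> tuples_over {..<n} (ar p)" for p ds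
    proof -
      have "p \<notin> set \<Sigma> \<or> length ds \<noteq> ar p \<or> (\<exists>d\<in>set ds. J (Elem d) = FF)"
        using that n by (auto simp: tuples_over_def)
      then show ?thesis using ps by (auto simp: partial_structure_def)
    qed
    have "0 < n" using ps n by (auto simp: partial_structure_def split: if_splits)
    have enc: "encode \<Sigma> ar J =
        replicate n 4 @ concat (map (\<lambda>p. table n (ar p) (\<lambda>ds. tv_code (J (Atm p ds)))) \<Sigma>)"
      using dom by (simp add: encode_def)
    have "tv_code x \<le> 5" for x by (cases x) auto
    then show "set (encode \<Sigma> ar J) \<subseteq> tm_symbols M" by (auto simp: enc M(2))
    \<comment> \<open>Unknown atoms are made false to obtain a two-valued structure. The operator
      consults \<open>E\<close> on exogenous atoms only, where \<open>J\<close> is known.\<close>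
    define E where "E a = (if J a = UU then FF else J a)" for a
    have Elem: "E (Elem d) = (if d < n then TT else FF)" for d by (simp add: E_def n)
    have "structure_over \<Sigma> ar E"
      using \<open>0 < n\<close> outside Elem
      by (force simp: structure_over_def two_valued_def partial_structure_def E_def tuples_over_def n
          split: if_splits)
    then interpret endogenous_expansion \<Sigma> ar \<Delta> n E
      using wf Elem by unfold_locales auto
    define g where "g b ds = (case b of Rl s p \<Rightarrow> tv_code (J (Atm p ds)) | _ \<Rightarrow> 1)" for b ds
    have "tv_code x \<noteq> 4" for x by (cases x) auto
    then have "\<forall>b ds. g b ds \<noteq> 4" by (simp add: g_def split: arr.split)
    note run = run[OF _ this, of n]
    define A0 where "A0 = (\<lambda>b. if b \<in> set (map (Rl True) \<Sigma>) then \<lambda>ds. bit_code (g b ds) else (\<lambda>_. 0))"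
    define A where "A = sem n C (\<lambda>_. 0) A0"
    have "a \<in> store_set True A0 \<longleftrightarrow> a \<in> known" for a
    proof (cases a)
      case (Elem d)
      then show ?thesis by (auto simp: facts_def)
    next
      case (Atm p ds)
      have *: "bit_code (tv_code x) = 3 \<longleftrightarrow> x = TT" for x by (cases x) (auto simp: bit_code_def)
      have "a \<in> store_set True A0 \<longleftrightarrow>
          p \<in> set \<Sigma> \<and> ds \<in> tuples_over {..<n} (ar p) \<and> J (Atm p ds) = TT"
        by (auto simp: Atm Atm_store_set source_def A0_def g_def *)
      moreover have "a \<in> known \<longleftrightarrow> p \<notin> endogenous \<Delta> \<and> J (Atm p ds) = TT"
        by (auto simp: Atm facts_def E_def)
      ultimately show ?thesis using endo[of p ds] outside[of p ds] by auto
    qed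
    \<comment> \<open>Endogenous entries are unknown in \<open>J\<close> and were loaded as 1, so
      the initial lower bound consists of the facts.\<close>
    then have "store_set True A0 = known" by blast
    then have A: "store_set True A = wf_lower"
      using sem_alternate[of A0 K "\<lambda>_. 0"] by (simp add: A_def C_def ps_def predicates_def)
    have "bit_code (A (Rl True p) ds) = (if Atm p ds \<in> wf_lower then 3 else 1)"
      if "p \<in> set \<Sigma>" "ds \<in> set (List.n_lists (ar p) [0..<n])" for p ds
    proof -
      have "ds \<in> tuples_over {..<n} (ar p)" using that(2) by (auto simp: set_n_lists tuples_over_def)
      then have "Atm p ds \<in> wf_lower \<longleftrightarrow> A (Rl True p) ds = 3"
        using that(1) by (simp add: A[symmetric] Atm_store_set source_def)
      then show ?thesis by (simp add: bit_code_def)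
    qed
    then have tables: "map (\<lambda>b. table n (arr_arity ar b) (\<lambda>ds. bit_code (A b ds))) (map (Rl True) \<Sigma>) =
        map (\<lambda>p. table n (ar p) (\<lambda>ds. if Atm p ds \<in> wf_lower then 3 else 1)) \<Sigma>"
      by simp
    have inputs: "map (\<lambda>b. table n (arr_arity ar b) (g b)) (map (Rl True) \<Sigma>) =
        map (\<lambda>p. table n (ar p) (\<lambda>ds. tv_code (J (Atm p ds)))) \<Sigma>"
      by (simp add: g_def)
    have "\<exists>t\<le>c * n ^ k. tm_computes M (encode \<Sigma> ar J) (encode \<Sigma> ar expansion) t"
      using run \<open>0 < n\<close>
      unfolding A0_def[symmetric] A_def[symmetric] Let_def tables inputs enc encode_expansion by simp
    then obtain t where t: "t \<le> c * n ^ k"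
      "tm_computes M (encode \<Sigma> ar J) (encode \<Sigma> ar expansion) t"
      by blast
    have "J a = UU \<or> J a = expansion a" for a
    proof (cases a)
      case (Elem d)
      then show ?thesis by (simp add: n expansion_eq Elem_wf_lower)
    next
      case (Atm p ds)
      show ?thesis
      proof (cases "p \<in> set \<Sigma> \<and> ds \<in> tuples_over {..<n} (ar p)")
        case True
        then show ?thesis using endo[of p ds] exo[of p ds] Atm_wf_lower[of p ds] Atm
          by (cases "J a") (auto simp: expansion_eq E_def)
      next
        case False
        then show ?thesis using outside[of p ds] Atm_wf_lowerD[of p ds] Atm by (auto simp: expansion_eq)
      qed
    qed
    then have "model_expansion \<Sigma> ar \<Delta> J expansion"
      using is_model_expansion[OF assms(2) \<open>0 < n\<close>] by (simp add: model_expansion_def less_precise_def)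
    then have "mx_answer \<Sigma> ar \<Delta> J (encode \<Sigma> ar expansion)" by (auto simp: mx_answer_def)
    \<comment> \<open>The unary prefix makes the input at least \<open>n\<close> symbols long, so a
      bound in \<open>n\<close> is a bound in the input length.\<close>
    moreover have "n ^ k \<le> length (encode \<Sigma> ar J) ^ k" by (intro power_mono) (auto simp: enc)
    then have "t \<le> c * length (encode \<Sigma> ar J) ^ k + c"
      using t(1) by (meson le_add1 mult_le_mono2 order_trans)
    ultimately show "\<exists>v t. mx_answer \<Sigma> ar \<Delta> J v \<and> tm_computes M (encode \<Sigma> ar J) v t \<and>
       t \<le> c * length (encode \<Sigma> ar J) ^ k + c"
      using t(2) by blast
  qed
  then show ?thesis
    unfolding endogenous_mx_in_P_def poly_time_solvable_def using M(1) by blast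
qed

end
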